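(* Let $r\ge1$ and let $(G_n)$ be a sequence of graphs satisfying the geometry condition with parameter $r$. Let $\Psi:\mathbb{R}\to(0,1)$ be onto, strictly increasing, differentiable, and suppose that $\Psi'/(\Psi(1-\Psi))$ is uniformly bounded. Suppose one observes independent $\{0,1\}$-valued variables $Y_1,\dots,Y_n$ with $P_0(Y_i=1)=p_0(i)$ for $i=1,\dots,n$, where $p_0=p_{0,n}$ is a $(0,1)$-valued function on $G_n$. Assume that $\Psi^{-1}(p_0)\in H^\beta(C)$ for every $n$, where $\beta,C>0$ do not depend on $n$. (i) (Power of the Laplacian.) If $\alpha>0$ is fixed, $\beta\le\alpha+r/2$, and the prior on $p$ is the law of $\Psi(f)$, for $f$ given by $$c\sim\mathrm{Exp}(1),\qquad f\mid c\sim N\Big(0,\Big(\big((n/c)^{2/r}(L+n^{-2}I)\big)^{\alpha+r/2}\Big)^{-1}\Big),$$ then the posterior contracts around $p_0$ at the rate $n^{-\beta/(r+2\beta)}$. (ii) (Exponential of the Laplacian.) If the prior on $p$ is the law of $\Psi(f)$, for $f$ given by $$c\sim\mathrm{Exp}(1),\qquad f\mid c\sim N\big(0,\,n\,e^{-(n/c)^{2/r}L}\big),$$ then the posterior contracts around $p_0$ at the rate $n^{-\beta/(r+2\beta)}\log^{\kappa}n$ for some $\kappa>0$.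
   Context: Graphs: $n$ tends to infinity through an infinite set of positive integers, and for each such $n$, $G=G_n$ is a connected, simple (no loops, multiple edges or weights), undirected graph with vertices $1,\dots,n$. Let $A_G$ be its adjacency matrix, $D$ the diagonal matrix of vertex degrees, and $L=L_n=D-A_G$ its Laplacian, with eigenvalues $0=\lambda_0<\lambda_1\le\dots\le\lambda_{n-1}$ (dependence on $n$ suppressed). $I$ is the identity matrix; powers and exponentials of symmetric matrices are defined spectrally. Geometry condition with parameter $r\ge1$: there exist $i_0\in\mathbb{N}$, $\kappa_0\in(0,1]$ and $C_1,C_2>0$ (not depending on $n$) such that for all $n$ large enough, $C_1(i/n)^{2/r}\le\lambda_i\le C_2(i/n)^{2/r}$ for all integers $i_0\le i\le\kappa_0 n$, $i\le n-1$. A function $f$ on $G_n$ is identified with the vector $(f(1),\dots,f(n))\in\mathbb{R}^n$; $\Psi(f)$ and $\Psi^{-1}(p)$ are taken coordinatewise. $\langle f,g\rangle_n=\frac1n\sum_{i=1}^nf(i)g(i)$ and $\|f\|_n^2=\langle f,f\rangle_n$. For $\beta,C>0$ (independent of $n$), $H^\beta(C)=\{f:\langle f,(I+(n^{2/r}L)^\beta)f\rangle_n\le C^2\}$. $\mathrm{Exp}(1)$ is the standard exponential distribution; $N(0,\Sigma)$ is the centered Gaussian law on $\mathbb{R}^n$ with covariance matrix $\Sigma$. For a prior $\Pi$ on $p$, $\Pi(\cdot\mid Y_1,\dots,Y_n)$ denotes the corresponding posterior distribution. For positive numbers $\varepsilon_n\to0$, the posterior is said to contract around $p_0$ at the rate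 $\varepsilon_n$ if for all large enough $M>0$, $\Pi(p:\|p-p_0\|_n\ge M\varepsilon_n\mid Y_1,\dots,Y_n)\to0$ in probability, as $n\to\infty$, under the law $P_0$ of the data with true function $p_0$. *)

theory Defs
  imports
    "HOL-Probability.Probability"
    "Graph_Theory.Graph_Theory"
    "Jordan_Normal_Form.Char_Poly"
begin

text \<open>
  The vertices 1, ..., n are represented by 0, ..., n - 1, to fit the indexing of the matrix
  library. A function on the graph with n vertices is a function on nat of which only the values
  on {..<n} matter; laws of random functions live on the product sigma-algebra over {..<n}.
\<close>

subsection \<open>Graphs and Laplacians\<close>

definition conn_graph :: "nat \<Rightarrow> nat pair_pre_digraph \<Rightarrow> bool" where
  "conn_graph n G \<longleftrightarrow> pair_graph G \<and> pverts G = {..<n} \<and> Digraph_Component.connected (with_proj G)"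

definition adjacency_mat :: "nat \<Rightarrow> nat pair_pre_digraph \<Rightarrow> real mat" where
  "adjacency_mat n G = Matrix.mat n n (\<lambda>(i, j). if (i, j) \<in> parcs G then 1 else 0)"

text \<open>An undirected edge is a pair of opposite arcs, so the out-degree is the vertex degree.\<close>

definition degree_mat :: "nat \<Rightarrow> nat pair_pre_digraph \<Rightarrow> real mat" where
  "degree_mat n G = mat_diag n (\<lambda>i. real (out_degree (with_proj G) i))"

definition laplacian :: "nat \<Rightarrow> nat pair_pre_digraph \<Rightarrow> real mat" where
  "laplacian n G = degree_mat n G - adjacency_mat n G"

text \<open>
  The i-th smallest eigenvalue, counted with multiplicity and starting from i = 0. (A real
  symmetric matrix of size n has exactly n real eigenvalues with multiplicity.)
\<close>

definition laplacian_eigenvalue :: "nat \<Rightarrow> nat pair_pre_digraph \<Rightarrow> nat \<Rightarrow> real" where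
  "laplacian_eigenvalue n G i = sorted_list_of_multiset (proots (char_poly (laplacian n G))) ! i"

text \<open>The filter of n tending to infinity through the infinite set N.\<close>

definition at_top_in :: "nat set \<Rightarrow> nat filter" where
  "at_top_in N = inf sequentially (principal N)"

definition geometry_condition :: "real \<Rightarrow> nat set \<Rightarrow> (nat \<Rightarrow> nat pair_pre_digraph) \<Rightarrow> bool" where
  "geometry_condition r N G \<longleftrightarrow>
    (\<exists>(i0::nat) (\<kappa>0::real) (C1::real) (C2::real).
      0 < \<kappa>0 \<and> \<kappa>0 \<le> 1 \<and> 0 < C1 \<and> 0 < C2 \<and>
      (\<forall>\<^sub>F n in at_top_in N. \<forall>i. i0 \<le> i \<and> real i \<le> \<kappa>0 * real n \<and> i \<le> n - 1 \<longrightarrow>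
        C1 * (real i / real n) powr (2 / r) \<le> laplacian_eigenvalue n (G n) i \<and>
        laplacian_eigenvalue n (G n) i \<le> C2 * (real i / real n) powr (2 / r)))"

subsection \<open>Spectral calculus of real symmetric matrices\<close>

text \<open>
  For symmetric A the matrix B below exists and does not depend on the orthogonal
  diagonalization of A. For other A the value is unspecified.
\<close>

definition spectral_fun :: "(real \<Rightarrow> real) \<Rightarrow> real mat \<Rightarrow> real mat" where
  "spectral_fun g A = (THE B. \<exists>U d. U \<in> carrier_mat (dim_row A) (dim_row A) \<and>
      transpose_mat U * U = 1\<^sub>m (dim_row A) \<and>
      A = U * mat_diag (dim_row A) d * transpose_mat U \<and>
      B = U * mat_diag (dim_row A) (\<lambda>i. g (d i)) * transpose_mat U)"

abbreviation mat_powr :: "real mat \<Rightarrow> real \<Rightarrow> real mat" where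
  "mat_powr A s \<equiv> spectral_fun (\<lambda>x. x powr s) A"

abbreviation mat_exp :: "real mat \<Rightarrow> real mat" where
  "mat_exp A \<equiv> spectral_fun exp A"

abbreviation mat_inv :: "real mat \<Rightarrow> real mat" where
  "mat_inv A \<equiv> spectral_fun inverse A"

subsection \<open>Functions on the graph\<close>

definition mat_app :: "nat \<Rightarrow> real mat \<Rightarrow> (nat \<Rightarrow> real) \<Rightarrow> (nat \<Rightarrow> real)" where
  "mat_app n A f = (\<lambda>i\<in>{..<n}. \<Sum>j<n. A $$ (i, j) * f j)"

definition inner_n :: "nat \<Rightarrow> (nat \<Rightarrow> real) \<Rightarrow> (nat \<Rightarrow> real) \<Rightarrow> real" where
  "inner_n n f g = (\<Sum>i<n. f i * g i) / real n"

definition norm_n :: "nat \<Rightarrow> (nat \<Rightarrow> real) \<Rightarrow> real" where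
  "norm_n n f = sqrt (inner_n n f f)"

definition sobolev_ball ::
    "real \<Rightarrow> nat \<Rightarrow> nat pair_pre_digraph \<Rightarrow> real \<Rightarrow> real \<Rightarrow> (nat \<Rightarrow> real) set" where
  "sobolev_ball r n G \<beta> C =
    {f. inner_n n f (mat_app n (1\<^sub>m n + mat_powr (real n powr (2 / r) \<cdot>\<^sub>m laplacian n G) \<beta>) f) \<le> C\<^sup>2}"

subsection \<open>Priors\<close>

text \<open>N(0, S) is the law of the vector S^(1/2) Z for Z with independent standard normal entries.\<close>

definition centered_gaussian :: "nat \<Rightarrow> real mat \<Rightarrow> (nat \<Rightarrow> real) measure" where
  "centered_gaussian n S =
    distr (PiM {..<n} (\<lambda>_. density lborel std_normal_density)) (PiM {..<n} (\<lambda>_. borel))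
      (mat_app n (spectral_fun sqrt S))"

definition exp1 :: "real measure" where
  "exp1 = density lborel (exponential_density 1)"

text \<open>
  The law of f if c has law Exp(1) and f given c has law N(0, S c). The values of S at
  c \<open>\<le>\<close> 0 are irrelevant, since these c form a null set.
\<close>

definition gaussian_mixture :: "nat \<Rightarrow> (real \<Rightarrow> real mat) \<Rightarrow> (nat \<Rightarrow> real) measure" where
  "gaussian_mixture n S = Giry_Monad.bind exp1 (\<lambda>c. centered_gaussian n (S c))"

definition power_cov :: "real \<Rightarrow> real \<Rightarrow> nat \<Rightarrow> nat pair_pre_digraph \<Rightarrow> real \<Rightarrow> real mat" where
  "power_cov r \<alpha> n G c =
    mat_inv (mat_powr ((real n / c) powr (2 / r) \<cdot>\<^sub>m (laplacian n G + (1 / (real n)\<^sup>2) \<cdot>\<^sub>m 1\<^sub>m n))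
      (\<alpha> + r / 2))"

definition exp_cov :: "real \<Rightarrow> nat \<Rightarrow> nat pair_pre_digraph \<Rightarrow> real \<Rightarrow> real mat" where
  "exp_cov r n G c = real n \<cdot>\<^sub>m mat_exp ((- ((real n / c) powr (2 / r))) \<cdot>\<^sub>m laplacian n G)"

definition link_law :: "nat \<Rightarrow> (real \<Rightarrow> real) \<Rightarrow> (nat \<Rightarrow> real) measure \<Rightarrow> (nat \<Rightarrow> real) measure" where
  "link_law n \<Psi> M = distr M (PiM {..<n} (\<lambda>_. borel)) (compose {..<n} \<Psi>)"

definition power_prior ::
    "(real \<Rightarrow> real) \<Rightarrow> real \<Rightarrow> real \<Rightarrow> nat \<Rightarrow> nat pair_pre_digraph \<Rightarrow> (nat \<Rightarrow> real) measure" where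
  "power_prior \<Psi> r \<alpha> n G = link_law n \<Psi> (gaussian_mixture n (power_cov r \<alpha> n G))"

definition exp_prior ::
    "(real \<Rightarrow> real) \<Rightarrow> real \<Rightarrow> nat \<Rightarrow> nat pair_pre_digraph \<Rightarrow> (nat \<Rightarrow> real) measure" where
  "exp_prior \<Psi> r n G = link_law n \<Psi> (gaussian_mixture n (exp_cov r n G))"

subsection \<open>Observations, posterior and contraction\<close>

text \<open>The outcomes 1 and 0 of the observations are represented by True and False.\<close>

definition data_law :: "nat \<Rightarrow> (nat \<Rightarrow> real) \<Rightarrow> (nat \<Rightarrow> bool) pmf" where
  "data_law n p = Pi_pmf {..<n} False (\<lambda>i. bernoulli_pmf (p i))"

definition likelihood :: "nat \<Rightarrow> (nat \<Rightarrow> real) \<Rightarrow> (nat \<Rightarrow> bool) \<Rightarrow> real" where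
  "likelihood n p Y = (\<Prod>i<n. if Y i then p i else 1 - p i)"

text \<open>
  Bayes' formula; for priors concentrated on functions with values in (0,1) the normalizing
  integral is positive for every Y.
\<close>

definition posterior ::
    "nat \<Rightarrow> (nat \<Rightarrow> real) measure \<Rightarrow> (nat \<Rightarrow> bool) \<Rightarrow> (nat \<Rightarrow> real) measure" where
  "posterior n \<mu> Y = density \<mu> (\<lambda>p. ennreal (likelihood n p Y / (\<integral>q. likelihood n q Y \<partial>\<mu>)))"

definition contracts ::
    "nat set \<Rightarrow> (nat \<Rightarrow> (nat \<Rightarrow> real) measure) \<Rightarrow> (nat \<Rightarrow> nat \<Rightarrow> real) \<Rightarrow> (nat \<Rightarrow> real) \<Rightarrow> bool" where
  "contracts N \<mu> p0 \<epsilon> \<longleftrightarrow>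
    (\<forall>\<^sub>F M::real in at_top. \<forall>\<delta>>0.
      ((\<lambda>n. measure_pmf.prob (data_law n (p0 n))
          {Y. measure (posterior n (\<mu> n) Y)
                {p \<in> space (\<mu> n). norm_n n (\<lambda>i. p i - p0 n i) \<ge> M * \<epsilon> n} > \<delta>})
        \<longlongrightarrow> 0) (at_top_in N))"

end

theory Submission
  imports
    Defs
    "HOL-Computational_Algebra.Fundamental_Theorem_Algebra"
    "Jordan_Normal_Form.Schur_Decomposition"
begin

text \<open>
  In an orthonormal eigenbasis of the Laplacian, the function \<open>f\<close> given \<open>c\<close> has independent
  \<open>N(0, v c j)\<close> coordinates, where \<open>v\<close> increases in \<open>c\<close>; this uses the rotation invariance of the
  standard normal law. All norms below are Euclidean, so the squared rate appears multiplied by \<open>n\<close>.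

  The prior mass of a ball around the truth is bounded below through the Laplace transform of the
  squared distance, a product over the coordinates of
  \<open>(1 + 2 v)\<^sup>-\<^sup>1\<^sup>/\<^sup>2 exp (- g\<^sup>2 / (1 + 2 v))\<close> with \<open>g\<close> the coordinates of the truth. As sieve serves
  the ellipsoid \<open>\<Sum> g\<^sub>j\<^sup>2 / (1 + v\<^sub>j) \<le> R\<close>: its complement has small probability by an exponential moment
  bound for \<open>\<chi>\<^sup>2\<close> variables, and truncating the coordinates to integers gives a net whose cardinality
  is a lattice point count. Both bounds are governed by the complexity \<open>\<Sum> ln (1 + v\<^sub>j)\<close>. A random
  scale \<open>c\<close> larger than a multiple of the prior mass exponent has negligible probability.

  Since the logit of the link function is Lipschitz, Hoeffding's lemma controls the likelihood
  ratios, and Hoeffding's inequality yields least squares tests of the truth against the net points.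
  Lower bounds on the eigenvalues bound the complexity, and hence the entropy and the prior mass exponent.
\<close>

section \<open>Spectral decomposition of the Laplacian\<close>

text \<open>The Laplace transform gives the price of a centred ball and the price of moving it to
  the truth in one explicit exponent. What shapes the rest is the random scale. If
  \<open>exp (- 2 * B)\<close> is the order of the prior mass near the truth, the evidence bound
  loses this factor and, with \<open>K\<close> the Lipschitz constant of the link, another
  \<open>exp (- 4 * K\<^sup>2 * B)\<close> from the likelihood ratio. The part of the prior outside
  the sieve must therefore be as small as \<open>exp (- (4 * K\<^sup>2 + 3) * B)\<close>, which
  forces the cutoff of \<open>c\<close> up to \<open>(4 * K\<^sup>2 + 3) * B\<close>, whatever the
  order of magnitude of \<open>c\<close> that suits the truth. As \<open>v\<close> increases in
  \<open>c\<close>, the ellipsoid at the cutoff serves all smaller scales, but its complexity enters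
  the entropy. Hence two exponents, \<open>B\<close> for the prior mass and \<open>H\<close> for the
  entropy, and the squared rate is \<open>H / n\<close>. For the power prior the complexity is of
  order c + ln n, and both exponents have the same order. For the exponential prior it is of order c
  (ln n)^(1 + r/2): \<open>B\<close> carries one logarithmic factor, the cutoff inherits it,
  \<open>H\<close> carries two, and the square root leaves \<kappa> = 1 + r/2.\<close>

lemma mult_mat_vec_index_sum:
  "A \<in> carrier_mat n n \<Longrightarrow> v \<in> carrier_vec n \<Longrightarrow> i < n \<Longrightarrow> (A *\<^sub>v v) $ i = (\<Sum>j<n. A $$ (i, j) * v $ j)"
  by (simp add: scalar_prod_def lessThan_atLeast0)

lemma symmetric_bilinear_commute:
  fixes x y :: "nat \<Rightarrow> real"
  assumes "\<And>i j. i < n \<Longrightarrow> j < n \<Longrightarrow> a i j = a j i"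
  shows "(\<Sum>i<n. y i * (\<Sum>j<n. a i j * x j)) = (\<Sum>i<n. x i * (\<Sum>j<n. a i j * y j))"
proof -
  have "(\<Sum>i<n. y i * (\<Sum>j<n. a i j * x j)) = (\<Sum>j<n. \<Sum>i<n. y i * (a i j * x j))"
    unfolding sum_distrib_left by (rule sum.swap)
  also have "\<dots> = (\<Sum>i<n. x i * (\<Sum>j<n. a i j * y j))"
    unfolding sum_distrib_left by (intro sum.cong refl) (auto simp: assms)
  finally show ?thesis .
qed

text \<open>The fundamental theorem of algebra yields a complex eigenvector x + i y. Symmetry makes
  the eigenvalue real, so x and y are themselves real eigenvectors or zero, and not both
  vanish.\<close>

lemma real_symmetric_eigenvector:
  fixes A :: "real mat"
  assumes A: "A \<in> carrier_mat n n" and sym: "transpose_mat A = A" and n: "n > 0"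
  obtains v e where "v \<in> carrier_vec n" "v \<noteq> 0\<^sub>v n" "A *\<^sub>v v = e \<cdot>\<^sub>v v"
proof -
  let ?A = "map_mat complex_of_real A"
  have cA: "?A \<in> carrier_mat n n" using A by auto
  have "degree (char_poly ?A) = n" using degree_monic_char_poly[OF cA] by simp
  then have "\<not> constant (poly (char_poly ?A))" using n by (simp add: constant_degree)
  then obtain \<mu> where "poly (char_poly ?A) \<mu> = 0" using fundamental_theorem_of_algebra by blast
  then have "eigenvalue ?A \<mu>" using eigenvalue_root_char_poly[OF cA] by simp
  then obtain w where w: "w \<in> carrier_vec n" "w \<noteq> 0\<^sub>v n" "?A *\<^sub>v w = \<mu> \<cdot>\<^sub>v w"
    unfolding eigenvalue_def eigenvector_def using A by auto
  define a where "a i j = A $$ (i, j)" for i j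
  have asym: "a i j = a j i" if "i < n" "j < n" for i j
    using that A sym unfolding a_def by (metis carrier_matD index_transpose_mat(1))
  define x y where "x i = Re (w $ i)" and "y i = Im (w $ i)" for i
  have ev: "(\<Sum>j<n. of_real (a i j) * w $ j) = \<mu> * w $ i" if "i < n" for i
  proof -
    have "(?A *\<^sub>v w) $ i = \<mu> * w $ i" using w that by simp
    moreover have "(?A *\<^sub>v w) $ i = (\<Sum>j<n. ?A $$ (i, j) * w $ j)"
      using mult_mat_vec_index_sum[OF cA w(1) that] .
    moreover have "\<dots> = (\<Sum>j<n. of_real (a i j) * w $ j)"
      by (rule sum.cong) (use A that in \<open>auto simp: a_def\<close>)
    ultimately show ?thesis by simp
  qed
  have xe: "(\<Sum>j<n. a i j * x j) = Re \<mu> * x i - Im \<mu> * y i"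
    and ye: "(\<Sum>j<n. a i j * y j) = Re \<mu> * y i + Im \<mu> * x i" if "i < n" for i
    using arg_cong[OF ev[OF that], of Re] arg_cong[OF ev[OF that], of Im]
    by (simp_all add: x_def y_def)
  \<comment> \<open>This equates the bilinear form of \<open>a\<close> at (y, x) and at (x, y). The
    terms with \<open>Re \<mu>\<close> cancel, and \<open>Im \<mu>\<close> times the squared norm of
    the eigenvector remains.\<close>
  have "(\<Sum>i<n. y i * (Re \<mu> * x i - Im \<mu> * y i)) = (\<Sum>i<n. x i * (Re \<mu> * y i + Im \<mu> * x i))"
    using symmetric_bilinear_commute[of n a y x] asym by (simp add: xe ye)
  then have "Im \<mu> * (\<Sum>i<n. (x i)\<^sup>2 + (y i)\<^sup>2) = 0"
    by (simp add: sum_distrib_left sum.distrib sum_subtractf algebra_simps power2_eq_square)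
  moreover have "(\<Sum>i<n. (x i)\<^sup>2 + (y i)\<^sup>2) \<noteq> 0"
  proof
    assume "(\<Sum>i<n. (x i)\<^sup>2 + (y i)\<^sup>2) = 0"
    then have "\<forall>i<n. (x i)\<^sup>2 + (y i)\<^sup>2 = 0" by (subst (asm) sum_nonneg_eq_0_iff) auto
    then have "\<forall>i<n. w $ i = 0" by (simp add: x_def y_def complex_eq_iff)
    then have "w = 0\<^sub>v n" using w(1) by (intro eq_vecI) auto
    then show False using w by simp
  qed
  ultimately have im: "Im \<mu> = 0" by simp
  have ev_vec: "A *\<^sub>v vec n z = Re \<mu> \<cdot>\<^sub>v vec n z" if "\<And>i. i < n \<Longrightarrow> (\<Sum>j<n. a i j * z j) = Re \<mu> * z i" for z
  proof (rule eq_vecI)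
    fix i assume "i < dim_vec (Re \<mu> \<cdot>\<^sub>v vec n z)"
    then have "i < n" by simp
    then show "(A *\<^sub>v vec n z) $ i = (Re \<mu> \<cdot>\<^sub>v vec n z) $ i"
      using that[OF \<open>i < n\<close>] by (subst mult_mat_vec_index_sum[OF A]) (auto simp: a_def)
  qed (use A in auto)
  have "vec n x \<noteq> 0\<^sub>v n \<or> vec n y \<noteq> 0\<^sub>v n"
  proof (rule ccontr)
    assume "\<not> ?thesis"
    then have z: "vec n x = 0\<^sub>v n" "vec n y = 0\<^sub>v n" by auto
    have "w $ i = 0" if "i < n" for i
      using arg_cong[OF z(1), of "\<lambda>v. v $ i"] arg_cong[OF z(2), of "\<lambda>v. v $ i"] that
      by (simp add: x_def y_def complex_eq_iff)
    then have "w = 0\<^sub>v n" using w(1) by (intro eq_vecI) auto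
    then show False using w by simp
  qed
  then show thesis
    using that[of "vec n x" "Re \<mu>"] that[of "vec n y" "Re \<mu>"] ev_vec[of x] ev_vec[of y] xe ye im
    by auto
qed

text \<open>Complete \<open>v\<close> to a basis and orthogonalize: Gram-Schmidt leaves the first
  vector unchanged, so after normalization the first column is a multiple of
  \<open>v\<close>.\<close>

lemma orthogonal_matrix_first_column:
  fixes v :: "real vec"
  assumes v: "v \<in> carrier_vec n" and v0: "v \<noteq> 0\<^sub>v n"
  obtains W c where "W \<in> carrier_mat n n" "transpose_mat W * W = 1\<^sub>m n" "col W 0 = c \<cdot>\<^sub>v v"
proof -
  have n: "n > 0"
  proof (rule ccontr)
    assume "\<not> 0 < n"
    then have "v = 0\<^sub>v n" using v by (intro eq_vecI) auto
    then show False using v0 by simp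
  qed
  interpret cof_vec_space n "TYPE(real)" .
  define b where "b = basis_completion v"
  note bc = basis_completion[OF v v0, folded b_def]
  obtain vs where bv: "b = v # vs" using bc n by (cases b) auto
  define ws where "ws = gram_schmidt n b"
  note gs = gram_schmidt_result[OF bc(2,4,5) ws_def]
  have hdws: "hd ws = v" using gram_schmidt_hd[OF v, of vs] by (simp add: ws_def bv)
  have len: "length ws = n" using gs bc by simp
  have wsc: "ws ! i \<in> carrier_vec n" if "i < n" for i using gs(3) len that nth_mem by blast
  have orth: "(ws ! i \<bullet> ws ! j = 0) = (i \<noteq> j)" if "i < n" "j < n" for i j
    using corthogonalD[OF gs(2), of i j] that len by simp
  define q where "q i = ws ! i \<bullet> ws ! i" for i
  have q: "q i > 0" if "i < n" for i
  proof -
    have "q i \<ge> 0" unfolding q_def scalar_prod_def by (intro sum_nonneg) auto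
    moreover have "q i \<noteq> 0" using orth[OF that that] by (simp add: q_def)
    ultimately show ?thesis by simp
  qed
  define us where "us = map (\<lambda>i. (1 / sqrt (q i)) \<cdot>\<^sub>v (ws ! i)) [0..<n]"
  define W where "W = mat_of_cols n us"
  have us: "us ! i = (1 / sqrt (q i)) \<cdot>\<^sub>v (ws ! i)" if "i < n" for i using that by (simp add: us_def)
  have W: "W \<in> carrier_mat n n" unfolding W_def us_def by auto
  have colW: "col W i = us ! i" if "i < n" for i
    unfolding W_def by (rule col_mat_of_cols) (use that us wsc in \<open>auto simp: us_def\<close>)
  have "transpose_mat W * W = 1\<^sub>m n"
  proof (rule eq_matI)
    fix i j assume "i < dim_row (1\<^sub>m n :: real mat)" "j < dim_col (1\<^sub>m n :: real mat)"
    then have ij: "i < n" "j < n" by auto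
    have "(transpose_mat W * W) $$ (i, j) = us ! i \<bullet> us ! j"
      using ij W colW by simp
    also have "\<dots> = (1 / sqrt (q i)) * ((1 / sqrt (q j)) * (ws ! i \<bullet> ws ! j))"
      using us[OF ij(1)] us[OF ij(2)] wsc[OF ij(1)] wsc[OF ij(2)] by simp
    also have "\<dots> = 1\<^sub>m n $$ (i, j)"
      using ij orth[OF ij] q[OF ij(1)] by (cases "i = j") (auto simp: q_def)
    finally show "(transpose_mat W * W) $$ (i, j) = 1\<^sub>m n $$ (i, j)" .
  qed (use W in auto)
  moreover have "col W 0 = (1 / sqrt (q 0)) \<cdot>\<^sub>v v"
    using colW[OF n] us[OF n] hdws len n hd_conv_nth[of ws] by auto
  ultimately show thesis using that[OF W] by blast
qed

lemma orthogonal_mat_transpose: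
  fixes U :: "real mat"
  assumes "U \<in> carrier_mat n n" "transpose_mat U * U = 1\<^sub>m n"
  shows "U * transpose_mat U = 1\<^sub>m n"
  using mat_mult_left_right_inverse[of "transpose_mat U" n U] assms by simp

lemma block_diag_mult:
  assumes "A \<in> carrier_mat k k" "A' \<in> carrier_mat k k" "D \<in> carrier_mat m m" "D' \<in> carrier_mat m m"
  shows "four_block_mat A (0\<^sub>m k m) (0\<^sub>m m k) D * four_block_mat A' (0\<^sub>m k m) (0\<^sub>m m k) (D' :: real mat) =
    four_block_mat (A * A') (0\<^sub>m k m) (0\<^sub>m m k) (D * D')"
  using assms by (subst mult_four_block_mat[where ?nr1.0=k and ?n1.0=k and ?n2.0=m and ?nr2.0=m and ?nc1.0=k and ?nc2.0=m]) auto

text \<open>Deflation: in an orthonormal basis that starts with an eigenvector, the first column of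
  the matrix vanishes off the diagonal, by symmetry so does the first row, and the induction
  hypothesis applies to the remaining block.\<close>

theorem real_symmetric_diagonalization:
  fixes A :: "real mat"
  assumes "A \<in> carrier_mat n n" "transpose_mat A = A"
  shows "\<exists>U d. U \<in> carrier_mat n n \<and> transpose_mat U * U = 1\<^sub>m n \<and> A = U * mat_diag n d * transpose_mat U"
  using assms
proof (induction n arbitrary: A)
  case 0
  show ?case
    by (intro exI[of _ "1\<^sub>m 0"] exI[of _ "\<lambda>_. 0"] conjI) (use 0 in \<open>auto intro!: eq_matI\<close>)
next
  case (Suc m)
  let ?n = "Suc m"
  obtain v e where v: "v \<in> carrier_vec ?n" "v \<noteq> 0\<^sub>v ?n" "A *\<^sub>v v = e \<cdot>\<^sub>v v"
    using real_symmetric_eigenvector[OF Suc.prems] by auto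
  obtain W c where W: "W \<in> carrier_mat ?n ?n" and WW: "transpose_mat W * W = 1\<^sub>m ?n"
    and cW: "col W 0 = c \<cdot>\<^sub>v v"
    using orthogonal_matrix_first_column[OF v(1,2)] by blast
  note A = Suc.prems(1)
  have WT: "transpose_mat W \<in> carrier_mat ?n ?n" using W by simp
  have WW': "W * transpose_mat W = 1\<^sub>m ?n" using orthogonal_mat_transpose[OF W WW] .
  define B where "B = transpose_mat W * (A * W)"
  have B: "B \<in> carrier_mat ?n ?n" using A W unfolding B_def by auto
  have Bsym: "transpose_mat B = B"
  proof -
    have "transpose_mat B = transpose_mat (A * W) * W"
      unfolding B_def using transpose_mult[OF WT, of "A * W" ?n] A W by simp
    also have "transpose_mat (A * W) = transpose_mat W * A"
      using transpose_mult[OF A W] Suc.prems(2) by simp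
    finally show ?thesis unfolding B_def using assoc_mult_mat[OF WT A W] by simp
  qed
  have col0: "B $$ (i, 0) = (if i = 0 then e else 0)" if "i < ?n" for i
  proof -
    have "col (A * W) 0 = A *\<^sub>v col W 0" using col_mult2[OF A W, of 0] by simp
    also have "\<dots> = c \<cdot>\<^sub>v (A *\<^sub>v v)" unfolding cW using mult_mat_vec[OF A v(1)] by simp
    also have "\<dots> = e \<cdot>\<^sub>v col W 0" unfolding cW v(3) by (simp add: smult_smult_assoc mult.commute)
    finally have "B $$ (i, 0) = e * (col W i \<bullet> col W 0)"
      unfolding B_def using that W A by simp
    moreover have "col W i \<bullet> col W 0 = (transpose_mat W * W) $$ (i, 0)" using that W by simp
    ultimately show ?thesis using that unfolding WW by simp
  qed
  have row0: "B $$ (0, i) = (if i = 0 then e else 0)" if "i < ?n" for i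
    using col0[OF that] Bsym B that by (metis carrier_matD index_transpose_mat(1) zero_less_Suc)
  define B' where "B' = Matrix.mat m m (\<lambda>(i, j). B $$ (Suc i, Suc j))"
  have B': "B' \<in> carrier_mat m m" unfolding B'_def by simp
  have "transpose_mat B' = B'"
  proof (rule eq_matI)
    fix i j assume "i < dim_row B'" "j < dim_col B'"
    then have ij: "i < m" "j < m" unfolding B'_def by auto
    have "B $$ (Suc j, Suc i) = B $$ (Suc i, Suc j)"
      using Bsym B ij by (metis Suc_mono carrier_matD index_transpose_mat(1))
    then show "transpose_mat B' $$ (i, j) = B' $$ (i, j)" unfolding B'_def using ij by simp
  qed (auto simp: B'_def)
  from Suc.IH[OF B' this] obtain V d where V: "V \<in> carrier_mat m m"
    and VV: "transpose_mat V * V = 1\<^sub>m m" and B'_eq: "B' = V * mat_diag m d * transpose_mat V" by blast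
  define X where "X = four_block_mat (1\<^sub>m 1) (0\<^sub>m 1 m) (0\<^sub>m m 1) V"
  define \<delta> where "\<delta> = (\<lambda>i. case i of 0 \<Rightarrow> e | Suc i \<Rightarrow> d i)"
  have X: "X \<in> carrier_mat ?n ?n" unfolding X_def using V by (metis four_block_carrier_mat one_carrier_mat plus_1_eq_Suc)
  have XT: "transpose_mat X = four_block_mat (1\<^sub>m 1) (0\<^sub>m 1 m) (0\<^sub>m m 1) (transpose_mat V)"
    unfolding X_def using V by (subst transpose_four_block_mat[where ?nr1.0=1 and ?nc1.0=1 and ?nr2.0=m and ?nc2.0=m]) auto
  have XX: "transpose_mat X * X = 1\<^sub>m ?n"
    unfolding XT unfolding X_def
    using V VV by (simp add: block_diag_mult[where m = m and k = "Suc 0"])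
  have D: "mat_diag ?n \<delta> = four_block_mat (mat_diag 1 (\<lambda>_. e)) (0\<^sub>m 1 m) (0\<^sub>m m 1) (mat_diag m d)"
    unfolding mat_diag_def \<delta>_def by (rule eq_matI) (auto split: nat.split)
  have B_eq: "B = four_block_mat (mat_diag 1 (\<lambda>_. e)) (0\<^sub>m 1 m) (0\<^sub>m m 1) B'"
  proof (rule eq_matI)
    fix i j assume "i < dim_row (four_block_mat (mat_diag 1 (\<lambda>_. e)) (0\<^sub>m 1 m) (0\<^sub>m m 1) B')"
      "j < dim_col (four_block_mat (mat_diag 1 (\<lambda>_. e)) (0\<^sub>m 1 m) (0\<^sub>m m 1) B')"
    then have "i < ?n" "j < ?n" by (auto simp: B'_def mat_diag_def)
    then show "B $$ (i, j) = four_block_mat (mat_diag 1 (\<lambda>_. e)) (0\<^sub>m 1 m) (0\<^sub>m m 1) B' $$ (i, j)"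
      using col0[of i] row0[of j] by (cases i; cases j) (auto simp: B'_def mat_diag_def)
  qed (use B B' in \<open>auto simp: mat_diag_def\<close>)
  have "X * mat_diag ?n \<delta> * transpose_mat X = B"
    unfolding XT D unfolding X_def
    using V B'_eq by (simp add: left_mult_one_mat[of "mat_diag (Suc 0) (\<lambda>_. e)" "Suc 0" "Suc 0"] right_mult_one_mat[of "mat_diag (Suc 0) (\<lambda>_. e)" "Suc 0" "Suc 0"] block_diag_mult[where m = m and k = "Suc 0"] B_eq)
  then have XB: "B = X * mat_diag ?n \<delta> * transpose_mat X" by simp
  define U where "U = W * X"
  have U: "U \<in> carrier_mat ?n ?n" unfolding U_def using W X by simp
  have UT: "transpose_mat U = transpose_mat X * transpose_mat W"
    unfolding U_def using transpose_mult[OF W X] .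
  have XTc: "transpose_mat X \<in> carrier_mat ?n ?n" using X by simp
  have "transpose_mat U * U = transpose_mat X * ((transpose_mat W * W) * X)"
    unfolding UT unfolding U_def using W X WT XTc by (simp add: assoc_mult_mat[where ?n\<^sub>1="?n" and ?n\<^sub>2="?n" and ?n\<^sub>3="?n" and ?n\<^sub>4="?n"] mult_carrier_mat[where nr="?n" and n="?n" and nc="?n"])
  also have "\<dots> = 1\<^sub>m ?n" using WW XX X by simp
  finally have UU: "transpose_mat U * U = 1\<^sub>m ?n" .
  have "U * mat_diag ?n \<delta> * transpose_mat U = W * (X * mat_diag ?n \<delta> * transpose_mat X) * transpose_mat W"
    unfolding UT unfolding U_def using W X WT XTc mat_diag_dim[of ?n \<delta>]
    by (simp add: assoc_mult_mat[where ?n\<^sub>1="?n" and ?n\<^sub>2="?n" and ?n\<^sub>3="?n" and ?n\<^sub>4="?n"] mult_carrier_mat[where nr="?n" and n="?n" and nc="?n"])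
  also have "\<dots> = W * B * transpose_mat W" using XB by simp
  also have "\<dots> = (W * transpose_mat W) * A * (W * transpose_mat W)"
    unfolding B_def using W WT A by (simp add: assoc_mult_mat[where ?n\<^sub>1="?n" and ?n\<^sub>2="?n" and ?n\<^sub>3="?n" and ?n\<^sub>4="?n"] mult_carrier_mat[where nr="?n" and n="?n" and nc="?n"])
  also have "\<dots> = A" unfolding WW' using A by simp
  finally show ?case using U UU by metis
qed

section \<open>Functional calculus in a given eigenbasis\<close>

lemma spectral_sandwich_index:
  assumes "U \<in> carrier_mat n n" "i < n" "k < n"
  shows "(U * mat_diag n d * transpose_mat U) $$ (i, k) = (\<Sum>j<n. U $$ (i, j) * d j * U $$ (k, j))"
  using assms by (simp add: mat_diag_mult_right[of U n n] scalar_prod_def lessThan_atLeast0)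

lemma orthogonal_cols:
  assumes "U \<in> carrier_mat n n" "transpose_mat U * U = 1\<^sub>m n" "j < n" "k < n"
  shows "(\<Sum>i<n. U $$ (i, j) * U $$ (i, k)) = (if j = k then 1 else 0 :: real)"
proof -
  have "(transpose_mat U * U) $$ (j, k) = (\<Sum>i<n. U $$ (i, j) * U $$ (i, k))"
    using assms(1,3,4) by (simp add: scalar_prod_def lessThan_atLeast0)
  then show ?thesis using assms by simp
qed

lemma orthogonal_rows:
  assumes "U \<in> carrier_mat n n" "transpose_mat U * U = 1\<^sub>m n" "j < n" "k < n"
  shows "(\<Sum>i<n. U $$ (j, i) * U $$ (k, i)) = (if j = k then 1 else 0 :: real)"
proof -
  have "(U * transpose_mat U) $$ (j, k) = (\<Sum>i<n. U $$ (j, i) * U $$ (k, i))"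
    using assms(1,3,4) by (simp add: scalar_prod_def lessThan_atLeast0)
  then show ?thesis using orthogonal_mat_transpose[OF assms(1,2)] assms by simp
qed

text \<open>The definite description is justified by comparing two diagonalizations U d and V e. The
  matrix W = V^T U satisfies W_ij d_j = e_i W_ij, so d_j = e_i wherever W_ij is nonzero, and W also
  intertwines g(d) with g(e).\<close>

lemma spectral_fun_eq:
  assumes U: "U \<in> carrier_mat n n" and UU: "transpose_mat U * U = 1\<^sub>m n"
  shows "spectral_fun g (U * mat_diag n d * transpose_mat U) = U * mat_diag n (\<lambda>i. g (d i)) * transpose_mat U"
proof -
  let ?A = "U * mat_diag n d * transpose_mat U"
  have dim: "dim_row ?A = n" using U by simp
  have unique: "V * mat_diag n (\<lambda>i. g (e i)) * transpose_mat V = U * mat_diag n (\<lambda>i. g (d i)) * transpose_mat U"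
    if V: "V \<in> carrier_mat n n" and VV: "transpose_mat V * V = 1\<^sub>m n"
      and A: "?A = V * mat_diag n e * transpose_mat V" for V e
  proof -
    have UT: "transpose_mat U \<in> carrier_mat n n" and VT: "transpose_mat V \<in> carrier_mat n n"
      using U V by auto
    note UU' = orthogonal_mat_transpose[OF U UU] and VV' = orthogonal_mat_transpose[OF V VV]
    note assoc = assoc_mult_mat[where ?n\<^sub>1=n and ?n\<^sub>2=n and ?n\<^sub>3=n and ?n\<^sub>4=n]
      mult_carrier_mat[where nr=n and n=n and nc=n]
    have VVX: "transpose_mat V * (V * X) = X" if "X \<in> carrier_mat n n" for X
      using that V VT VV by (simp flip: assoc(1))
    define W where "W = transpose_mat V * U"
    have W: "W \<in> carrier_mat n n" unfolding W_def using U V by auto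
    have "W * mat_diag n d = transpose_mat V * ?A * U"
      unfolding W_def using U V UT VT UU by (simp add: assoc mat_diag_dim right_mult_one_mat[of "mat_diag n d" n n])
    also have "\<dots> = mat_diag n e * W"
      unfolding A W_def using U V UT VT VV by (simp add: assoc mat_diag_dim VVX)
    finally have comm: "W $$ (i, j) * d j = e i * W $$ (i, j)" if "i < n" "j < n" for i j
      using W that unfolding mat_diag_mult_right[OF W] mat_diag_mult_left[OF W]
      by (metis (no_types, lifting) case_prod_conv index_mat(1))
    have "W $$ (i, j) * g (d j) = g (e i) * W $$ (i, j)" if "i < n" "j < n" for i j
      using comm[OF that] by (cases "W $$ (i, j) = 0") (auto simp: mult.commute)
    then have WD: "W * mat_diag n (\<lambda>i. g (d i)) = mat_diag n (\<lambda>i. g (e i)) * W"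
      unfolding mat_diag_mult_right[OF W] mat_diag_mult_left[OF W] by (intro eq_matI) auto
    have "V * mat_diag n (\<lambda>i. g (e i)) * transpose_mat V =
        V * (mat_diag n (\<lambda>i. g (e i)) * W) * transpose_mat U"
      unfolding W_def using U V UT VT UU' by (simp add: assoc mat_diag_dim)
    also have "\<dots> = (V * transpose_mat V) * U * mat_diag n (\<lambda>i. g (d i)) * transpose_mat U"
      unfolding WD[symmetric] unfolding W_def using U V UT VT by (simp add: assoc mat_diag_dim)
    also have "\<dots> = U * mat_diag n (\<lambda>i. g (d i)) * transpose_mat U"
      unfolding VV' using U by simp
    finally show ?thesis .
  qed
  show ?thesis
    unfolding spectral_fun_def dim
  proof (rule the_equality)
    show "\<exists>V e. V \<in> carrier_mat n n \<and> transpose_mat V * V = 1\<^sub>m n \<and> ?A = V * mat_diag n e * transpose_mat V \<and>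
        U * mat_diag n (\<lambda>i. g (d i)) * transpose_mat U = V * mat_diag n (\<lambda>i. g (e i)) * transpose_mat V"
      using U UU by blast
  qed (use unique in metis)
qed

lemma spectral_smult:
  assumes "U \<in> carrier_mat n n"
  shows "(x::real) \<cdot>\<^sub>m (U * mat_diag n d * transpose_mat U) = U * mat_diag n (\<lambda>i. x * d i) * transpose_mat U"
  by (rule eq_matI)
     (use assms in \<open>auto simp: spectral_sandwich_index sum_distrib_left intro!: sum.cong simp del: index_mult_mat(1)\<close>)

lemma spectral_add_smult_one:
  assumes U: "U \<in> carrier_mat n n" and "transpose_mat U * U = 1\<^sub>m n"
  shows "U * mat_diag n d * transpose_mat U + (x::real) \<cdot>\<^sub>m 1\<^sub>m n =
    U * mat_diag n (\<lambda>i. d i + x) * transpose_mat U"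
proof (rule eq_matI)
  fix i k
  assume "i < dim_row (U * mat_diag n (\<lambda>i. d i + x) * transpose_mat U)"
    "k < dim_col (U * mat_diag n (\<lambda>i. d i + x) * transpose_mat U)"
  then have ik: "i < n" "k < n" using U by auto
  have "(\<Sum>j<n. U $$ (i, j) * (d j + x) * U $$ (k, j)) =
      (\<Sum>j<n. U $$ (i, j) * d j * U $$ (k, j)) + x * (\<Sum>j<n. U $$ (i, j) * U $$ (k, j))"
    by (simp add: sum_distrib_left sum.distrib algebra_simps)
  then show "(U * mat_diag n d * transpose_mat U + x \<cdot>\<^sub>m 1\<^sub>m n) $$ (i, k) =
      (U * mat_diag n (\<lambda>i. d i + x) * transpose_mat U) $$ (i, k)"
    using ik U orthogonal_rows[OF assms ik]
    by (simp add: spectral_sandwich_index del: index_mult_mat(1))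
qed (use U in auto)

lemma mat_app_spectral:
  assumes "U \<in> carrier_mat n n" "i < n"
  shows "mat_app n (U * mat_diag n d * transpose_mat U) f i = (\<Sum>j<n. U $$ (i, j) * d j * (\<Sum>k<n. U $$ (k, j) * f k))"
proof -
  have "mat_app n (U * mat_diag n d * transpose_mat U) f i =
      (\<Sum>k<n. (\<Sum>j<n. U $$ (i, j) * d j * U $$ (k, j)) * f k)"
    using assms by (simp add: mat_app_def spectral_sandwich_index del: index_mult_mat(1))
  also have "\<dots> = (\<Sum>j<n. U $$ (i, j) * d j * (\<Sum>k<n. U $$ (k, j) * f k))"
    unfolding sum_distrib_left sum_distrib_right by (subst sum.swap) (simp add: mult.assoc)
  finally show ?thesis .
qed

section \<open>The graph Laplacian: symmetry, positivity, ordered spectrum\<close>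

lemma laplacian_carrier: "laplacian n G \<in> carrier_mat n n"
  unfolding laplacian_def degree_mat_def adjacency_mat_def by auto

lemma laplacian_index:
  assumes "i < n" "j < n"
  shows "laplacian n G $$ (i, j) = (if i = j then real (out_degree (with_proj G) j) else 0) -
    (if (i, j) \<in> parcs G then 1 else 0)"
  using assms unfolding laplacian_def degree_mat_def adjacency_mat_def mat_diag_def by auto

lemma conn_graph_symmetric:
  assumes "conn_graph n G"
  shows "(i, j) \<in> parcs G \<longleftrightarrow> (j, i) \<in> parcs G"
proof -
  interpret pair_graph G using assms unfolding conn_graph_def by simp
  show ?thesis using pair_sym_arcs unfolding symmetric_def sym_def by auto
qed

lemma conn_graph_out_degree:
  assumes "conn_graph n G"
  shows "real (out_degree (with_proj G) i) = (\<Sum>j<n. if (i, j) \<in> parcs G then 1 else 0)"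
proof -
  interpret pair_graph G using assms unfolding conn_graph_def by simp
  have V: "pverts G = {..<n}" using assms unfolding conn_graph_def by simp
  have "out_arcs (with_proj G) i = Pair i ` {j \<in> {..<n}. (i, j) \<in> parcs G}"
    using arc_snd_in_verts unfolding out_arcs_def V by (force simp: image_iff)
  then have "out_degree (with_proj G) i = card {j \<in> {..<n}. (i, j) \<in> parcs G}"
    unfolding out_degree_def by (simp add: card_image inj_on_def)
  then show ?thesis by (simp add: sum.If_cases Int_def)
qed

lemma laplacian_symmetric:
  assumes "conn_graph n G"
  shows "transpose_mat (laplacian n G) = laplacian n G"
  by (rule eq_matI)
    (use laplacian_carrier[of n G] conn_graph_symmetric[OF assms] in \<open>auto simp: laplacian_index\<close>)

text \<open>Symmetrizing the double sum shows that twice the form is the sum of (x_i - x_j)^2 over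
  all arcs. The degrees are what turns the diagonal into differences.\<close>

lemma laplacian_nonneg_form:
  assumes G: "conn_graph n G"
  shows "(\<Sum>i<n. x i * (\<Sum>j<n. laplacian n G $$ (i, j) * x j)) \<ge> 0"
proof -
  define a :: "nat \<Rightarrow> nat \<Rightarrow> real" where "a i j = (if (i, j) \<in> parcs G then 1 else 0)" for i j
  have sym: "a i j = a j i" for i j using conn_graph_symmetric[OF G] unfolding a_def by auto
  have "(\<Sum>j<n. laplacian n G $$ (i, j) * x j) = (\<Sum>j<n. a i j * (x i - x j))" if "i < n" for i
  proof -
    have "(\<Sum>j<n. laplacian n G $$ (i, j) * x j) =
        (\<Sum>j<n. (if i = j then real (out_degree (with_proj G) j) * x j else 0) - a i j * x j)"
      using that by (intro sum.cong) (auto simp: laplacian_index a_def algebra_simps)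
    also have "\<dots> = real (out_degree (with_proj G) i) * x i - (\<Sum>j<n. a i j * x j)"
      using that by (simp add: sum_subtractf)
    also have "\<dots> = (\<Sum>j<n. a i j * (x i - x j))"
      unfolding conn_graph_out_degree[OF G] a_def
      by (simp add: sum_distrib_right sum_subtractf right_diff_distrib)
    finally show ?thesis .
  qed
  then have "(\<Sum>i<n. x i * (\<Sum>j<n. laplacian n G $$ (i, j) * x j)) = (\<Sum>i<n. \<Sum>j<n. a i j * (x i * (x i - x j)))" (is "?q = ?s")
    by (simp add: sum_distrib_left algebra_simps)
  moreover have "?s = (\<Sum>i<n. \<Sum>j<n. a i j * (x j * (x j - x i)))"
    by (subst sum.swap) (simp add: sym)
  ultimately have "2 * ?q = ?s + (\<Sum>i<n. \<Sum>j<n. a i j * (x j * (x j - x i)))" by linarith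
  also have "\<dots> = (\<Sum>i<n. \<Sum>j<n. a i j * (x i - x j)\<^sup>2)"
    unfolding sum.distrib[symmetric] by (simp add: algebra_simps power2_eq_square)
  also have "\<dots> \<ge> 0" by (intro sum_nonneg) (auto simp: a_def)
  finally show ?thesis by simp
qed

lemma proots_prod_linear: "proots (\<Prod>a\<leftarrow>xs. [:- a, 1:]) = mset (xs :: real list)"
proof (induction xs)
  case (Cons a xs)
  have "(\<Prod>a\<leftarrow>xs. [:- a, 1:]) \<noteq> 0" by (auto simp: prod_list_zero_iff)
  then show ?case using Cons by (simp add: proots_mult del: mult_pCons_left)
qed simp

text \<open>The eigenvalues are defined as sorted roots of the characteristic polynomial, whereas
  diagonalization gives them in arbitrary order. Permuting the columns by a sorting of
  \<open>e\<close> makes the diagonal a sorted list with the same multiset of roots, hence the same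
  list.\<close>

theorem laplacian_spectral:
  assumes G: "conn_graph n G"
  obtains U where "U \<in> carrier_mat n n" "transpose_mat U * U = 1\<^sub>m n"
    "laplacian n G = U * mat_diag n (laplacian_eigenvalue n G) * transpose_mat U"
    "\<And>i. i < n \<Longrightarrow> laplacian_eigenvalue n G i \<ge> 0"
    "\<And>i j. i \<le> j \<Longrightarrow> j < n \<Longrightarrow> laplacian_eigenvalue n G i \<le> laplacian_eigenvalue n G j"
proof -
  let ?L = "laplacian n G"
  obtain V e where V: "V \<in> carrier_mat n n" "transpose_mat V * V = 1\<^sub>m n"
    "?L = V * mat_diag n e * transpose_mat V"
    using real_symmetric_diagonalization[OF laplacian_carrier laplacian_symmetric[OF G]] by blast
  define xs where "xs = sort_key e [0..<n]"
  have len: "length xs = n" and dist: "distinct xs" and set: "set xs = {..<n}"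
    unfolding xs_def by auto
  define d where "d i = e (xs ! i)" for i
  define U where "U = Matrix.mat n n (\<lambda>(i, j). V $$ (i, xs ! j))"
  have bij: "bij_betw ((!) xs) {..<n} {..<n}" by (rule bij_betw_nth[OF dist]) (simp_all add: len set)
  have xs_lt: "xs ! i < n" if "i < n" for i using bij_betw_apply[OF bij, of i] that by simp
  have inj: "xs ! i = xs ! j \<longleftrightarrow> i = j" if "i < n" "j < n" for i j
    using that nth_eq_iff_index_eq[OF dist] len by metis
  have U: "U \<in> carrier_mat n n" unfolding U_def by simp
  have UU: "transpose_mat U * U = 1\<^sub>m n"
  proof (rule eq_matI)
    fix j k assume "j < dim_row (1\<^sub>m n :: real mat)" "k < dim_col (1\<^sub>m n :: real mat)"
    then have jk: "j < n" "k < n" by auto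
    have "(transpose_mat U * U) $$ (j, k) = (\<Sum>i<n. V $$ (i, xs ! j) * V $$ (i, xs ! k))"
      using jk by (simp add: U_def scalar_prod_def lessThan_atLeast0)
    then show "(transpose_mat U * U) $$ (j, k) = 1\<^sub>m n $$ (j, k)"
      using orthogonal_cols[OF V(1,2), of "xs ! j" "xs ! k"] jk xs_lt inj by simp
  qed (use U in auto)
  have L: "?L = U * mat_diag n d * transpose_mat U"
  proof (rule eq_matI)
    fix i k assume "i < dim_row (U * mat_diag n d * transpose_mat U)" "k < dim_col (U * mat_diag n d * transpose_mat U)"
    then have ik: "i < n" "k < n" using U by auto
    have "?L $$ (i, k) = (\<Sum>j<n. V $$ (i, j) * e j * V $$ (k, j))"
      unfolding V(3) using spectral_sandwich_index[OF V(1) ik] .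
    also have "\<dots> = (\<Sum>j<n. V $$ (i, xs ! j) * e (xs ! j) * V $$ (k, xs ! j))"
      by (rule sum.reindex_bij_betw[OF bij, symmetric])
    also have "\<dots> = (U * mat_diag n d * transpose_mat U) $$ (i, k)"
      unfolding spectral_sandwich_index[OF U ik] using ik by (intro sum.cong) (auto simp: U_def d_def)
    finally show "?L $$ (i, k) = (U * mat_diag n d * transpose_mat U) $$ (i, k)" .
  qed (use U laplacian_carrier[of n G] in auto)
  have sorted: "sorted (map d [0..<n])"
  proof -
    have "map d [0..<n] = map e xs" unfolding d_def by (rule nth_equalityI) (auto simp: len)
    then show ?thesis unfolding xs_def by simp
  qed
  have "similar_mat ?L (mat_diag n d)"
    by (rule similar_matI[of _ _ U "transpose_mat U" n])
      (use U UU orthogonal_mat_transpose[OF U UU] L laplacian_carrier in auto)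
  then have "char_poly ?L = char_poly (mat_diag n d)" by (rule char_poly_similar)
  also have "\<dots> = (\<Prod>a\<leftarrow>diag_mat (mat_diag n d). [:- a, 1:])"
    by (rule char_poly_upper_triangular[of _ n]) (auto simp: mat_diag_def)
  also have "diag_mat (mat_diag n d) = map d [0..<n]"
    unfolding diag_mat_def mat_diag_def by auto
  finally have "proots (char_poly ?L) = mset (map d [0..<n])"
    by (simp only: proots_prod_linear)
  then have "sorted_list_of_multiset (proots (char_poly ?L)) = map d [0..<n]"
    using sorted by (simp add: sorted_list_of_multiset_mset sorted_sort_id del: mset_map)
  then have ev: "laplacian_eigenvalue n G i = d i" if "i < n" for i
    using that by (simp add: laplacian_eigenvalue_def)
  have nonneg: "d i \<ge> 0" if i: "i < n" for i
  proof -
    let ?x = "\<lambda>k. U $$ (k, i)"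
    have "(\<Sum>k<n. ?L $$ (j, k) * ?x k) = d i * ?x j" if j: "j < n" for j
    proof -
      have "(\<Sum>k<n. ?L $$ (j, k) * ?x k) = mat_app n ?L ?x j" using j by (simp add: mat_app_def)
      also have "\<dots> = (\<Sum>l<n. U $$ (j, l) * d l * (\<Sum>k<n. U $$ (k, l) * U $$ (k, i)))"
        unfolding L by (rule mat_app_spectral[OF U j])
      also have "\<dots> = (\<Sum>l<n. U $$ (j, l) * d l * (if l = i then 1 else 0))"
        by (intro sum.cong) (use orthogonal_cols[OF U UU] i in auto)
      also have "\<dots> = d i * ?x j"
        using i by (simp add: if_distrib[of "\<lambda>c. _ * c"] cong: if_cong)
      finally show ?thesis .
    qed
    then have "(\<Sum>j<n. ?x j * (\<Sum>k<n. ?L $$ (j, k) * ?x k)) = d i * (\<Sum>j<n. ?x j * ?x j)"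
      by (simp add: sum_distrib_left algebra_simps)
    \<comment> \<open>The i-th column is a unit vector, so the value of the nonnegative form at it
      is \<open>d i\<close> itself.\<close>
    then show ?thesis using orthogonal_cols[OF U UU i i] laplacian_nonneg_form[OF G, of ?x] by simp
  qed
  have "mat_diag n (laplacian_eigenvalue n G) = mat_diag n d"
    unfolding mat_diag_def by (rule eq_matI) (auto simp: ev)
  then have L': "?L = U * mat_diag n (laplacian_eigenvalue n G) * transpose_mat U" using L by simp
  show thesis
  proof (rule that[OF U UU L'])
    fix i j assume ij: "i \<le> j" "j < n"
    then show "laplacian_eigenvalue n G i \<le> laplacian_eigenvalue n G j"
      using sorted_nth_mono[OF sorted, of i j] by (simp add: ev)
  qed (simp add: ev nonneg)
qed

section \<open>The standard normal law on the coordinate space\<close>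

abbreviation std_normal :: "real measure" where
  "std_normal \<equiv> density lborel std_normal_density"

abbreviation std_normal_n :: "nat \<Rightarrow> (nat \<Rightarrow> real) measure" where
  "std_normal_n n \<equiv> PiM {..<n} (\<lambda>_. std_normal)"

abbreviation lborel_n :: "nat \<Rightarrow> (nat \<Rightarrow> real) measure" where
  "lborel_n n \<equiv> PiM {..<n} (\<lambda>_. lborel)"

interpretation lborel_product: product_sigma_finite "\<lambda>_::nat. lborel :: real measure"
  by standard

lemma prob_space_std_normal: "prob_space std_normal"
  using prob_space_normal_density[of 1 0] by simp

interpretation std_normal_product: product_sigma_finite "\<lambda>_::nat. std_normal"
  using prob_space_std_normal by (intro product_sigma_finite.intro prob_space_imp_sigma_finite)

lemma prob_space_std_normal_n: "prob_space (std_normal_n n)"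
  by (intro prob_space_PiM prob_space_std_normal)

text \<open>Rotation invariance will be derived from that of Lebesgue measure, and this requires a
  joint density in place of a product of laws.\<close>

lemma std_normal_n_density:
  "std_normal_n n = density (lborel_n n) (\<lambda>x. ennreal (\<Prod>i<n. std_normal_density (x i)))"
proof (rule sym, rule std_normal_product.PiM_eqI)
  fix A :: "nat \<Rightarrow> real set"
  assume A: "\<And>i. i \<in> {..<n} \<Longrightarrow> A i \<in> sets std_normal"
  then have [measurable]: "A i \<in> sets borel" if "i < n" for i using that by auto
  have box: "Pi\<^sub>E {..<n} A \<in> sets (lborel_n n)" by (intro sets_PiM_I_finite) auto
  have "emeasure (density (lborel_n n) (\<lambda>x. ennreal (\<Prod>i<n. std_normal_density (x i)))) (Pi\<^sub>E {..<n} A) =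
      (\<integral>\<^sup>+x. ennreal (\<Prod>i<n. std_normal_density (x i)) * indicator (Pi\<^sub>E {..<n} A) x \<partial>lborel_n n)"
    using box by (subst emeasure_density) auto
  also have "\<dots> = (\<integral>\<^sup>+x. (\<Prod>i<n. ennreal (std_normal_density (x i)) * indicator (A i) (x i)) \<partial>lborel_n n)"
    by (intro nn_integral_cong)
      (auto simp: prod.distrib prod_ennreal indicator_def space_PiM PiE_iff Ball_def)
  also have "\<dots> = (\<Prod>i<n. \<integral>\<^sup>+x. ennreal (std_normal_density x) * indicator (A i) x \<partial>lborel)"
    by (rule lborel_product.product_nn_integral_prod) auto
  also have "\<dots> = (\<Prod>i<n. emeasure std_normal (A i))"
    by (intro prod.cong refl) (subst emeasure_density, auto)
  finally show "emeasure (density (lborel_n n) (\<lambda>x. ennreal (\<Prod>i<n. std_normal_density (x i)))) (Pi\<^sub>E {..<n} A) =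
      (\<Prod>i\<in>{..<n}. emeasure std_normal (A i))" .
next
  have "sets (lborel_n n) = sets (std_normal_n n)" by (intro sets_PiM_cong) auto
  then show "sets (density (lborel_n n) (\<lambda>x. ennreal (\<Prod>i<n. std_normal_density (x i)))) = sets (std_normal_n n)"
    by simp
qed simp

section \<open>Translations and rotations of Lebesgue measure and of the normal law\<close>

lemma distr_lborel_n_translate:
  "distr (lborel_n n) (lborel_n n) (\<lambda>x. \<lambda>i\<in>{..<n}. x i + a i) = lborel_n n"
proof (rule lborel_product.PiM_eqI)
  have meas[measurable]: "(\<lambda>x. \<lambda>i\<in>{..<n}. x i + a i) \<in> lborel_n n \<rightarrow>\<^sub>M lborel_n n" by measurable
  fix A :: "nat \<Rightarrow> real set"
  assume A: "\<And>i. i \<in> {..<n} \<Longrightarrow> A i \<in> sets lborel"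
  then have [measurable]: "A i \<in> sets borel" if "i < n" for i using that by auto
  have box: "Pi\<^sub>E {..<n} A \<in> sets (lborel_n n)" by (intro sets_PiM_I_finite) auto
  have "(\<lambda>x. \<lambda>i\<in>{..<n}. x i + a i) -` Pi\<^sub>E {..<n} A \<inter> space (lborel_n n) = Pi\<^sub>E {..<n} (\<lambda>i. (\<lambda>x. x + a i) -` A i)"
    by (auto simp: space_PiM PiE_iff extensional_def)
  then have "emeasure (distr (lborel_n n) (lborel_n n) (\<lambda>x. \<lambda>i\<in>{..<n}. x i + a i)) (Pi\<^sub>E {..<n} A) =
      emeasure (lborel_n n) (Pi\<^sub>E {..<n} (\<lambda>i. (\<lambda>x. x + a i) -` A i))"
    using box by (subst emeasure_distr) auto
  also have "\<dots> = (\<Prod>i<n. emeasure lborel ((\<lambda>x. x + a i) -` A i))"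
    by (intro lborel_product.emeasure_PiM)
      (auto intro!: measurable_sets_borel[where M = borel])
  also have "\<dots> = (\<Prod>i<n. emeasure lborel (A i))"
  proof (intro prod.cong refl)
    fix i assume "i \<in> {..<n}"
    then have "emeasure lborel (A i) = emeasure (distr lborel borel ((+) (a i))) (A i)"
      by (simp add: lborel_distr_plus)
    also have "\<dots> = emeasure lborel ((\<lambda>x. x + a i) -` A i)"
      using \<open>i \<in> {..<n}\<close> by (subst emeasure_distr) (auto simp: vimage_def add.commute)
    finally show "emeasure lborel ((\<lambda>x. x + a i) -` A i) = emeasure lborel (A i)" ..
  qed
  finally show "emeasure (distr (lborel_n n) (lborel_n n) (\<lambda>x. \<lambda>i\<in>{..<n}. x i + a i)) (Pi\<^sub>E {..<n} A) =
      (\<Prod>i\<in>{..<n}. emeasure lborel (A i))" .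
qed auto

lemma nn_integral_lborel_n_translate:
  assumes [measurable]: "F \<in> borel_measurable (lborel_n n)"
  shows "(\<integral>\<^sup>+x. F (\<lambda>i\<in>{..<n}. x i + a i) \<partial>lborel_n n) = (\<integral>\<^sup>+x. F x \<partial>lborel_n n)"
  by (subst (2) distr_lborel_n_translate[of n a, symmetric], subst nn_integral_distr) auto

text \<open>Both orthonormality relations are assumed, so that the notion is visibly closed under
  transposition and \<open>rot\<close> and \<open>inv_rot\<close> are inverse to each other on the
  coordinates below \<open>n\<close>.\<close>

locale orthogonal_map =
  fixes n :: nat and U :: "nat \<Rightarrow> nat \<Rightarrow> real"
  assumes orth_cols: "\<And>j k. j < n \<Longrightarrow> k < n \<Longrightarrow> (\<Sum>i<n. U i j * U i k) = (if j = k then 1 else 0)"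
    and orth_rows: "\<And>j k. j < n \<Longrightarrow> k < n \<Longrightarrow> (\<Sum>i<n. U j i * U k i) = (if j = k then 1 else 0)"
begin

definition rot :: "(nat \<Rightarrow> real) \<Rightarrow> nat \<Rightarrow> real" where
  "rot x = (\<lambda>i\<in>{..<n}. \<Sum>j<n. U i j * x j)"

definition inv_rot :: "(nat \<Rightarrow> real) \<Rightarrow> nat \<Rightarrow> real" where
  "inv_rot x = (\<lambda>j\<in>{..<n}. \<Sum>i<n. U i j * x i)"

lemma rot_measurable[measurable]: "rot \<in> lborel_n n \<rightarrow>\<^sub>M lborel_n n"
  unfolding rot_def by measurable

lemma inv_rot_rot: "i < n \<Longrightarrow> inv_rot (rot x) i = x i"
proof -
  assume i: "i < n"
  have "inv_rot (rot x) i = (\<Sum>k<n. \<Sum>j<n. U k i * U k j * x j)"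
    using i by (simp add: inv_rot_def rot_def sum_distrib_left mult.assoc)
  also have "\<dots> = (\<Sum>j<n. (\<Sum>k<n. U k i * U k j) * x j)"
    by (subst sum.swap) (simp add: sum_distrib_right)
  also have "\<dots> = (\<Sum>j<n. (if i = j then 1 else 0) * x j)"
    by (intro sum.cong) (use orth_cols i in auto)
  finally show ?thesis using i by (simp add: if_distrib[of "\<lambda>c. c * _"] cong: if_cong)
qed

lemma rot_inv_rot: "i < n \<Longrightarrow> rot (inv_rot x) i = x i"
proof -
  assume i: "i < n"
  have "rot (inv_rot x) i = (\<Sum>k<n. \<Sum>j<n. U i k * U j k * x j)"
    using i by (simp add: inv_rot_def rot_def sum_distrib_left mult.assoc)
  also have "\<dots> = (\<Sum>j<n. (\<Sum>k<n. U i k * U j k) * x j)"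
    by (subst sum.swap) (simp add: sum_distrib_right)
  also have "\<dots> = (\<Sum>j<n. (if i = j then 1 else 0) * x j)"
    by (intro sum.cong) (use orth_rows i in auto)
  finally show ?thesis using i by (simp add: if_distrib[of "\<lambda>c. c * _"] cong: if_cong)
qed

lemma rot_norm: "(\<Sum>i<n. (rot x i)\<^sup>2) = (\<Sum>i<n. (x i)\<^sup>2)"
proof -
  have "(\<Sum>i<n. (rot x i)\<^sup>2) = (\<Sum>i<n. \<Sum>j<n. x j * (U i j * rot x i))"
    by (intro sum.cong refl) (simp add: rot_def power2_eq_square sum_distrib_left sum_distrib_right algebra_simps)
  also have "\<dots> = (\<Sum>j<n. x j * inv_rot (rot x) j)"
    by (subst sum.swap) (simp add: inv_rot_def sum_distrib_left)
  finally show ?thesis by (simp add: inv_rot_rot power2_eq_square)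
qed

lemma restrict_rot:
  "(\<lambda>i\<in>{..<n}. y i - rot x i) = (\<lambda>i\<in>{..<n}. y i - (\<Sum>j<n. U i j * x j))"
  "(\<lambda>i\<in>{..<n}. rot x i + y i) = (\<lambda>i\<in>{..<n}. (\<Sum>j<n. U i j * x j) + y i)"
  "(\<lambda>i\<in>{..<n}. y i + inv_rot x i) = (\<lambda>i\<in>{..<n}. y i + (\<Sum>j<n. U j i * x j))"
  by (auto simp: rot_def inv_rot_def)

lemma rot_diff: "i < n \<Longrightarrow> rot (\<lambda>j. x j - y j) i = rot x i - rot y i"
  by (simp add: rot_def right_diff_distrib sum_subtractf)

text \<open>Two Fubini swaps and translations: a translation invariant measure is determined by
  its value on a single rotation invariant function with positive finite integral.\<close>

lemma nn_integral_lborel_n_rot: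
  assumes F[measurable]: "F \<in> borel_measurable (lborel_n n)"
  shows "(\<integral>\<^sup>+x. F (rot x) \<partial>lborel_n n) = (\<integral>\<^sup>+x. F x \<partial>lborel_n n)"
proof -
  interpret sf: sigma_finite_measure "lborel_n n" by (rule lborel_product.sigma_finite) simp
  interpret pair_sigma_finite "lborel_n n" "lborel_n n" ..
  define G :: "(nat \<Rightarrow> real) \<Rightarrow> ennreal" where "G x = (\<Prod>i<n. ennreal (std_normal_density (x i)))" for x
  have G[measurable]: "G \<in> borel_measurable (lborel_n n)" unfolding G_def by measurable
  have G_eq: "G x = ennreal ((1 / sqrt (2 * pi)) ^ n * exp (- (\<Sum>i<n. (x i)\<^sup>2) / 2))" for x
    unfolding G_def
    by (simp add: prod_ennreal std_normal_density_def prod.distrib prod_dividef power_divide exp_sum sum_divide_distrib flip: sum_negf)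
  have int_G: "(\<integral>\<^sup>+x. G x \<partial>lborel_n n) = 1"
  proof -
    have "(\<integral>\<^sup>+x. ennreal (std_normal_density x) \<partial>lborel) = 1"
      using prob_space.emeasure_space_1[OF prob_space_std_normal] by (simp add: emeasure_density)
    then show ?thesis
      unfolding G_def by (subst lborel_product.product_nn_integral_prod) auto
  qed
  have "(\<integral>\<^sup>+x. F (rot x) \<partial>lborel_n n) = (\<integral>\<^sup>+x. F (rot x) * (\<integral>\<^sup>+y. G y \<partial>lborel_n n) \<partial>lborel_n n)"
    by (simp add: int_G)
  \<comment> \<open>For fixed x the integral of \<open>G\<close> is invariant under the translation
    by \<open>rot x\<close>; this couples the two variables before the order of integration is
    exchanged.\<close>
  also have "\<dots> = (\<integral>\<^sup>+x. (\<integral>\<^sup>+y. F (rot x) * G (\<lambda>i\<in>{..<n}. y i - rot x i) \<partial>lborel_n n) \<partial>lborel_n n)"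
  proof (intro nn_integral_cong)
    fix x
    have "(\<integral>\<^sup>+y. G y \<partial>lborel_n n) = (\<integral>\<^sup>+y. G (\<lambda>i\<in>{..<n}. y i - rot x i) \<partial>lborel_n n)"
      using nn_integral_lborel_n_translate[OF G, of "\<lambda>i. - rot x i"] by simp
    then show "F (rot x) * (\<integral>\<^sup>+y. G y \<partial>lborel_n n) =
        (\<integral>\<^sup>+y. F (rot x) * G (\<lambda>i\<in>{..<n}. y i - rot x i) \<partial>lborel_n n)"
      by (simp add: nn_integral_cmult)
  qed
  also have "\<dots> = (\<integral>\<^sup>+y. (\<integral>\<^sup>+x. F (rot x) * G (\<lambda>i\<in>{..<n}. y i - rot x i) \<partial>lborel_n n) \<partial>lborel_n n)"
    unfolding restrict_rot by (rule Fubini'[symmetric]) measurable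
  also have "\<dots> = (\<integral>\<^sup>+y. (\<integral>\<^sup>+x. F (\<lambda>i\<in>{..<n}. rot x i + y i) * G x \<partial>lborel_n n) \<partial>lborel_n n)"
  proof (rule nn_integral_cong)
    fix y assume "y \<in> space (lborel_n n)"
    \<comment> \<open>Translating x by \<open>inv_rot y\<close> turns \<open>rot x\<close> into
      \<open>rot x + y\<close>, so y cancels in the argument of \<open>G\<close> and leaves
      \<open>- rot x\<close>. As \<open>G\<close> depends only on the sum of squares, its value
      there is \<open>G x\<close>.\<close>
    define H where "H x = F (rot x) * G (\<lambda>i\<in>{..<n}. y i - rot x i)" for x
    have [measurable]: "H \<in> borel_measurable (lborel_n n)" unfolding H_def restrict_rot by measurable
    have "(\<integral>\<^sup>+x. H x \<partial>lborel_n n) = (\<integral>\<^sup>+x. H (\<lambda>i\<in>{..<n}. x i + inv_rot y i) \<partial>lborel_n n)"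
      by (rule nn_integral_lborel_n_translate[symmetric]) fact
    also have "\<dots> = (\<integral>\<^sup>+x. F (\<lambda>i\<in>{..<n}. rot x i + y i) * G x \<partial>lborel_n n)"
    proof (intro nn_integral_cong)
      fix x assume "x \<in> space (lborel_n n)"
      have r: "rot (\<lambda>i\<in>{..<n}. x i + inv_rot y i) i = rot x i + y i" if "i < n" for i
      proof -
        have "rot (\<lambda>i\<in>{..<n}. x i + inv_rot y i) i = rot x i + rot (inv_rot y) i"
          using that by (simp add: rot_def distrib_left sum.distrib)
        then show ?thesis using rot_inv_rot[OF that] by simp
      qed
      have 1: "rot (\<lambda>i\<in>{..<n}. x i + inv_rot y i) = (\<lambda>i\<in>{..<n}. rot x i + y i)"
        by (rule ext) (metis r restrict_apply rot_def lessThan_iff)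
      have 2: "G (\<lambda>i\<in>{..<n}. y i - rot (\<lambda>i\<in>{..<n}. x i + inv_rot y i) i) = G x"
        unfolding G_eq using rot_norm[of x] r by simp
      show "H (\<lambda>i\<in>{..<n}. x i + inv_rot y i) = F (\<lambda>i\<in>{..<n}. rot x i + y i) * G x"
        unfolding H_def 2 unfolding 1 ..
    qed
    finally show "(\<integral>\<^sup>+x. F (rot x) * G (\<lambda>i\<in>{..<n}. y i - rot x i) \<partial>lborel_n n) =
        (\<integral>\<^sup>+x. F (\<lambda>i\<in>{..<n}. rot x i + y i) * G x \<partial>lborel_n n)" by (simp add: H_def)
  qed
  also have "\<dots> = (\<integral>\<^sup>+x. (\<integral>\<^sup>+y. F (\<lambda>i\<in>{..<n}. rot x i + y i) * G x \<partial>lborel_n n) \<partial>lborel_n n)"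
    unfolding restrict_rot by (rule Fubini') measurable
  also have "\<dots> = (\<integral>\<^sup>+x. (\<integral>\<^sup>+y. F y \<partial>lborel_n n) * G x \<partial>lborel_n n)"
  proof (intro nn_integral_cong)
    fix x
    have "(\<integral>\<^sup>+y. F (\<lambda>i\<in>{..<n}. rot x i + y i) \<partial>lborel_n n) = (\<integral>\<^sup>+y. F y \<partial>lborel_n n)"
      using nn_integral_lborel_n_translate[OF F, of "rot x"] by (simp add: add.commute)
    moreover have "(\<lambda>y. F (\<lambda>i\<in>{..<n}. rot x i + y i)) \<in> borel_measurable (lborel_n n)"
      by (rule measurable_compose[OF _ F]) measurable
    ultimately show "(\<integral>\<^sup>+y. F (\<lambda>i\<in>{..<n}. rot x i + y i) * G x \<partial>lborel_n n) = (\<integral>\<^sup>+y. F y \<partial>lborel_n n) * G x"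
      by (simp add: nn_integral_multc)
  qed
  also have "\<dots> = (\<integral>\<^sup>+y. F y \<partial>lborel_n n)"
    by (simp add: nn_integral_cmult int_G)
  finally show ?thesis .
qed

lemma inv_rot_orthogonal: "orthogonal_map n (\<lambda>i j. U j i)"
  by standard (use orth_cols orth_rows in auto)

text \<open>The density depends only on the sum of squares, which \<open>rot\<close> preserves, so
  the invariance of Lebesgue measure carries over.\<close>

theorem distr_std_normal_rot: "distr (std_normal_n n) (std_normal_n n) rot = std_normal_n n"
proof (rule measure_eqI)
  fix A assume "A \<in> sets (distr (std_normal_n n) (std_normal_n n) rot)"
  have sets: "sets (std_normal_n n) = sets (lborel_n n)" by (intro sets_PiM_cong) auto
  have A[measurable]: "A \<in> sets (lborel_n n)"
    using \<open>A \<in> _\<close> sets by simp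
  have rot': "rot \<in> std_normal_n n \<rightarrow>\<^sub>M std_normal_n n"
    using rot_measurable by (simp add: measurable_cong_sets[OF sets sets])
  define g :: "(nat \<Rightarrow> real) \<Rightarrow> ennreal" where "g x = ennreal (\<Prod>i<n. std_normal_density (x i))" for x
  have g[measurable]: "g \<in> borel_measurable (lborel_n n)" unfolding g_def by measurable
  have g_eq: "g x = ennreal ((1 / sqrt (2 * pi)) ^ n * exp (- (\<Sum>i<n. (x i)\<^sup>2) / 2))" for x
    unfolding g_def
    by (simp add: std_normal_density_def prod.distrib prod_dividef power_divide exp_sum sum_divide_distrib flip: sum_negf)
  have "emeasure (distr (std_normal_n n) (std_normal_n n) rot) A =
      emeasure (std_normal_n n) (rot -` A \<inter> space (std_normal_n n))"
    using rot' A sets by (subst emeasure_distr) auto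
  also have "space (std_normal_n n) = space (lborel_n n)" by (simp add: space_PiM)
  also have "emeasure (std_normal_n n) (rot -` A \<inter> space (lborel_n n)) =
      (\<integral>\<^sup>+x. g x * indicator (rot -` A \<inter> space (lborel_n n)) x \<partial>lborel_n n)"
    unfolding std_normal_n_density g_def[symmetric]
    by (subst emeasure_density) (auto intro: measurable_sets[OF rot_measurable])
  also have "\<dots> = (\<integral>\<^sup>+x. g (rot x) * indicator A (rot x) \<partial>lborel_n n)"
    by (intro nn_integral_cong) (auto simp: g_eq rot_norm indicator_def)
  also have "\<dots> = (\<integral>\<^sup>+x. g x * indicator A x \<partial>lborel_n n)"
    by (rule nn_integral_lborel_n_rot[where F = "\<lambda>x. g x * indicator A x"]) measurable
  also have "\<dots> = emeasure (std_normal_n n) A"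
    unfolding std_normal_n_density g_def[symmetric] by (subst emeasure_density) auto
  finally show "emeasure (distr (std_normal_n n) (std_normal_n n) rot) A = emeasure (std_normal_n n) A" .
qed simp

end

section \<open>Exponential moments of Gaussian vectors, by completing the square\<close>

lemma nn_integral_std_normal_exp_quadratic:
  fixes q l :: real
  assumes q: "q > - 1 / 2"
  shows "(\<integral>\<^sup>+w. ennreal (exp (- q * w\<^sup>2 + l * w)) \<partial>std_normal) = ennreal (exp (l\<^sup>2 / (2 * (1 + 2 * q))) / sqrt (1 + 2 * q))"
proof -
  define s where "s = 1 + 2 * q"
  have s: "s > 0" using q by (simp add: s_def)
  have "(\<integral>\<^sup>+w. ennreal (exp (- q * w\<^sup>2 + l * w)) \<partial>std_normal) =
      (\<integral>\<^sup>+w. ennreal (std_normal_density w * exp (- q * w\<^sup>2 + l * w)) \<partial>lborel)"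
    by (subst nn_integral_density) (auto simp: ennreal_mult)
  also have "\<dots> = (\<integral>\<^sup>+w. ennreal (exp (l\<^sup>2 / (2 * s)) / sqrt s) * ennreal (normal_density (l / s) (1 / sqrt s) w) \<partial>lborel)"
  proof (intro nn_integral_cong)
    fix w
    define m where "m = l / s"
    have l: "l = s * m" and q_eq: "q = (s - 1) / 2" using s by (simp_all add: m_def s_def)
    have "l\<^sup>2 / (2 * s) = s * m\<^sup>2 / 2" using s by (simp add: l power2_eq_square)
    then have e: "- (w\<^sup>2 / 2) + (- q * w\<^sup>2 + l * w) = l\<^sup>2 / (2 * s) + - ((w - l / s)\<^sup>2 * s / 2)"
      unfolding m_def[symmetric] unfolding l q_eq by (simp add: field_simps power2_eq_square)
    have "std_normal_density w * exp (- q * w\<^sup>2 + l * w) = 1 / sqrt (2 * pi) * exp (- (w\<^sup>2 / 2) + (- q * w\<^sup>2 + l * w))"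
      by (simp add: std_normal_density_def mult_exp_exp)
    also have "\<dots> = exp (l\<^sup>2 / (2 * s)) / sqrt s * normal_density (l / s) (1 / sqrt s) w"
      unfolding e exp_add using s
      by (simp add: normal_density_def real_sqrt_mult real_sqrt_divide power_divide field_simps)
    finally show "ennreal (std_normal_density w * exp (- q * w\<^sup>2 + l * w)) =
        ennreal (exp (l\<^sup>2 / (2 * s)) / sqrt s) * ennreal (normal_density (l / s) (1 / sqrt s) w)"
      using s by (simp flip: ennreal_mult)
  qed
  also have "\<dots> = ennreal (exp (l\<^sup>2 / (2 * s)) / sqrt s) * (\<integral>\<^sup>+w. ennreal (normal_density (l / s) (1 / sqrt s) w) \<partial>lborel)"
    by (subst nn_integral_cmult) auto
  also have "(\<integral>\<^sup>+w. ennreal (normal_density (l / s) (1 / sqrt s) w) \<partial>lborel) = 1"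
    using prob_space.emeasure_space_1[OF prob_space_normal_density[of "1 / sqrt s" "l / s"]] s
    by (simp add: emeasure_density)
  finally show ?thesis by (simp add: s_def)
qed

lemma nn_integral_std_normal_n_prod:
  assumes "\<And>i. i < n \<Longrightarrow> h i \<in> borel_measurable borel"
  shows "(\<integral>\<^sup>+w. (\<Prod>i<n. h i (w i)) \<partial>std_normal_n n) = (\<Prod>i<n. \<integral>\<^sup>+x. h i x \<partial>std_normal)"
  by (rule std_normal_product.product_nn_integral_prod) (use assms in auto)

text \<open>The integral factors over the coordinates. In the exponent the logarithm is the price of
  concentrating near 0, and \<open>(g i)\<^sup>2 / (1 + 2 * v i)\<close> is what remains of the
  squared shift: almost all of it where the variance is small, little where it is large.\<close>

lemma gaussian_shifted_laplace:
  assumes v: "\<And>i. i < n \<Longrightarrow> v i \<ge> 0"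
  shows "(\<integral>\<^sup>+w. ennreal (exp (- (\<Sum>i<n. (sqrt (v i) * w i - g i)\<^sup>2))) \<partial>std_normal_n n) =
    ennreal (exp (- (\<Sum>i<n. ln (1 + 2 * v i) / 2 + (g i)\<^sup>2 / (1 + 2 * v i))))"
proof -
  have "(\<integral>\<^sup>+w. ennreal (exp (- (\<Sum>i<n. (sqrt (v i) * w i - g i)\<^sup>2))) \<partial>std_normal_n n) =
      (\<integral>\<^sup>+w. (\<Prod>i<n. ennreal (exp (- (sqrt (v i) * w i - g i)\<^sup>2))) \<partial>std_normal_n n)"
    by (intro nn_integral_cong) (simp add: prod_ennreal exp_sum flip: sum_negf)
  also have "\<dots> = (\<Prod>i<n. \<integral>\<^sup>+x. ennreal (exp (- (sqrt (v i) * x - g i)\<^sup>2)) \<partial>std_normal)"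
    by (rule nn_integral_std_normal_n_prod) auto
  also have "\<dots> = (\<Prod>i<n. ennreal (exp (- (ln (1 + 2 * v i) / 2 + (g i)\<^sup>2 / (1 + 2 * v i)))))"
  proof (intro prod.cong refl)
    fix i assume "i \<in> {..<n}"
    then have vi: "v i \<ge> 0" using v by simp
    define l where "l = 2 * sqrt (v i) * g i"
    have "exp (- (sqrt (v i) * x - g i)\<^sup>2) = exp (- (g i)\<^sup>2) * exp (- v i * x\<^sup>2 + l * x)" for x
      using vi by (simp add: l_def power2_diff power_mult_distrib algebra_simps flip: exp_add)
    then have "(\<integral>\<^sup>+x. ennreal (exp (- (sqrt (v i) * x - g i)\<^sup>2)) \<partial>std_normal) =
        ennreal (exp (- (g i)\<^sup>2)) * (\<integral>\<^sup>+x. ennreal (exp (- v i * x\<^sup>2 + l * x)) \<partial>std_normal)"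
      by (simp add: ennreal_mult nn_integral_cmult)
    also have "\<dots> = ennreal (exp (- (g i)\<^sup>2)) * ennreal (exp (l\<^sup>2 / (2 * (1 + 2 * v i))) / sqrt (1 + 2 * v i))"
      by (subst nn_integral_std_normal_exp_quadratic) (use vi in auto)
    also have "\<dots> = ennreal (exp (- (g i)\<^sup>2 + l\<^sup>2 / (2 * (1 + 2 * v i))) / sqrt (1 + 2 * v i))"
      using vi by (simp add: mult_exp_exp flip: ennreal_mult)
    also have "- (g i)\<^sup>2 + l\<^sup>2 / (2 * (1 + 2 * v i)) = - ((g i)\<^sup>2 / (1 + 2 * v i))"
      using vi by (simp add: l_def power_mult_distrib field_simps)
    also have "exp (- ((g i)\<^sup>2 / (1 + 2 * v i))) / sqrt (1 + 2 * v i) =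
        exp (- (ln (1 + 2 * v i) / 2 + (g i)\<^sup>2 / (1 + 2 * v i)))"
    proof -
      have sq: "sqrt (1 + 2 * v i) = exp (ln (1 + 2 * v i) / 2)"
        using exp_ln[of "sqrt (1 + 2 * v i)"] ln_sqrt[of "1 + 2 * v i"] vi by simp
      show ?thesis unfolding sq exp_diff[symmetric] by (simp add: algebra_simps)
    qed
    finally show "(\<integral>\<^sup>+x. ennreal (exp (- (sqrt (v i) * x - g i)\<^sup>2)) \<partial>std_normal) =
        ennreal (exp (- (ln (1 + 2 * v i) / 2 + (g i)\<^sup>2 / (1 + 2 * v i))))" .
  qed
  also have "\<dots> = ennreal (\<Prod>i<n. exp (- (ln (1 + 2 * v i) / 2 + (g i)\<^sup>2 / (1 + 2 * v i))))"
    by (rule prod_ennreal) simp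
  also have "(\<Prod>i<n. exp (- (ln (1 + 2 * v i) / 2 + (g i)\<^sup>2 / (1 + 2 * v i)))) =
      exp (- (\<Sum>i<n. ln (1 + 2 * v i) / 2 + (g i)\<^sup>2 / (1 + 2 * v i)))"
    by (simp only: exp_sum[OF finite_lessThan, symmetric] sum_negf)
  finally show ?thesis .
qed

text \<open>Each factor is \<open>1 / sqrt (1 - 2 * t i)\<close>. The restriction to
  \<open>t i \<le> 1 / 4\<close> is exactly what makes
  \<open>(1 - 2 * t i) * (1 + 4 * t i) \<ge> 1\<close> for nonnegative \<open>t i\<close>, whence
  the factor is at most \<open>exp (2 * t i)\<close>.\<close>

lemma gaussian_exp_moment_le:
  assumes t: "\<And>i. i < n \<Longrightarrow> 0 \<le> t i \<and> t i \<le> 1 / 4"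
  shows "(\<integral>\<^sup>+w. ennreal (exp (\<Sum>i<n. t i * (w i)\<^sup>2)) \<partial>std_normal_n n) \<le> ennreal (exp (2 * (\<Sum>i<n. t i)))"
proof -
  have "(\<integral>\<^sup>+w. ennreal (exp (\<Sum>i<n. t i * (w i)\<^sup>2)) \<partial>std_normal_n n) =
      (\<integral>\<^sup>+w. (\<Prod>i<n. ennreal (exp (t i * (w i)\<^sup>2))) \<partial>std_normal_n n)"
    by (intro nn_integral_cong) (simp add: prod_ennreal exp_sum)
  also have "\<dots> = (\<Prod>i<n. \<integral>\<^sup>+x. ennreal (exp (t i * x\<^sup>2)) \<partial>std_normal)"
    by (rule nn_integral_std_normal_n_prod) auto
  also have "\<dots> = (\<Prod>i<n. ennreal (1 / sqrt (1 - 2 * t i)))"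
  proof (intro prod.cong refl)
    fix i assume "i \<in> {..<n}"
    then show "(\<integral>\<^sup>+x. ennreal (exp (t i * x\<^sup>2)) \<partial>std_normal) = ennreal (1 / sqrt (1 - 2 * t i))"
      using nn_integral_std_normal_exp_quadratic[of "- t i" 0] t[of i] by simp
  qed
  also have "\<dots> = ennreal (\<Prod>i<n. 1 / sqrt (1 - 2 * t i))"
    using t by (intro prod_ennreal) force
  also have "\<dots> \<le> ennreal (\<Prod>i<n. exp (2 * t i))"
  proof (intro ennreal_leI prod_mono conjI)
    fix i assume "i \<in> {..<n}"
    then have ti: "0 \<le> t i" "t i \<le> 1 / 4" using t by auto
    then show "0 \<le> 1 / sqrt (1 - 2 * t i)" by simp
    have "exp (- (4 * t i)) \<le> 1 / (1 + 4 * t i)"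
      using exp_ge_add_one_self[of "4 * t i"] ti by (simp add: exp_minus field_simps)
    also have "\<dots> \<le> 1 - 2 * t i"
    proof -
      have "0 \<le> t i * (2 - 8 * t i)" using ti by simp
      then have "1 \<le> (1 - 2 * t i) * (1 + 4 * t i)" by (simp add: algebra_simps)
      then show ?thesis using ti by (simp add: field_simps)
    qed
    finally have "sqrt (exp (- (4 * t i))) \<le> sqrt (1 - 2 * t i)" by (rule real_sqrt_le_mono)
    moreover have "sqrt (exp (- (4 * t i))) = exp (- (2 * t i))"
      by (rule real_sqrt_unique) (auto simp: power2_eq_square simp flip: exp_add)
    ultimately have "exp (- (2 * t i)) \<le> sqrt (1 - 2 * t i)" by simp
    then show "1 / sqrt (1 - 2 * t i) \<le> exp (2 * t i)"
      using ti by (simp add: exp_minus field_simps)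
  qed
  also have "(\<Prod>i<n. exp (2 * t i)) = exp (2 * (\<Sum>i<n. t i))"
    by (simp add: exp_sum sum_distrib_left)
  finally show ?thesis .
qed

section \<open>Nets of ellipsoids\<close>

lemma exp_minus_square_le: "exp (- x\<^sup>2) \<le> 4 / 3 * exp (- \<bar>x\<bar> :: real)"
proof -
  have "0 \<le> (\<bar>x\<bar> - 1 / 2)\<^sup>2" by simp
  then have "- x\<^sup>2 \<le> 1 / 4 + - \<bar>x\<bar>" by (simp add: power2_diff power_divide)
  then have "exp (- x\<^sup>2) \<le> exp (1 / 4) * exp (- \<bar>x\<bar>)" by (simp flip: exp_add)
  moreover have "exp (1 / 4 :: real) \<le> 4 / 3"
    using exp_ge_add_one_self[of "- 1 / 4 :: real"] by (simp add: exp_minus field_simps)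
  ultimately show ?thesis
    by (meson exp_ge_zero mult_right_mono order_trans)
qed

lemma sum_exp_minus_le:
  fixes b :: real
  assumes b: "b \<ge> 1"
  shows "(\<Sum>k=0..m. exp (- (real k / b))) \<le> 2 * b"
proof -
  define q where "q = exp (- (1 / b))"
  have q: "0 < q" "q < 1" using b by (auto simp: q_def)
  have "(\<Sum>k=0..m. exp (- (real k / b))) = (\<Sum>k\<le>m. q ^ k)"
    by (simp add: q_def atLeast0AtMost flip: exp_of_nat_mult)
  also have "\<dots> \<le> (\<Sum>k. q ^ k)"
    using q by (intro sum_le_suminf summable_geometric) auto
  also have "\<dots> = 1 / (1 - q)" using q by (simp add: suminf_geometric)
  also have "\<dots> \<le> 1 + b"
  proof -
    have "q \<le> 1 / (1 + 1 / b)"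
      using exp_ge_add_one_self[of "1 / b"] b unfolding q_def exp_minus
      by (simp add: inverse_eq_divide frac_le add_pos_nonneg)
    also have "\<dots> = b / (1 + b)" using b by (simp add: field_simps)
    finally have "1 - q \<ge> 1 / (1 + b)" using b by (simp add: field_simps)
    then show ?thesis using q b by (simp add: field_simps)
  qed
  finally show ?thesis using b by simp
qed

text \<open>Passing to exp(-|x|) leaves two geometric sums, each at most 4/3 * 2b; zero is counted
  twice. The total 16/3 b is rounded up to 6b.\<close>

lemma sum_int_gaussian_le:
  fixes b :: real
  assumes b: "b \<ge> 1"
  shows "(\<Sum>z\<in>{-int m..int m}. exp (- (real_of_int z / b)\<^sup>2)) \<le> 6 * b"
proof -
  have "(\<Sum>z\<in>{-int m..int m}. exp (- (real_of_int z / b)\<^sup>2)) \<le>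
      (\<Sum>z\<in>{-int m..int m}. 4 / 3 * exp (- (\<bar>real_of_int z\<bar> / b)))"
    using exp_minus_square_le[of "real_of_int _ / b"] b by (intro sum_mono) (simp add: abs_divide)
  also have "\<dots> \<le> (\<Sum>z\<in>{0..int m} \<union> uminus ` {0..int m}. 4 / 3 * exp (- (\<bar>real_of_int z\<bar> / b)))"
  proof (rule sum_mono2)
    show "{-int m..int m} \<subseteq> {0..int m} \<union> uminus ` {0..int m}"
    proof
      fix z assume "z \<in> {-int m..int m}"
      then show "z \<in> {0..int m} \<union> uminus ` {0..int m}"
        by (cases "z \<ge> 0") (auto intro!: image_eqI[of _ _ "- z"])
    qed
  qed auto
  also have "\<dots> \<le> (\<Sum>z\<in>{0..int m}. 4 / 3 * exp (- (\<bar>real_of_int z\<bar> / b))) +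
      (\<Sum>z\<in>uminus ` {0..int m}. 4 / 3 * exp (- (\<bar>real_of_int z\<bar> / b)))"
    using sum.union_inter[of "{0..int m}" "uminus ` {0..int m}" "\<lambda>z. 4 / 3 * exp (- (\<bar>real_of_int z\<bar> / b))"]
      sum_nonneg[of "{0..int m} \<inter> uminus ` {0..int m}" "\<lambda>z. 4 / 3 * exp (- (\<bar>real_of_int z\<bar> / b))"]
    by (simp only: finite_imageI finite_atLeastAtMost_int) simp
  also have "(\<Sum>z\<in>uminus ` {0..int m}. 4 / 3 * exp (- (\<bar>real_of_int z\<bar> / b))) =
      (\<Sum>z\<in>{0..int m}. 4 / 3 * exp (- (\<bar>real_of_int z\<bar> / b)))"
    by (subst sum.reindex) (auto simp: inj_on_def)
  also have "(\<Sum>z\<in>{0..int m}. 4 / 3 * exp (- (\<bar>real_of_int z\<bar> / b))) =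
      (\<Sum>k=0..m. 4 / 3 * exp (- (real k / b)))"
    by (rule sum.reindex_bij_witness[of _ int nat]) auto
  also have "\<dots> = 4 / 3 * (\<Sum>k=0..m. exp (- (real k / b)))" by (simp add: sum_distrib_left)
  also have "\<dots> + \<dots> \<le> 6 * b" using sum_exp_minus_le[OF b, of m] b by simp
  finally show ?thesis .
qed

text \<open>Each counted point has weight exp(R - sum of (z_j / b_j)^2) at least 1. Summing the
  weights over a whole cube of lattice points instead makes the bound a product of one-dimensional
  Gaussian sums.\<close>

lemma card_lattice_ellipsoid:
  fixes b :: "'a \<Rightarrow> real" and R :: real
  assumes J: "finite J" and b: "\<And>j. j \<in> J \<Longrightarrow> b j \<ge> 1"
  defines "T \<equiv> {z \<in> PiE J (\<lambda>_. UNIV :: int set). (\<Sum>j\<in>J. (real_of_int (z j) / b j)\<^sup>2) \<le> R}"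
  shows "finite T" "real (card T) \<le> exp R * (\<Prod>j\<in>J. 6 * b j)"
proof -
  \<comment> \<open>A crude side length of an enclosing cube, for finiteness only: an integer
    satisfies |z| <= z^2, and z_j^2 <= R b_j^2. The size of \<open>B\<close> does not enter the
    cardinality bound.\<close>
  define B where "B = nat \<lceil>R * (\<Sum>j\<in>J. (b j)\<^sup>2)\<rceil>"
  have sub: "T \<subseteq> PiE J (\<lambda>_. {-int B..int B})"
  proof
    fix z assume z: "z \<in> T"
    have "z j \<in> {-int B..int B}" if j: "j \<in> J" for j
    proof -
      have bj: "b j > 0" using b[OF j] by simp
      have "(real_of_int (z j) / b j)\<^sup>2 \<le> R"
        using z member_le_sum[OF j, of "\<lambda>j. (real_of_int (z j) / b j)\<^sup>2"] J by (auto simp: T_def)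
      moreover from this have R: "R \<ge> 0" by (rule order_trans[OF zero_le_power2])
      ultimately have "(real_of_int (z j))\<^sup>2 \<le> R * (b j)\<^sup>2"
        using bj by (simp add: power_divide field_simps)
      also have "R * (b j)\<^sup>2 \<le> R * (\<Sum>j\<in>J. (b j)\<^sup>2)"
        using R member_le_sum[OF j, of "\<lambda>j. (b j)\<^sup>2"] J by (intro mult_left_mono) auto
      also have "\<dots> \<le> real B" unfolding B_def by (rule real_nat_ceiling_ge)
      finally have "real_of_int ((z j)\<^sup>2) \<le> real_of_int (int B)" by simp
      then have "(z j)\<^sup>2 \<le> int B" by linarith
      moreover have "\<bar>z j\<bar> \<le> (z j)\<^sup>2"
      proof (cases "z j = 0")
        case False
        then have "1 \<le> \<bar>z j\<bar>" by linarith
        then have "\<bar>z j\<bar> * 1 \<le> \<bar>z j\<bar> * \<bar>z j\<bar>" by (intro mult_left_mono) auto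
        then show ?thesis by (simp add: power2_eq_square flip: abs_mult)
      qed simp
      ultimately have "\<bar>z j\<bar> \<le> int B" by linarith
      then show ?thesis by (simp add: abs_le_iff minus_le_iff)
    qed
    then show "z \<in> PiE J (\<lambda>_. {-int B..int B})" using z by (auto simp: T_def PiE_iff)
  qed
  show fin: "finite T" using sub finite_PiE[OF J] by (rule finite_subset) simp
  have "real (card T) = (\<Sum>z\<in>T. 1)" by simp
  also have "\<dots> \<le> (\<Sum>z\<in>T. exp R * (\<Prod>j\<in>J. exp (- (real_of_int (z j) / b j)\<^sup>2)))"
    by (intro sum_mono) (auto simp: T_def sum_negf simp flip: exp_sum[OF J] exp_add)
  also have "\<dots> \<le> (\<Sum>z\<in>PiE J (\<lambda>_. {-int B..int B}). exp R * (\<Prod>j\<in>J. exp (- (real_of_int (z j) / b j)\<^sup>2)))"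
    using sub J by (intro sum_mono2 finite_PiE) (auto intro!: mult_nonneg_nonneg prod_nonneg)
  also have "\<dots> = exp R * (\<Prod>j\<in>J. \<Sum>z\<in>{-int B..int B}. exp (- (real_of_int z / b j)\<^sup>2))"
    unfolding sum_distrib_left[symmetric] using J
    by (subst prod_sum_PiE[where f = "\<lambda>j z. exp (- (real_of_int z / b j)\<^sup>2)"]) auto
  also have "\<dots> \<le> exp R * (\<Prod>j\<in>J. 6 * b j)"
    using b by (intro mult_left_mono prod_mono) (auto intro: sum_nonneg sum_int_gaussian_le)
  finally show "real (card T) \<le> exp R * (\<Prod>j\<in>J. 6 * b j)" .
qed

text \<open>Rounding towards zero does not increase the absolute value, so a rounded point stays in
  any ellipsoid with the coordinate axes as its axes.\<close>

lemma truncate_to_int: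
  fixes x :: real
  obtains z :: int where "\<bar>real_of_int z\<bar> \<le> \<bar>x\<bar>" "\<bar>x - real_of_int z\<bar> \<le> 1"
proof (cases "x \<ge> 0")
  case True
  have "\<bar>real_of_int \<lfloor>x\<rfloor>\<bar> \<le> \<bar>x\<bar>" using True by (simp add: of_int_floor_le)
  moreover have "\<bar>x - real_of_int \<lfloor>x\<rfloor>\<bar> \<le> 1" by linarith
  ultimately show ?thesis by (rule that)
next
  case False
  have "\<bar>real_of_int \<lceil>x\<rceil>\<bar> \<le> \<bar>x\<bar>"
  proof -
    have "\<lceil>x\<rceil> \<le> 0" using False by (simp add: ceiling_le_iff)
    then show ?thesis using False le_of_int_ceiling[of x] by simp
  qed
  moreover have "\<bar>x - real_of_int \<lceil>x\<rceil>\<bar> \<le> 1" by linarith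
  ultimately show ?thesis by (rule that)
qed

text \<open>Coordinates with \<open>v j > 1\<close> are truncated to integers, the others are dropped.\<close>

theorem ellipsoid_net:
  fixes v :: "nat \<Rightarrow> real" and R :: real
  assumes v: "\<And>j. j < n \<Longrightarrow> v j \<ge> 0" and R: "R \<ge> 0"
    and \<Phi>_eq: "\<Phi> = (\<Sum>j<n. ln (1 + v j))"
  shows "\<exists>T. finite T \<and> real (card T) \<le> exp (R + 4 * \<Phi>) \<and>
    (\<forall>g. (\<Sum>j<n. (g j)\<^sup>2 / (1 + v j)) \<le> R \<longrightarrow> (\<exists>t\<in>T. (\<Sum>j<n. (g j - t j)\<^sup>2) \<le> 2 * R + 2 * \<Phi>))"
proof -
  define J where "J = {j. j < n \<and> v j > 1}"
  have J: "finite J" "J \<subseteq> {..<n}" by (auto simp: J_def)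
  define b where "b j = sqrt (1 + v j)" for j
  have b: "b j \<ge> 1" if "j \<in> J" for j using that by (auto simp: b_def J_def)
  define Z where "Z = {z \<in> PiE J (\<lambda>_. UNIV :: int set). (\<Sum>j\<in>J. (real_of_int (z j) / b j)\<^sup>2) \<le> R}"
  have Z: "finite Z" "real (card Z) \<le> exp R * (\<Prod>j\<in>J. 6 * b j)"
    unfolding Z_def by (intro card_lattice_ellipsoid J(1) b; assumption)+
  define T where "T = (\<lambda>z j. if j \<in> J then real_of_int (z j) else 0) ` Z"
  have ln2: "ln 2 \<ge> (1 / 2 :: real)" using ln2_ge_two_thirds by simp
  have ln_ge: "ln 2 \<le> ln (1 + v j)" if "j \<in> J" for j using that by (subst ln_le_cancel_iff) (auto simp: J_def)
  have sum_J: "(\<Sum>j\<in>J. ln (1 + v j)) \<le> \<Phi>"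
    unfolding \<Phi>_eq using J v by (intro sum_mono2) (auto intro!: ln_ge_zero)
  have "real (card J) * ln 2 \<le> (\<Sum>j\<in>J. ln (1 + v j))"
    using ln_ge by (rule sum_bounded_below)
  then have card_ln: "real (card J) * ln 2 \<le> \<Phi>" using sum_J by simp
  then have card_J: "real (card J) \<le> 2 * \<Phi>"
    using mult_left_mono[OF ln2, of "real (card J)"] by simp
  have "real (card T) \<le> real (card Z)" using card_image_le[OF Z(1)] by (simp add: T_def)
  also have "\<dots> \<le> exp R * (\<Prod>j\<in>J. 6 * b j)" using Z(2) .
  \<comment> \<open>The constant 6 is enlarged to 8 = 2^3 so that it can be charged to the
    complexity: every index in \<open>J\<close> contributes at least ln 2 to \<Phi>. The constants
    cost 3 \<Phi> and the factors 1 + v another \<Phi>.\<close>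
  also have "(\<Prod>j\<in>J. 6 * b j) \<le> (\<Prod>j\<in>J. exp (3 * ln 2 + ln (1 + v j)))"
  proof (intro prod_mono conjI)
    fix j assume j: "j \<in> J"
    then show "0 \<le> 6 * b j" using b[OF j] by simp
    have vj: "v j > 1" using j by (simp add: J_def)
    have "b j \<le> 1 + v j" unfolding b_def using vj by (intro real_le_lsqrt) (auto simp: power2_eq_square algebra_simps)
    then have "6 * b j \<le> 8 * (1 + v j)" using vj b[OF j] by simp
    also have "\<dots> = exp (3 * ln 2 + ln (1 + v j))"
    proof -
      have "exp (3 * ln 2 :: real) = 8" using exp_of_nat_mult[of 3 "ln 2 :: real"] by simp
      then show ?thesis using vj by (simp add: exp_add)
    qed
    finally show "6 * b j \<le> exp (3 * ln 2 + ln (1 + v j))" .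
  qed
  also have "(\<Prod>j\<in>J. exp (3 * ln 2 + ln (1 + v j))) = exp (real (card J) * (3 * ln 2) + (\<Sum>j\<in>J. ln (1 + v j)))"
    by (simp add: exp_sum[OF J(1), symmetric] sum.distrib)
  also have "\<dots> \<le> exp (4 * \<Phi>)" using card_ln sum_J by simp
  finally have "real (card T) \<le> exp (R + 4 * \<Phi>)" by (simp add: exp_add)
  moreover have "finite T" using Z(1) by (simp add: T_def)
  moreover have "\<exists>t\<in>T. (\<Sum>j<n. (g j - t j)\<^sup>2) \<le> 2 * R + 2 * \<Phi>" if g: "(\<Sum>j<n. (g j)\<^sup>2 / (1 + v j)) \<le> R" for g
  proof -
    have "\<exists>z. \<forall>j. \<bar>real_of_int (z j)\<bar> \<le> \<bar>g j\<bar> \<and> \<bar>g j - real_of_int (z j)\<bar> \<le> 1"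
      by (rule choice) (metis truncate_to_int)
    then obtain z where z: "\<And>j. \<bar>real_of_int (z j)\<bar> \<le> \<bar>g j\<bar>" "\<And>j. \<bar>g j - real_of_int (z j)\<bar> \<le> 1" by blast
    define z' where "z' = restrict z J"
    have "(\<Sum>j\<in>J. (real_of_int (z' j) / b j)\<^sup>2) \<le> (\<Sum>j\<in>J. (g j)\<^sup>2 / (1 + v j))"
    proof (intro sum_mono)
      fix j assume j: "j \<in> J"
      have "(real_of_int (z j))\<^sup>2 \<le> (g j)\<^sup>2" using z(1)[of j] by (simp add: abs_le_square_iff)
      then show "(real_of_int (z' j) / b j)\<^sup>2 \<le> (g j)\<^sup>2 / (1 + v j)"
        using j by (auto simp: z'_def b_def J_def power_divide intro!: divide_right_mono)
    qed
    also have "\<dots> \<le> (\<Sum>j<n. (g j)\<^sup>2 / (1 + v j))"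
      using J v by (intro sum_mono2) auto
    finally have "z' \<in> Z" using g by (auto simp: Z_def z'_def)
    then have t: "(\<lambda>j. if j \<in> J then real_of_int (z' j) else 0) \<in> T" (is "?t \<in> T") by (auto simp: T_def)
    \<comment> \<open>On \<open>J\<close> rounding costs at most 1 per coordinate, and
      \<open>card J \<le> 2 * \<Phi>\<close>. Off \<open>J\<close> one has v <= 1, so dropping the
      coordinate costs at most twice its share of the ellipsoid sum.\<close>
    have "(\<Sum>j<n. (g j - ?t j)\<^sup>2) \<le> (\<Sum>j<n. 2 * ((g j)\<^sup>2 / (1 + v j)) + (if j \<in> J then 1 else 0))"
    proof (intro sum_mono)
      fix j assume "j \<in> {..<n}"
      then have j: "j < n" "v j \<ge> 0" using v by auto
      show "(g j - ?t j)\<^sup>2 \<le> 2 * ((g j)\<^sup>2 / (1 + v j)) + (if j \<in> J then 1 else 0)"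
      proof (cases "j \<in> J")
        case True
        have "(g j - real_of_int (z j))\<^sup>2 \<le> 1" using z(2)[of j] by (simp add: abs_square_le_1)
        moreover have "0 \<le> (g j)\<^sup>2 / (1 + v j)" using j by simp
        ultimately show ?thesis using True by (simp add: z'_def)
      next
        case False
        then have "v j \<le> 1" using j by (auto simp: J_def)
        then have "(g j)\<^sup>2 * (1 + v j) \<le> (g j)\<^sup>2 * 2" by (intro mult_left_mono) auto
        then have "(g j)\<^sup>2 \<le> 2 * (g j)\<^sup>2 / (1 + v j)" using j by (simp add: le_divide_eq)
        then show ?thesis using False by simp
      qed
    qed
    also have "\<dots> = 2 * (\<Sum>j<n. (g j)\<^sup>2 / (1 + v j)) + real (card J)"
      using J by (simp add: sum.distrib sum_distrib_left sum.If_cases Int_absorb1)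
    also have "\<dots> \<le> 2 * R + 2 * \<Phi>" using g card_J by simp
    finally show ?thesis by (rule bexI[OF _ t])
  qed
  ultimately show ?thesis by blast
qed

section \<open>Bernoulli observations\<close>

definition logit :: "real \<Rightarrow> real" where
  "logit p = ln (p / (1 - p))"

text \<open>Hoeffding's lemma for a single Bernoulli variable. The case h < 0 is reduced to h > 0 by
  exchanging success and failure, that is p with 1 - p and h with -h.\<close>

lemma bernoulli_mgf_le:
  fixes p h :: real
  assumes p: "0 \<le> p" "p \<le> 1"
  shows "1 - p + p * exp h \<le> exp (h * p + h\<^sup>2 / 8)"
proof -
  have pos: "1 + q * (exp x - 1) > 0" if "0 \<le> q" "q \<le> 1" for q x :: real
  proof (cases "q = 1")
    case False
    then have "0 < (1 - q) + q * exp x" using that by (intro add_pos_nonneg) auto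
    then show ?thesis by (simp add: algebra_simps)
  qed simp
  have nonneg: "1 + q * (exp x - 1) \<le> exp (x * q + x\<^sup>2 / 8)" if "0 \<le> q" "q \<le> 1" "x \<ge> 0" for q x :: real
  proof -
    have "ln (1 + q * (exp x - 1)) \<le> x * q + x\<^sup>2 / 8"
      using Hoeffdings_lemma_aux[of x q] that by simp
    then have "exp (ln (1 + q * (exp x - 1))) \<le> exp (x * q + x\<^sup>2 / 8)" by simp
    then show ?thesis using pos[of q x] that by simp
  qed
  show ?thesis
  proof (cases "h \<ge> 0")
    case True
    then show ?thesis using nonneg[of p h] p by (simp add: algebra_simps)
  next
    case False
    have "1 + (1 - p) * (exp (- h) - 1) \<le> exp (- h * (1 - p) + h\<^sup>2 / 8)"
      using nonneg[of "1 - p" "- h"] p False by simp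
    then have "exp h * (1 + (1 - p) * (exp (- h) - 1)) \<le> exp h * exp (- h * (1 - p) + h\<^sup>2 / 8)"
      by (intro mult_left_mono) auto
    moreover have "exp h * exp (- h * (1 - p) + h\<^sup>2 / 8) = exp (h * p + h\<^sup>2 / 8)"
      by (simp add: algebra_simps flip: exp_add)
    moreover have "exp h * (1 + (1 - p) * (exp (- h) - 1)) = 1 - p + p * exp h"
      by (simp add: algebra_simps exp_minus)
    ultimately show ?thesis by simp
  qed
qed

text \<open>The data vectors that are False off \<open>{..<n}\<close>, in accordance with the
  default value in \<open>data_law\<close>. This finite set contains the support of the data, so
  probabilities become finite sums that commute with integrals over the prior.\<close>

definition outcomes :: "nat \<Rightarrow> (nat \<Rightarrow> bool) set" where
  "outcomes n = PiE_dflt {..<n} False (\<lambda>_. UNIV)"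

lemma finite_outcomes [simp]: "finite (outcomes n)"
  unfolding outcomes_def by (intro finite_PiE_dflt) auto

lemma set_data_law: "set_pmf (data_law n p) \<subseteq> outcomes n"
  unfolding data_law_def outcomes_def using set_Pi_pmf_subset[of "{..<n}" False] by (auto simp: PiE_dflt_def)

lemma integrable_data_law [simp]: "integrable (measure_pmf (data_law n p)) (f :: _ \<Rightarrow> real)"
  by (rule integrable_measure_pmf_finite) (rule finite_subset[OF set_data_law finite_outcomes])

lemma pmf_data_law:
  assumes "\<And>i. i < n \<Longrightarrow> p i \<in> {0..1}" "Y \<in> outcomes n"
  shows "pmf (data_law n p) Y = likelihood n p Y"
proof -
  have "pmf (data_law n p) Y = (\<Prod>i<n. pmf (bernoulli_pmf (p i)) (Y i))"
    using assms(2) unfolding data_law_def outcomes_def by (subst pmf_Pi) (auto simp: PiE_dflt_def)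
  also have "\<dots> = likelihood n p Y"
    unfolding likelihood_def using assms(1) by (intro prod.cong) auto
  finally show ?thesis .
qed

lemma prob_data_law:
  assumes "\<And>i. i < n \<Longrightarrow> p i \<in> {0..1}"
  shows "measure_pmf.prob (data_law n p) A = (\<Sum>Y\<in>outcomes n. likelihood n p Y * indicator A Y)"
proof -
  have "measure_pmf.prob (data_law n p) A = measure_pmf.prob (data_law n p) (A \<inter> outcomes n)"
    by (rule measure_prob_cong_0) (use set_data_law[of n p] in \<open>auto simp: set_pmf_iff subset_iff\<close>)
  also have "\<dots> = (\<Sum>Y\<in>A \<inter> outcomes n. pmf (data_law n p) Y)"
    by (intro measure_measure_pmf_finite) auto
  also have "\<dots> = (\<Sum>Y\<in>outcomes n. pmf (data_law n p) Y * indicator A Y)"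
    by (intro sum.mono_neutral_cong_left) (auto simp: indicator_def)
  also have "\<dots> = (\<Sum>Y\<in>outcomes n. likelihood n p Y * indicator A Y)"
    by (intro sum.cong) (use pmf_data_law[OF assms] in auto)
  finally show ?thesis .
qed

theorem data_law_hoeffding:
  assumes p: "\<And>i. i < n \<Longrightarrow> p i \<in> {0..1}" and V: "V > 0" "(\<Sum>i<n. (a i)\<^sup>2) \<le> V" and t: "t \<ge> 0"
  shows "measure_pmf.prob (data_law n p) {Y. (\<Sum>i<n. a i * (of_bool (Y i) - p i)) \<ge> t} \<le> exp (- 2 * t\<^sup>2 / V)"
proof -
  let ?P = "data_law n p"
  \<comment> \<open>The minimizer of - l t + l^2 V / 8, the exponent in the Chernoff bound.\<close>
  define l where "l = 4 * t / V"
  have l: "l \<ge> 0" using V t by (simp add: l_def)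
  define S where "S Y = (\<Sum>i<n. a i * (of_bool (Y i) - p i))" for Y :: "nat \<Rightarrow> bool"
  have "measure_pmf.prob ?P {Y. S Y \<ge> t} = measure_pmf.expectation ?P (indicator {Y. S Y \<ge> t})" by simp
  also have "\<dots> \<le> measure_pmf.expectation ?P (\<lambda>Y. exp (- l * t) * exp (l * S Y))"
  proof (intro integral_mono)
    fix Y
    have "0 \<le> l * (S Y - t)" if "t \<le> S Y" using that l by simp
    then show "indicator {Y. S Y \<ge> t} Y \<le> exp (- l * t) * exp (l * S Y)"
      by (auto simp: indicator_def right_diff_distrib simp flip: exp_add)
  qed auto
  also have "\<dots> = exp (- l * t) * measure_pmf.expectation ?P (\<lambda>Y. \<Prod>i<n. exp (l * a i * (of_bool (Y i) - p i)))"
    by (simp add: S_def exp_sum sum_distrib_left mult.assoc)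
  also have "measure_pmf.expectation ?P (\<lambda>Y. \<Prod>i<n. exp (l * a i * (of_bool (Y i) - p i))) =
      (\<Prod>i<n. measure_pmf.expectation (bernoulli_pmf (p i)) (\<lambda>y. exp (l * a i * (of_bool y - p i))))"
    unfolding data_law_def
    by (rule expectation_prod_Pi_pmf) (auto intro: integrable_measure_pmf_finite)
  also have "\<dots> \<le> (\<Prod>i<n. exp ((l * a i)\<^sup>2 / 8))"
  proof (intro prod_mono conjI)
    fix i assume "i \<in> {..<n}"
    then have pi: "0 \<le> p i" "p i \<le> 1" using p[of i] by auto
    show "0 \<le> measure_pmf.expectation (bernoulli_pmf (p i)) (\<lambda>y. exp (l * a i * (of_bool y - p i)))"
      by (intro integral_nonneg_AE) auto
    have "measure_pmf.expectation (bernoulli_pmf (p i)) (\<lambda>y. exp (l * a i * (of_bool y - p i))) =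
        exp (- (l * a i * p i)) * (1 - p i + p i * exp (l * a i))"
      using pi by (simp add: right_diff_distrib exp_diff exp_minus field_simps)
    also have "\<dots> \<le> exp (- (l * a i * p i)) * exp (l * a i * p i + (l * a i)\<^sup>2 / 8)"
      by (intro mult_left_mono bernoulli_mgf_le pi) auto
    also have "\<dots> = exp ((l * a i)\<^sup>2 / 8)" by (simp flip: exp_add)
    finally show "measure_pmf.expectation (bernoulli_pmf (p i)) (\<lambda>y. exp (l * a i * (of_bool y - p i))) \<le>
      exp ((l * a i)\<^sup>2 / 8)" .
  qed
  also have "\<dots> = exp (l\<^sup>2 * (\<Sum>i<n. (a i)\<^sup>2) / 8)"
    by (simp add: exp_sum[symmetric] power_mult_distrib sum_distrib_left sum_divide_distrib)
  also have "exp (- l * t) * \<dots> \<le> exp (- l * t) * exp (l\<^sup>2 * V / 8)"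
    using V(2) by (intro mult_left_mono) (auto intro!: divide_right_mono mult_left_mono)
  also have "\<dots> = exp (- 2 * t\<^sup>2 / V)"
    using V(1) by (simp add: l_def field_simps power2_eq_square flip: exp_add)
  finally show ?thesis by (simp add: S_def mult_left_mono)
qed

lemma likelihood_pos:
  assumes "\<And>i. i < n \<Longrightarrow> p i \<in> {0<..<1}"
  shows "likelihood n p Y > 0"
  unfolding likelihood_def using assms by (intro prod_pos) auto

lemma likelihood_le_1:
  assumes "\<And>i. i < n \<Longrightarrow> p i \<in> {0..1}"
  shows "likelihood n p Y \<le> 1"
  unfolding likelihood_def using assms by (intro prod_le_1) auto

lemma likelihood_measurable [measurable]:
  "(\<lambda>p. likelihood n p Y) \<in> borel_measurable (PiM {..<n} (\<lambda>_. borel))"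
  unfolding likelihood_def by measurable

text \<open>Hoeffding's lemma bounds the Kullback--Leibler divergence of Bernoulli laws by the
  squared distance of their logits.\<close>

lemma likelihood_ratio_ge:
  assumes p: "\<And>i. i < n \<Longrightarrow> p i \<in> {0<..<1}" and q: "\<And>i. i < n \<Longrightarrow> q i \<in> {0<..<1}"
  defines "\<Delta> \<equiv> \<lambda>i. logit (q i) - logit (p i)"
  shows "likelihood n q Y \<ge>
    likelihood n p Y * exp ((\<Sum>i<n. \<Delta> i * (of_bool (Y i) - p i)) - (\<Sum>i<n. (\<Delta> i)\<^sup>2) / 8)"
proof -
  have "likelihood n p Y * exp ((\<Sum>i<n. \<Delta> i * (of_bool (Y i) - p i)) - (\<Sum>i<n. (\<Delta> i)\<^sup>2) / 8) =
      (\<Prod>i<n. (if Y i then p i else 1 - p i) * exp (\<Delta> i * (of_bool (Y i) - p i) - (\<Delta> i)\<^sup>2 / 8))"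
    by (simp add: likelihood_def prod.distrib exp_sum[symmetric] sum_subtractf sum_divide_distrib)
  also have "\<dots> \<le> (\<Prod>i<n. if Y i then q i else 1 - q i)"
  proof (intro prod_mono conjI)
    fix i assume "i \<in> {..<n}"
    then have pi: "0 < p i" "p i < 1" and qi: "0 < q i" "q i < 1" using p[of i] q[of i] by auto
    show "0 \<le> (if Y i then p i else 1 - p i) * exp (\<Delta> i * (of_bool (Y i) - p i) - (\<Delta> i)\<^sup>2 / 8)"
      using pi by simp
    define e where "e = exp (\<Delta> i)"
    have e: "e = q i * (1 - p i) / (p i * (1 - q i))"
      unfolding e_def \<Delta>_def logit_def exp_diff using pi qi by (simp add: field_simps)
    \<comment> \<open>The law with parameter \<open>q i\<close> is the exponential tilt of the one
      with parameter \<open>p i\<close> by \<open>\<Delta> i\<close>, and \<open>m\<close> is its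
      normalizing constant: q = p e / m and 1 - q = (1 - p) / m. A lower bound on the likelihood
      ratio is thus an upper bound on a moment generating function.\<close>
    define m where "m = 1 - p i + p i * e"
    have m: "m = (1 - p i) / (1 - q i)" unfolding m_def e using pi qi by (simp add: field_simps)
    then have m_pos: "m > 0" using pi qi by simp
    have m_le: "m \<le> exp (\<Delta> i * p i + (\<Delta> i)\<^sup>2 / 8)"
      unfolding m_def e_def using pi by (intro bernoulli_mgf_le) auto
    have ex: "exp (- (\<Delta> i * p i) - (\<Delta> i)\<^sup>2 / 8) \<le> 1 / m"
    proof -
      have "exp (- (\<Delta> i * p i) - (\<Delta> i)\<^sup>2 / 8) = 1 / exp (\<Delta> i * p i + (\<Delta> i)\<^sup>2 / 8)"
        using exp_minus[of "\<Delta> i * p i + (\<Delta> i)\<^sup>2 / 8"] by (simp add: inverse_eq_divide)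
      also have "\<dots> \<le> 1 / m" using m_le m_pos by (intro divide_left_mono) auto
      finally show ?thesis .
    qed
    show "(if Y i then p i else 1 - p i) * exp (\<Delta> i * (of_bool (Y i) - p i) - (\<Delta> i)\<^sup>2 / 8) \<le>
        (if Y i then q i else 1 - q i)"
    proof (cases "Y i")
      case True
      have "p i * exp (\<Delta> i * (1 - p i) - (\<Delta> i)\<^sup>2 / 8) = p i * e * exp (- (\<Delta> i * p i) - (\<Delta> i)\<^sup>2 / 8)"
        by (simp add: e_def algebra_simps flip: exp_add)
      also have "\<dots> \<le> p i * e * (1 / m)"
        using ex pi by (intro mult_left_mono) (auto simp: e_def)
      also have "\<dots> = q i" unfolding e m using pi qi by (simp add: divide_simps)
      finally show ?thesis using True by simp
    next
      case False
      have "(1 - p i) * exp (- (\<Delta> i * p i) - (\<Delta> i)\<^sup>2 / 8) \<le> (1 - p i) * (1 / m)"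
        using ex pi by (intro mult_left_mono) auto
      also have "\<dots> = 1 - q i" unfolding m using pi qi by (simp add: field_simps)
      finally show ?thesis using False by simp
    qed
  qed
  finally show ?thesis by (simp add: likelihood_def)
qed

text \<open>For a net point t near x, the linear statistic in direction t - p has mean 0 under p and
  at least 3/4 d under x, so a threshold d/2 separates the two. Both estimates are Young
  inequalities; with the error e at most r/25, the first gives r <= 5/4 d + r/5 and the second 7/8 d
  - 2e >= 3/4 d.\<close>

lemma sum_square_distance:
  fixes t x p :: "nat \<Rightarrow> real"
  assumes far: "(\<Sum>i<n. (x i - p i)\<^sup>2) \<ge> r" and near: "25 * (\<Sum>i<n. (x i - t i)\<^sup>2) \<le> r"
  defines "d \<equiv> \<Sum>i<n. (t i - p i)\<^sup>2"
  shows "d \<ge> 16 / 25 * r" "(\<Sum>i<n. (t i - p i) * (x i - p i)) \<ge> 3 / 4 * d"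
proof -
  define e where "e = (\<Sum>i<n. (x i - t i)\<^sup>2)"
  have "(\<Sum>i<n. (x i - p i)\<^sup>2) \<le> (\<Sum>i<n. 5 / 4 * (t i - p i)\<^sup>2 + 5 * (x i - t i)\<^sup>2)"
  proof (intro sum_mono)
    fix i
    define a b where ab: "a = t i - p i" "b = x i - t i"
    have "x i - p i = a + b" by (simp add: ab)
    moreover have "0 \<le> (a - 4 * b)\<^sup>2" by simp
    ultimately show "(x i - p i)\<^sup>2 \<le> 5 / 4 * (t i - p i)\<^sup>2 + 5 * (x i - t i)\<^sup>2"
      unfolding ab[symmetric] by (simp add: power2_eq_square algebra_simps)
  qed
  then have "r \<le> 5 / 4 * d + 5 * e"
    using far by (simp add: d_def e_def sum.distrib sum_distrib_left)
  then show d: "d \<ge> 16 / 25 * r" using near by (simp add: e_def)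
  have "(\<Sum>i<n. 7 / 8 * (t i - p i)\<^sup>2 - 2 * (x i - t i)\<^sup>2) \<le> (\<Sum>i<n. (t i - p i) * (x i - p i))"
  proof (intro sum_mono)
    fix i
    define a b where ab: "a = t i - p i" "b = x i - t i"
    have "x i - p i = a + b" by (simp add: ab)
    moreover have "0 \<le> (a + 4 * b)\<^sup>2" by simp
    ultimately show "7 / 8 * (t i - p i)\<^sup>2 - 2 * (x i - t i)\<^sup>2 \<le> (t i - p i) * (x i - p i)"
      unfolding ab[symmetric] by (simp add: power2_eq_square algebra_simps)
  qed
  then have "7 / 8 * d - 2 * e \<le> (\<Sum>i<n. (t i - p i) * (x i - p i))"
    by (simp add: d_def e_def sum_subtractf sum_distrib_left)
  then show "(\<Sum>i<n. (t i - p i) * (x i - p i)) \<ge> 3 / 4 * d" using d near by (simp add: e_def)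
qed

section \<open>Posterior mass of sets away from the truth\<close>

lemma (in prob_space) integrable_bounded_01:
  assumes "f \<in> borel_measurable M" "\<And>x. x \<in> space M \<Longrightarrow> 0 \<le> f x \<and> f x \<le> (1::real)"
  shows "integrable M f"
  by (rule integrable_const_bound[where B = 1]) (use assms in auto)

text \<open>The prior is kept as the law of a random function \<open>X\<close> on a probability
  space \<open>Q\<close>. Sieves and small balls can then be events of \<open>Q\<close> that involve
  the scale and the Gaussian coordinates, not only the function drawn.\<close>

locale bernoulli_model = prob_space Q for Q :: "'a measure" +
  fixes n :: nat and X :: "'a \<Rightarrow> nat \<Rightarrow> real" and p0 :: "nat \<Rightarrow> real"
  assumes X_measurable[measurable]: "X \<in> Q \<rightarrow>\<^sub>M PiM {..<n} (\<lambda>_. borel)"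
    and X01: "\<And>\<omega> i. \<omega> \<in> space Q \<Longrightarrow> i < n \<Longrightarrow> X \<omega> i \<in> {0<..<1}"
    and p01: "\<And>i. i < n \<Longrightarrow> p0 i \<in> {0<..<1}"
begin

definition prior :: "(nat \<Rightarrow> real) measure" where
  "prior = distr Q (PiM {..<n} (\<lambda>_. borel)) X"

definition lik :: "(nat \<Rightarrow> bool) \<Rightarrow> 'a \<Rightarrow> real" where
  "lik Y \<omega> = likelihood n (X \<omega>) Y"

definition evidence :: "(nat \<Rightarrow> bool) \<Rightarrow> real" where
  "evidence Y = (\<integral>\<omega>. lik Y \<omega> \<partial>Q)"

lemma lik_measurable[measurable]: "lik Y \<in> borel_measurable Q"
  unfolding lik_def by measurable

lemma lik_bounds: "\<omega> \<in> space Q \<Longrightarrow> 0 < lik Y \<omega> \<and> lik Y \<omega> \<le> 1"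
  unfolding lik_def using X01[of \<omega>]
  by (intro conjI likelihood_pos likelihood_le_1) (auto simp: less_imp_le)

lemma integrable_lik_indicator [simp]:
  assumes "A \<in> sets Q"
  shows "integrable Q (\<lambda>\<omega>. lik Y \<omega> * indicator A \<omega>)"
  by (rule integrable_bounded_01) (use assms lik_bounds less_imp_le in \<open>auto simp: indicator_def\<close>)

lemma integrable_lik [simp]: "integrable Q (lik Y)"
  by (rule integrable_bounded_01) (use lik_bounds less_imp_le in auto)

lemma evidence_pos: "evidence Y > 0"
proof -
  have "(\<integral>\<omega>. 0 \<partial>Q) < (\<integral>\<omega>. lik Y \<omega> \<partial>Q)"
    by (rule integral_less_AE_space) (use lik_bounds emeasure_space_1 in auto)
  then show ?thesis by (simp add: evidence_def)
qed

lemma measure_posterior: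
  assumes A[measurable]: "A \<in> sets (PiM {..<n} (\<lambda>_. borel))"
  shows "measure (posterior n prior Y) A = (\<integral>\<omega>. lik Y \<omega> * indicator (X -` A \<inter> space Q) \<omega> \<partial>Q) / evidence Y"
proof -
  have XA[measurable]: "X -` A \<inter> space Q \<in> sets Q" using A by measurable
  have ev: "(\<integral>q. likelihood n q Y \<partial>prior) = evidence Y"
    unfolding prior_def evidence_def lik_def by (rule integral_distr) measurable
  have "emeasure (posterior n prior Y) A =
      (\<integral>\<^sup>+p. ennreal (likelihood n p Y / evidence Y) * indicator A p \<partial>prior)"
    unfolding posterior_def ev by (rule emeasure_density) (auto simp: prior_def)
  also have "\<dots> = (\<integral>\<^sup>+\<omega>. ennreal (likelihood n (X \<omega>) Y / evidence Y) * indicator A (X \<omega>) \<partial>Q)"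
    unfolding prior_def by (rule nn_integral_distr) measurable
  also have "\<dots> = (\<integral>\<^sup>+\<omega>. ennreal (lik Y \<omega> * indicator (X -` A \<inter> space Q) \<omega> / evidence Y) \<partial>Q)"
    by (intro nn_integral_cong) (auto simp: indicator_def lik_def)
  also have "\<dots> = ennreal (\<integral>\<omega>. lik Y \<omega> * indicator (X -` A \<inter> space Q) \<omega> / evidence Y \<partial>Q)"
    using XA evidence_pos[of Y] lik_bounds
    by (intro nn_integral_eq_integral) (auto intro!: divide_nonneg_pos mult_nonneg_nonneg simp: less_imp_le)
  also have "(\<integral>\<omega>. lik Y \<omega> * indicator (X -` A \<inter> space Q) \<omega> / evidence Y \<partial>Q) =
      (\<integral>\<omega>. lik Y \<omega> * indicator (X -` A \<inter> space Q) \<omega> \<partial>Q) / evidence Y" by simp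
  finally show ?thesis
    using evidence_pos[of Y] lik_bounds unfolding measure_def
    by (subst enn2real_ennreal[symmetric]) (auto intro!: divide_nonneg_pos integral_nonneg_AE mult_nonneg_nonneg simp: less_imp_le)
qed

abbreviation P0 :: "(nat \<Rightarrow> bool) set \<Rightarrow> real" where
  "P0 \<equiv> measure_pmf.prob (data_law n p0)"

lemma p0_01: "i < n \<Longrightarrow> p0 i \<in> {0..1}"
  using p01[of i] by auto

lemma X_01: "\<omega> \<in> space Q \<Longrightarrow> i < n \<Longrightarrow> X \<omega> i \<in> {0..1}"
  using X01[of \<omega> i] by auto

text \<open>The logarithm of the ratio is at least a centred linear statistic minus b/8, and the
  squared coefficients of that statistic sum to at most \<open>b\<close>. Hoeffding's inequality at
  the level \<open>b\<close> gives the bound.\<close>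

lemma P0_small_likelihood_ratio:
  assumes \<omega>: "\<omega> \<in> space Q" and b: "b > 0" "(\<Sum>i<n. (logit (X \<omega> i) - logit (p0 i))\<^sup>2) \<le> b"
  shows "P0 {Y. lik Y \<omega> < exp (- 2 * b) * likelihood n p0 Y} \<le> exp (- 2 * b)"
proof -
  let ?\<Delta> = "\<lambda>i. logit (p0 i) - logit (X \<omega> i)"
  have sq: "(\<Sum>i<n. (?\<Delta> i)\<^sup>2) \<le> b" using b(2) by (simp add: power2_commute)
  have "{Y. lik Y \<omega> < exp (- 2 * b) * likelihood n p0 Y} \<subseteq> {Y. (\<Sum>i<n. ?\<Delta> i * (of_bool (Y i) - p0 i)) \<ge> b}"
  proof
    fix Y assume Y: "Y \<in> {Y. lik Y \<omega> < exp (- 2 * b) * likelihood n p0 Y}"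
    define S where "S = (\<Sum>i<n. ?\<Delta> i * (of_bool (Y i) - p0 i))"
    have pos: "likelihood n p0 Y > 0" using p01 by (rule likelihood_pos)
    have "likelihood n p0 Y * exp ((\<Sum>i<n. (logit (X \<omega> i) - logit (p0 i)) * (of_bool (Y i) - p0 i)) -
        (\<Sum>i<n. (logit (X \<omega> i) - logit (p0 i))\<^sup>2) / 8) \<le> lik Y \<omega>"
      unfolding lik_def using p01 X01[OF \<omega>] by (rule likelihood_ratio_ge)
    moreover have "(\<Sum>i<n. (logit (X \<omega> i) - logit (p0 i)) * (of_bool (Y i) - p0 i)) = - S"
      unfolding S_def sum_negf[symmetric] by (intro sum.cong) (auto simp: algebra_simps)
    moreover have "\<dots> - b / 8 \<le> - S - (\<Sum>i<n. (logit (X \<omega> i) - logit (p0 i))\<^sup>2) / 8" using b by simp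
    ultimately have "likelihood n p0 Y * exp (- S - b / 8) \<le> lik Y \<omega>"
      using pos by (smt (verit) exp_le_cancel_iff mult_left_mono)
    with Y have "likelihood n p0 Y * exp (- S - b / 8) < likelihood n p0 Y * exp (- 2 * b)"
      by (simp add: mult.commute)
    \<comment> \<open>This yields S > 15/8 b, more than the deviation \<open>b\<close> that is
      used.\<close>
    then have "- S - b / 8 < - 2 * b" using pos by simp
    then show "Y \<in> {Y. (\<Sum>i<n. ?\<Delta> i * (of_bool (Y i) - p0 i)) \<ge> b}" using b(1) by (simp add: S_def)
  qed
  then have "P0 {Y. lik Y \<omega> < exp (- 2 * b) * likelihood n p0 Y} \<le>
      P0 {Y. (\<Sum>i<n. ?\<Delta> i * (of_bool (Y i) - p0 i)) \<ge> b}"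
    by (intro measure_pmf.finite_measure_mono) auto
  also have "\<dots> \<le> exp (- 2 * b\<^sup>2 / b)"
    using b sq p0_01 by (intro data_law_hoeffding) auto
  also have "\<dots> = exp (- 2 * b)" using b by (simp add: power2_eq_square)
  finally show ?thesis .
qed

text \<open>Instead of Jensen's inequality: by Fubini and Markov's inequality it is unlikely that more than
  half of \<open>A\<close> has a small likelihood ratio.\<close>

lemma evidence_lower_bound:
  assumes A[measurable]: "A \<in> sets Q" and b: "b > 0"
    and near: "\<And>\<omega>. \<omega> \<in> A \<Longrightarrow> (\<Sum>i<n. (logit (X \<omega> i) - logit (p0 i))\<^sup>2) \<le> b"
    and q: "q > 0" "q \<le> prob A"
  shows "P0 {Y. evidence Y < exp (- 2 * b) * q / 2 * likelihood n p0 Y} \<le> 2 * exp (- 2 * b)"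
proof -
  define low where "low Y = {\<omega> \<in> space Q. \<omega> \<in> A \<and> lik Y \<omega> < exp (- 2 * b) * likelihood n p0 Y}" for Y
  have low[measurable]: "low Y \<in> sets Q" for Y unfolding low_def by measurable
  have A_sp: "\<omega> \<in> space Q" if "\<omega> \<in> A" for \<omega> using sets.sets_into_space[OF A] that by auto
  have l0: "likelihood n p0 Y > 0" for Y using p01 by (rule likelihood_pos)
  define E where "E = {Y. evidence Y < exp (- 2 * b) * q / 2 * likelihood n p0 Y}"
  \<comment> \<open>Otherwise at least half of \<open>A\<close> would have a likelihood ratio above
    exp(-2b), and this part alone would contribute more to the evidence than membership in
    \<open>E\<close> allows.\<close>
  have E_low: "prob (low Y) \<ge> prob A / 2" if "Y \<in> E" for Y
  proof (rule ccontr)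
    assume "\<not> ?thesis"
    moreover have "prob (A - low Y) = prob A - prob (low Y)"
      by (rule finite_measure_Diff) (auto simp: low_def)
    ultimately have "prob (A - low Y) \<ge> q / 2" using q by simp
    then have "exp (- 2 * b) * likelihood n p0 Y * (q / 2) \<le> exp (- 2 * b) * likelihood n p0 Y * prob (A - low Y)"
      using l0[of Y] by (intro mult_left_mono) auto
    also have "\<dots> = (\<integral>\<omega>. exp (- 2 * b) * likelihood n p0 Y * indicator (A - low Y) \<omega> \<partial>Q)" by simp
    also have "\<dots> \<le> (\<integral>\<omega>. lik Y \<omega> \<partial>Q)"
    proof (intro integral_mono)
      fix \<omega> assume "\<omega> \<in> space Q"
      then show "exp (- 2 * b) * likelihood n p0 Y * indicator (A - low Y) \<omega> \<le> lik Y \<omega>"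
        using lik_bounds[of \<omega> Y] by (auto simp: low_def indicator_def)
    qed (auto intro: integrable_real_indicator simp: less_top[symmetric])
    finally show False using that by (simp add: E_def evidence_def algebra_simps)
  qed
  have "P0 E * (prob A / 2) = (\<Sum>Y\<in>outcomes n. likelihood n p0 Y * indicator E Y * (prob A / 2))"
    by (subst prob_data_law[OF p0_01]) (simp_all only: sum_distrib_right)
  also have "\<dots> \<le> (\<Sum>Y\<in>outcomes n. likelihood n p0 Y * prob (low Y))"
    using E_low l0 by (intro sum_mono) (auto simp: indicator_def intro!: mult_left_mono mult_nonneg_nonneg less_imp_le)
  also have "\<dots> = (\<Sum>Y\<in>outcomes n. \<integral>\<omega>. likelihood n p0 Y * indicator (low Y) \<omega> \<partial>Q)" by simp
  also have "\<dots> = (\<integral>\<omega>. (\<Sum>Y\<in>outcomes n. likelihood n p0 Y * indicator (low Y) \<omega>) \<partial>Q)"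
    by (rule Bochner_Integration.integral_sum[symmetric]) (auto intro: integrable_real_indicator simp: less_top[symmetric])
  also have "\<dots> \<le> (\<integral>\<omega>. exp (- 2 * b) * indicator A \<omega> \<partial>Q)"
  proof (intro integral_mono)
    fix \<omega> assume \<omega>: "\<omega> \<in> space Q"
    show "(\<Sum>Y\<in>outcomes n. likelihood n p0 Y * indicator (low Y) \<omega>) \<le> exp (- 2 * b) * indicator A \<omega>"
    proof (cases "\<omega> \<in> A")
      case True
      have "(\<Sum>Y\<in>outcomes n. likelihood n p0 Y * indicator (low Y) \<omega>) =
          P0 {Y. lik Y \<omega> < exp (- 2 * b) * likelihood n p0 Y}"
        by (subst prob_data_law[OF p0_01], assumption) (use True \<omega> in \<open>auto simp: low_def indicator_def intro!: sum.cong\<close>)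
      also have "\<dots> \<le> exp (- 2 * b)" by (rule P0_small_likelihood_ratio[OF \<omega> b near[OF True]])
      finally show ?thesis using True by simp
    qed (simp add: low_def)
  next
    show "integrable Q (\<lambda>\<omega>. \<Sum>Y\<in>outcomes n. likelihood n p0 Y * indicator (low Y) \<omega>)"
      by (intro Bochner_Integration.integrable_sum integrable_mult_right integrable_real_indicator low)
        (simp add: less_top[symmetric])
  qed (auto intro!: integrable_real_indicator simp: less_top[symmetric])
  also have "\<dots> = exp (- 2 * b) * prob A" by simp
  finally show ?thesis using q by (simp add: E_def field_simps)
qed

text \<open>The data are split three ways. The evidence is too small on \<open>E\<close>, a test
  against some net point rejects the truth on \<open>F'\<close>, and elsewhere the posterior mass is
  at most the numerator divided by the lower bound on the evidence. The expected numerator is an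
  error probability of the tests for draws in \<open>S\<close>, and at most the prior mass for draws
  outside \<open>S\<close>.\<close>

theorem posterior_mass_bound:
  assumes A: "A \<in> sets Q" and b: "b > 0"
    and near: "\<And>\<omega>. \<omega> \<in> A \<Longrightarrow> (\<Sum>i<n. (logit (X \<omega> i) - logit (p0 i))\<^sup>2) \<le> b"
    and q: "q > 0" "q \<le> prob A"
    and S[measurable]: "S \<in> sets Q" and T: "finite T"
    and net: "\<And>\<omega>. \<omega> \<in> S \<Longrightarrow> \<exists>t\<in>T. 25 * (\<Sum>i<n. (X \<omega> i - t i)\<^sup>2) \<le> r"
    and r: "r > 0" and \<delta>: "\<delta> > 0"
    and D: "D \<in> sets (PiM {..<n} (\<lambda>_. borel))"
    and far: "\<And>p. p \<in> D \<Longrightarrow> (\<Sum>i<n. (p i - p0 i)\<^sup>2) \<ge> r"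
  shows "P0 {Y. measure (posterior n prior Y) D > \<delta>} \<le>
    2 * exp (- 2 * b) + real (card T) * exp (- r / 4) +
    2 * exp (2 * b) / (q * \<delta>) * (exp (- r / 16) + prob (space Q - S))"
proof -
  define E where "E = {Y. evidence Y < exp (- 2 * b) * q / 2 * likelihood n p0 Y}"
  define d where "d t = (\<Sum>i<n. (t i - p0 i)\<^sup>2)" for t
  \<comment> \<open>A net point that approximates a draw at squared distance at least
    \<open>r\<close> from the truth is itself at least 16/25 r away. Restricting the tests to such
    points loses nothing and keeps their errors of the first kind exponentially small.\<close>
  define T' where "T' = {t \<in> T. d t \<ge> 16 / 25 * r}"
  define F where "F t = {Y. (\<Sum>i<n. (t i - p0 i) * (of_bool (Y i) - p0 i)) \<ge> d t / 2}" for t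
  define F' where "F' = (\<Union>t\<in>T'. F t)"
  define W where "W = {Y. measure (posterior n prior Y) D > \<delta>}"
  define XD where "XD = X -` D \<inter> space Q"
  have XD[measurable]: "XD \<in> sets Q" unfolding XD_def using D by measurable
  have l0: "likelihood n p0 Y > 0" for Y using p01 by (rule likelihood_pos)
  have PE: "P0 E \<le> 2 * exp (- 2 * b)" unfolding E_def by (rule evidence_lower_bound[OF A b near q])
  have PF: "P0 F' \<le> real (card T) * exp (- r / 4)"
  proof -
    have "P0 F' \<le> (\<Sum>t\<in>T'. P0 (F t))"
      unfolding F'_def using T by (intro measure_pmf.finite_measure_subadditive_finite) (auto simp: T'_def)
    also have "\<dots> \<le> (\<Sum>t\<in>T'. exp (- r / 4))"
    proof (intro sum_mono)
      fix t assume "t \<in> T'"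
      then have d: "d t \<ge> 16 / 25 * r" by (simp add: T'_def)
      then have dp: "d t > 0" using r by linarith
      have "P0 (F t) \<le> exp (- 2 * (d t / 2)\<^sup>2 / d t)"
        unfolding F_def using dp p0_01 by (intro data_law_hoeffding) (auto simp: d_def)
      also have "- 2 * (d t / 2)\<^sup>2 / d t = - d t / 2" using dp by (simp add: power2_eq_square)
      also have "exp (- d t / 2) \<le> exp (- r / 4)" using d r by simp
      finally show "P0 (F t) \<le> exp (- r / 4)" .
    qed
    also have "\<dots> \<le> real (card T) * exp (- r / 4)"
      using card_mono[OF T, of T'] by (auto simp: T'_def intro!: mult_right_mono)
    finally show ?thesis .
  qed
  have PX: "(\<Sum>Y\<in>outcomes n. lik Y \<omega> * indicator (- F') Y) \<le> exp (- r / 16)" if \<omega>: "\<omega> \<in> XD" "\<omega> \<in> S" for \<omega>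
  proof -
    have sp: "\<omega> \<in> space Q" using \<omega> by (simp add: XD_def)
    obtain t where t: "t \<in> T" "25 * (\<Sum>i<n. (X \<omega> i - t i)\<^sup>2) \<le> r" using net \<omega> by blast
    have "(\<Sum>i<n. (X \<omega> i - p0 i)\<^sup>2) \<ge> r" using far \<omega> by (simp add: XD_def)
    note dist = sum_square_distance[OF this t(2), folded d_def]
    have dp: "d t > 0" using dist(1) r by linarith
    have tT': "t \<in> T'" using t(1) dist(1) by (simp add: T'_def)
    have "(\<Sum>Y\<in>outcomes n. lik Y \<omega> * indicator (- F') Y) = measure_pmf.prob (data_law n (X \<omega>)) (- F')"
      unfolding lik_def using X_01[OF sp] by (subst prob_data_law) auto
    also have "\<dots> \<le> measure_pmf.prob (data_law n (X \<omega>))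
        {Y. (\<Sum>i<n. (p0 i - t i) * (of_bool (Y i) - X \<omega> i)) \<ge> d t / 4}"
    proof (intro measure_pmf.finite_measure_mono subsetI)
      fix Y assume "Y \<in> - F'"
      then have "(\<Sum>i<n. (t i - p0 i) * (of_bool (Y i) - p0 i)) < d t / 2"
        using tT' by (auto simp: F'_def F_def)
      moreover have "(\<Sum>i<n. (p0 i - t i) * (of_bool (Y i) - X \<omega> i)) =
          (\<Sum>i<n. (t i - p0 i) * (X \<omega> i - p0 i)) - (\<Sum>i<n. (t i - p0 i) * (of_bool (Y i) - p0 i))"
        unfolding sum_subtractf[symmetric] by (intro sum.cong) (auto simp: algebra_simps)
      ultimately show "Y \<in> {Y. (\<Sum>i<n. (p0 i - t i) * (of_bool (Y i) - X \<omega> i)) \<ge> d t / 4}"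
        using dist(2) by simp
    qed auto
    also have "\<dots> \<le> exp (- 2 * (d t / 4)\<^sup>2 / d t)"
      using dp X_01[OF sp] by (intro data_law_hoeffding) (auto simp: d_def power2_commute)
    also have "- 2 * (d t / 4)\<^sup>2 / d t = - d t / 8" using dp by (simp add: power2_eq_square)
    also have "exp (- d t / 8) \<le> exp (- r / 16)" using dist(1) r by simp
    finally show ?thesis .
  qed
  have "P0 (W - E - F') = (\<Sum>Y\<in>outcomes n. likelihood n p0 Y * indicator (W - E - F') Y)"
    by (rule prob_data_law[OF p0_01])
  \<comment> \<open>Change of measure: outside \<open>E\<close>, posterior mass above
    \<open>\<delta>\<close> forces the likelihood of the truth to be at most a constant multiple of
    the integrated likelihood over \<open>XD\<close>. The sum over the data is thereby taken under
    the drawn parameter, where the tests have power.\<close>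
  also have "\<dots> \<le> (\<Sum>Y\<in>outcomes n. 2 * exp (2 * b) / (q * \<delta>) *
      ((\<integral>\<omega>. lik Y \<omega> * indicator XD \<omega> \<partial>Q) * indicator (- F') Y))"
  proof (intro sum_mono)
    fix Y
    have I: "(\<integral>\<omega>. lik Y \<omega> * indicator XD \<omega> \<partial>Q) \<ge> 0"
      using lik_bounds by (intro integral_nonneg_AE AE_I2) (auto simp: indicator_def less_imp_le)
    show "likelihood n p0 Y * indicator (W - E - F') Y \<le>
        2 * exp (2 * b) / (q * \<delta>) * ((\<integral>\<omega>. lik Y \<omega> * indicator XD \<omega> \<partial>Q) * indicator (- F') Y)"
    proof (cases "Y \<in> W - E - F'")
      case True
      then have "\<delta> < (\<integral>\<omega>. lik Y \<omega> * indicator XD \<omega> \<partial>Q) / evidence Y"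
        using measure_posterior[OF D, of Y] by (simp add: W_def XD_def)
      then have "\<delta> * evidence Y \<le> (\<integral>\<omega>. lik Y \<omega> * indicator XD \<omega> \<partial>Q)"
        using evidence_pos[of Y] by (simp add: field_simps)
      moreover have "exp (- 2 * b) * q / 2 * likelihood n p0 Y \<le> evidence Y"
        using True by (simp add: E_def)
      then have "\<delta> * (exp (- 2 * b) * q / 2 * likelihood n p0 Y) \<le> \<delta> * evidence Y"
        using \<delta> by (intro mult_left_mono) auto
      ultimately have le: "\<delta> * (exp (- 2 * b) * q / 2 * likelihood n p0 Y) \<le> (\<integral>\<omega>. lik Y \<omega> * indicator XD \<omega> \<partial>Q)"
        by linarith
      have "likelihood n p0 Y = 2 * exp (2 * b) / (q * \<delta>) * (\<delta> * (exp (- 2 * b) * q / 2 * likelihood n p0 Y))"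
        using q \<delta> by (simp add: exp_minus field_simps)
      also have "\<dots> \<le> 2 * exp (2 * b) / (q * \<delta>) * (\<integral>\<omega>. lik Y \<omega> * indicator XD \<omega> \<partial>Q)"
        using q \<delta> by (intro mult_left_mono le) auto
      finally show ?thesis using True by simp
    next
      case False
      then show ?thesis using I q \<delta> by (auto simp: indicator_def)
    qed
  qed
  also have "\<dots> = 2 * exp (2 * b) / (q * \<delta>) *
      (\<Sum>Y\<in>outcomes n. \<integral>\<omega>. lik Y \<omega> * indicator XD \<omega> * indicator (- F') Y \<partial>Q)"
    unfolding sum_distrib_left by (intro sum.cong refl) simp
  finally have PW': "P0 (W - E - F') \<le> 2 * exp (2 * b) / (q * \<delta>) *
      (\<Sum>Y\<in>outcomes n. \<integral>\<omega>. lik Y \<omega> * indicator XD \<omega> * indicator (- F') Y \<partial>Q)" .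
  have "(\<Sum>Y\<in>outcomes n. \<integral>\<omega>. lik Y \<omega> * indicator XD \<omega> * indicator (- F') Y \<partial>Q) =
      (\<integral>\<omega>. (\<Sum>Y\<in>outcomes n. lik Y \<omega> * indicator XD \<omega> * indicator (- F') Y) \<partial>Q)"
    by (rule Bochner_Integration.integral_sum[symmetric]) auto
  also have "\<dots> \<le> (\<integral>\<omega>. exp (- r / 16) + indicator (space Q - S) \<omega> \<partial>Q)"
  proof (intro integral_mono)
    fix \<omega> assume \<omega>: "\<omega> \<in> space Q"
    have nonneg: "0 \<le> exp (- r / 16) + indicator (space Q - S) \<omega>" by (simp add: add_nonneg_nonneg)
    show "(\<Sum>Y\<in>outcomes n. lik Y \<omega> * indicator XD \<omega> * indicator (- F') Y) \<le>
        exp (- r / 16) + indicator (space Q - S) \<omega>"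
    proof (cases "\<omega> \<in> XD")
      case True
      show ?thesis
      proof (cases "\<omega> \<in> S")
        case True
        then show ?thesis using PX[of \<omega>] \<open>\<omega> \<in> XD\<close> by simp
      next
        case False
        have "(\<Sum>Y\<in>outcomes n. lik Y \<omega> * indicator (- F') Y) = measure_pmf.prob (data_law n (X \<omega>)) (- F')"
          unfolding lik_def using X_01[OF \<omega>] by (subst prob_data_law) auto
        also have "\<dots> \<le> 1" by simp
        finally show ?thesis using False True \<omega> by (simp add: add_increasing)
      qed
    qed (use nonneg in simp)
  next
    show "integrable Q (\<lambda>\<omega>. \<Sum>Y\<in>outcomes n. lik Y \<omega> * indicator XD \<omega> * indicator (- F') Y)"
      by (intro Bochner_Integration.integrable_sum integrable_mult_left integrable_lik_indicator XD)
  qed (auto intro!: integrable_real_indicator Bochner_Integration.integrable_add simp: less_top[symmetric])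
  also have "\<dots> = exp (- r / 16) + prob (space Q - S)"
    by (subst Bochner_Integration.integral_add) (auto intro!: integrable_real_indicator simp: less_top[symmetric] prob_space)
  finally have PW: "P0 (W - E - F') \<le> 2 * exp (2 * b) / (q * \<delta>) * (exp (- r / 16) + prob (space Q - S))"
    using q \<delta> by (intro order_trans[OF PW'] mult_left_mono) auto
  have "P0 W \<le> P0 (E \<union> F' \<union> (W - E - F'))" by (intro measure_pmf.finite_measure_mono) auto
  also have "\<dots> \<le> P0 E + P0 F' + P0 (W - E - F')"
    by (intro order_trans[OF measure_Un_le] add_right_mono measure_Un_le) auto
  finally show ?thesis using PE PF PW unfolding W_def by linarith
qed

end

section \<open>Gaussian scale mixtures\<close>

lemma prob_space_exp1: "prob_space exp1"
  unfolding exp1_def by (rule prob_space_exponential_density) simp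

lemma sets_exp1 [simp, measurable_cong]: "sets exp1 = sets borel"
  by (simp add: exp1_def)

lemma space_exp1 [simp]: "space exp1 = UNIV"
  by (simp add: exp1_def)

lemma sets_std_normal_n [measurable_cong]: "sets (std_normal_n n) = sets (PiM {..<n} (\<lambda>_. borel :: real measure))"
  by (intro sets_PiM_cong) auto

lemma exp1_tail:
  assumes "a \<ge> 0"
  shows "measure exp1 {a<..} = exp (- a)" "measure exp1 {..0} = 0"
proof -
  interpret prob_space exp1 by (rule prob_space_exp1)
  have "distributed exp1 lborel (\<lambda>x. x) (exponential_density 1)"
    by (auto simp: distributed_def exp1_def distr_id2)
  from exponential_distributedD_gt[OF this assms] exponential_distributedD_le[OF this, of 0]
  show "measure exp1 {a<..} = exp (- a)" "measure exp1 {..0} = 0"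
    by (simp_all add: greaterThan_def atMost_def)
qed

text \<open>The price of forcing the scale into a dyadic window. It is harmless in the prior mass
  bound, because there \<open>k\<close> does not exceed the exponent \<open>B\<close>.\<close>

lemma emeasure_exp1_interval_ge:
  assumes k: "k \<ge> 1"
  shows "emeasure exp1 {k..2 * k} \<ge> ennreal (exp (- k) / 2)"
proof -
  interpret prob_space exp1 by (rule prob_space_exp1)
  have "exp (- k) / 2 \<le> exp (- k) - exp (- (2 * k))"
  proof -
    have "exp (- k) \<le> 1 / 2"
    proof -
      have "2 \<le> exp k" using exp_ge_add_one_self[of k] k by linarith
      then show ?thesis by (simp add: exp_minus field_simps)
    qed
    then have "exp (- k) * exp (- k) \<le> exp (- k) * (1 / 2)" by (intro mult_left_mono) auto
    then show ?thesis by (simp flip: exp_add)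
  qed
  also have "\<dots> = measure exp1 {k<..} - measure exp1 {2 * k<..}"
    using k by (simp add: exp1_tail)
  also have "\<dots> = measure exp1 ({k<..} - {2 * k<..})"
    using k by (intro finite_measure_Diff[symmetric]) auto
  also have "\<dots> \<le> measure exp1 {k..2 * k}" by (intro finite_measure_mono) auto
  finally show ?thesis by (simp add: emeasure_eq_measure ennreal_leI)
qed

lemma (in orthogonal_map) inv_rot_eq: "inv_rot = orthogonal_map.rot n (\<lambda>i j. U j i)"
  by (simp add: fun_eq_iff inv_rot_def orthogonal_map.rot_def[OF inv_rot_orthogonal])

lemma orthogonal_map_mat:
  assumes "U \<in> carrier_mat n n" "transpose_mat U * U = 1\<^sub>m n"
  shows "orthogonal_map n (\<lambda>i j. U $$ (i, j))"
  by standard (use orthogonal_cols[OF assms] orthogonal_rows[OF assms] in auto)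

locale gaussian_scale_mixture = orthogonal_map n U for n U +
  fixes v :: "real \<Rightarrow> nat \<Rightarrow> real"
  assumes v_measurable: "\<And>j. j < n \<Longrightarrow> (\<lambda>c. v c j) \<in> borel_measurable borel"
    and v_nonneg: "\<And>c j. c > 0 \<Longrightarrow> j < n \<Longrightarrow> v c j \<ge> 0"
    and v_mono: "\<And>c c' j. 0 < c \<Longrightarrow> c \<le> c' \<Longrightarrow> j < n \<Longrightarrow> v c j \<le> v c' j"
begin

abbreviation joint :: "(real \<times> (nat \<Rightarrow> real)) measure" where
  "joint \<equiv> exp1 \<Otimes>\<^sub>M std_normal_n n"

definition coords :: "real \<Rightarrow> (nat \<Rightarrow> real) \<Rightarrow> nat \<Rightarrow> real" where
  "coords c w = (\<lambda>j. sqrt (v c j) * w j)"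

definition draw :: "real \<Rightarrow> (nat \<Rightarrow> real) \<Rightarrow> nat \<Rightarrow> real" where
  "draw c w = rot (coords c w)"

lemma draw_measurable: "case_prod draw \<in> exp1 \<Otimes>\<^sub>M std_normal_n n \<rightarrow>\<^sub>M PiM {..<n} (\<lambda>_. borel)"
proof -
  have [measurable]: "(\<lambda>x. v (fst x) j) \<in> borel_measurable (exp1 \<Otimes>\<^sub>M std_normal_n n)" if "j < n" for j
  proof -
    have "(\<lambda>c. v c j) \<in> borel_measurable exp1"
      using v_measurable[OF that] by (subst measurable_cong_sets[OF sets_exp1 refl])
    from measurable_compose[OF measurable_fst this] show ?thesis .
  qed
  have "(\<lambda>x. \<lambda>i\<in>{..<n}. \<Sum>j\<in>{..<n}. U i j * (sqrt (v (fst x) j) * snd x j)) \<in>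
      exp1 \<Otimes>\<^sub>M std_normal_n n \<rightarrow>\<^sub>M PiM {..<n} (\<lambda>_. borel)"
    by (intro measurable_restrict borel_measurable_sum borel_measurable_times borel_measurable_sqrt) auto
  then show ?thesis
    unfolding draw_def coords_def rot_def by (simp add: case_prod_unfold)
qed

lemma prob_space_joint: "prob_space joint"
proof -
  interpret E: prob_space exp1 by (rule prob_space_exp1)
  interpret Z: prob_space "std_normal_n n" by (rule prob_space_std_normal_n)
  interpret P: pair_prob_space exp1 "std_normal_n n" ..
  show ?thesis by (rule P.prob_space_axioms)
qed

lemma draw_measurable_snd: "draw c \<in> std_normal_n n \<rightarrow>\<^sub>M PiM {..<n} (\<lambda>_. borel)"
  using measurable_compose[OF measurable_Pair1' draw_measurable, of c] by simp

text \<open>The symmetric square root acts on standard normal Z as U diag(sqrt v) U^T Z, and U^T Z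
  has the law of Z, so the inner rotation can be removed.\<close>

lemma centered_gaussian_eq:
  assumes "A \<in> carrier_mat n n" "\<And>i j. i < n \<Longrightarrow> j < n \<Longrightarrow> U i j = A $$ (i, j)"
    and S: "spectral_fun sqrt S = A * mat_diag n (\<lambda>j. sqrt (v c j)) * transpose_mat A"
  shows "centered_gaussian n S = distr (std_normal_n n) (PiM {..<n} (\<lambda>_. borel)) (draw c)"
proof -
  interpret T: orthogonal_map n "\<lambda>i j. U j i" by (rule inv_rot_orthogonal)
  have inv: "inv_rot \<in> std_normal_n n \<rightarrow>\<^sub>M std_normal_n n"
    unfolding inv_rot_eq using T.rot_measurable
    by (simp cong: measurable_cong_sets add: sets_std_normal_n sets_PiM_cong[of "{..<n}" "{..<n}" "\<lambda>_. lborel" "\<lambda>_. borel"])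
  have "mat_app n (spectral_fun sqrt S) z = draw c (inv_rot z)" for z
  proof
    fix i
    show "mat_app n (spectral_fun sqrt S) z i = draw c (inv_rot z) i"
    proof (cases "i < n")
      case True
      have "mat_app n (spectral_fun sqrt S) z i =
          (\<Sum>j<n. A $$ (i, j) * sqrt (v c j) * (\<Sum>k<n. A $$ (k, j) * z k))"
        unfolding S by (rule mat_app_spectral[OF assms(1) True])
      then show ?thesis using True
        by (simp add: draw_def coords_def rot_def inv_rot_def assms(2) mult.assoc)
    qed (simp add: mat_app_def draw_def rot_def)
  qed
  then have "mat_app n (spectral_fun sqrt S) = draw c \<circ> inv_rot" by (simp add: fun_eq_iff)
  then have "centered_gaussian n S = distr (std_normal_n n) (PiM {..<n} (\<lambda>_. borel)) (draw c \<circ> inv_rot)"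
    unfolding centered_gaussian_def by simp
  also have "\<dots> = distr (distr (std_normal_n n) (std_normal_n n) inv_rot) (PiM {..<n} (\<lambda>_. borel)) (draw c)"
    using inv draw_measurable_snd by (simp add: distr_distr)
  also have "distr (std_normal_n n) (std_normal_n n) inv_rot = std_normal_n n"
    unfolding inv_rot_eq by (rule T.distr_std_normal_rot)
  finally show ?thesis .
qed

text \<open>Realizes the mixture as the image of a product measure. Scale and noise become
  independent coordinates, and prior probabilities can be computed by integrating sections over the
  scale.\<close>

lemma gaussian_mixture_eq:
  assumes "A \<in> carrier_mat n n" "\<And>i j. i < n \<Longrightarrow> j < n \<Longrightarrow> U i j = A $$ (i, j)"
    and S: "\<And>c. spectral_fun sqrt (S c) = A * mat_diag n (\<lambda>j. sqrt (v c j)) * transpose_mat A"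
  shows "gaussian_mixture n S = distr joint (PiM {..<n} (\<lambda>_. borel)) (case_prod draw)"
proof -
  let ?B = "PiM {..<n} (\<lambda>_. borel) :: (nat \<Rightarrow> real) measure"
  interpret Z: prob_space "std_normal_n n" by (rule prob_space_std_normal_n)
  have "(\<lambda>_. std_normal_n n) \<in> exp1 \<rightarrow>\<^sub>M subprob_algebra (std_normal_n n)"
    by (rule measurable_const) (simp add: space_subprob_algebra Z.subprob_space_axioms)
  then have kernel: "(\<lambda>c. distr (std_normal_n n) ?B (draw c)) \<in> exp1 \<rightarrow>\<^sub>M subprob_algebra ?B"
    using draw_measurable by (intro measurable_distr2) auto
  have mix: "gaussian_mixture n S = Giry_Monad.bind exp1 (\<lambda>c. distr (std_normal_n n) ?B (draw c))"
    unfolding gaussian_mixture_def by (simp add: centered_gaussian_eq[OF assms(1,2) S])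
  show ?thesis
  proof (rule measure_eqI)
    show sets_eq: "sets (gaussian_mixture n S) = sets (distr joint ?B (case_prod draw))"
      unfolding mix using kernel by (subst sets_bind_measurable[OF kernel]) auto
    fix X assume "X \<in> sets (gaussian_mixture n S)"
    then have X: "X \<in> sets ?B" using sets_eq by simp
    have "emeasure (gaussian_mixture n S) X = (\<integral>\<^sup>+c. emeasure (distr (std_normal_n n) ?B (draw c)) X \<partial>exp1)"
      unfolding mix by (rule emeasure_bind[OF _ kernel X]) simp
    also have "\<dots> = (\<integral>\<^sup>+c. emeasure (std_normal_n n) (Pair c -` (case_prod draw -` X \<inter> space joint)) \<partial>exp1)"
      using draw_measurable_snd X
      by (intro nn_integral_cong) (auto simp: emeasure_distr space_pair_measure intro!: arg_cong2[where f = emeasure])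
    also have "\<dots> = emeasure joint (case_prod draw -` X \<inter> space joint)"
      using draw_measurable X by (intro Z.emeasure_pair_measure_alt[symmetric]) (rule measurable_sets)
    also have "\<dots> = emeasure (distr joint ?B (case_prod draw)) X"
      using draw_measurable X by (simp add: emeasure_distr)
    finally show "emeasure (gaussian_mixture n S) X = emeasure (distr joint ?B (case_prod draw)) X" .
  qed
qed

section \<open>Small balls and sieves for Gaussian scale mixtures\<close>

definition complexity :: "real \<Rightarrow> real" where
  "complexity c = (\<Sum>j<n. ln (1 + v c j))"

text \<open>For c > 0, minus the logarithm of the expected exp(-squared distance to
  \<open>g\<close>) at scale \<open>c\<close>; it plays the role of the concentration function of
  the Gaussian prior.\<close>

definition approx_cost :: "(nat \<Rightarrow> real) \<Rightarrow> real \<Rightarrow> real" where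
  "approx_cost g c = (\<Sum>j<n. ln (1 + 2 * v c j) / 2 + (g j)\<^sup>2 / (1 + 2 * v c j))"

text \<open>The Laplace transform is at least exp(-B), while points with squared distance above 2B
  contribute at most exp(-2B) to it. For B >= 1 this is at most half, and the other half must come
  from the ball.\<close>

lemma small_ball_given_scale:
  assumes c: "c > 0" and B: "B \<ge> 1" "approx_cost g c \<le> B"
  shows "emeasure (std_normal_n n) {w \<in> space (std_normal_n n). (\<Sum>j<n. (coords c w j - g j)\<^sup>2) \<le> 2 * B} \<ge>
    ennreal (exp (- B) / 2)"
proof -
  interpret Z: prob_space "std_normal_n n" by (rule prob_space_std_normal_n)
  define N where "N w = (\<Sum>j<n. (coords c w j - g j)\<^sup>2)" for w
  have N[measurable]: "N \<in> borel_measurable (std_normal_n n)" unfolding N_def coords_def by measurable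
  define E where "E = {w \<in> space (std_normal_n n). N w \<le> 2 * B}"
  have E[measurable]: "E \<in> sets (std_normal_n n)" unfolding E_def by measurable
  have "ennreal (exp (- B)) \<le> ennreal (exp (- approx_cost g c))" using B by (simp add: ennreal_leI)
  also have "\<dots> = (\<integral>\<^sup>+w. ennreal (exp (- N w)) \<partial>std_normal_n n)"
    unfolding approx_cost_def N_def coords_def using v_nonneg c
    by (subst gaussian_shifted_laplace) auto
  also have "\<dots> \<le> (\<integral>\<^sup>+w. indicator E w + ennreal (exp (- (2 * B))) \<partial>std_normal_n n)"
  proof (rule nn_integral_mono)
    fix w assume w: "w \<in> space (std_normal_n n)"
    show "ennreal (exp (- N w)) \<le> indicator E w + ennreal (exp (- (2 * B)))"
    proof (cases "w \<in> E")
      case True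
      have "N w \<ge> 0" unfolding N_def by (intro sum_nonneg) auto
      then have "ennreal (exp (- N w)) \<le> 1" by simp
      then show ?thesis using True by (simp add: add_increasing2)
    next
      case False
      then show ?thesis using w by (auto simp: E_def intro!: ennreal_leI)
    qed
  qed
  also have "\<dots> = emeasure (std_normal_n n) E + ennreal (exp (- (2 * B)))"
    by (simp add: nn_integral_add Z.emeasure_space_1)
  also have "\<dots> = ennreal (Z.prob E + exp (- (2 * B)))"
    by (simp add: Z.emeasure_eq_measure)
  finally have "exp (- B) \<le> Z.prob E + exp (- (2 * B))"
    by (subst (asm) ennreal_le_iff) auto
  moreover have "exp (- (2 * B)) \<le> exp (- B) / 2"
  proof -
    have "2 \<le> exp B" using exp_ge_add_one_self[of B] B by linarith
    then have "exp (- B) \<le> 1 / 2" by (simp add: exp_minus field_simps)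
    then have "exp (- B) * exp (- B) \<le> exp (- B) * (1 / 2)" by (intro mult_left_mono) auto
    then show ?thesis by (simp flip: exp_add)
  qed
  ultimately have "exp (- B) / 2 \<le> Z.prob E" by linarith
  then show ?thesis by (simp add: E_def[symmetric] N_def[symmetric] Z.emeasure_eq_measure ennreal_leI)
qed

text \<open>Markov's inequality for the exponential of a quarter of the ellipsoid sum. Monotonicity
  of the variance keeps the weights \<open>t\<close> at most 1/4, and v / (1 + v) <= ln (1 + v)
  turns their sum into the complexity.\<close>

lemma sieve_given_scale:
  assumes c: "0 < c" "c \<le> cmax"
  shows "emeasure (std_normal_n n) {w \<in> space (std_normal_n n). (\<Sum>j<n. (coords c w j)\<^sup>2 / (1 + v cmax j)) > R} \<le>
    ennreal (exp (complexity cmax / 2 - R / 4))"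
proof -
  define t where "t j = v c j / (1 + v cmax j) / 4" for j
  define E where "E = {w \<in> space (std_normal_n n). (\<Sum>j<n. (coords c w j)\<^sup>2 / (1 + v cmax j)) > R}"
  have E[measurable]: "E \<in> sets (std_normal_n n)" unfolding E_def coords_def by measurable
  have v: "0 \<le> v c j" "v c j \<le> v cmax j" if "j < n" for j using v_nonneg v_mono c that by auto
  have t: "0 \<le> t j \<and> t j \<le> 1 / 4" if "j < n" for j
    using v[OF that] by (auto simp: t_def divide_simps)
  have tw: "t j * (w j)\<^sup>2 = (coords c w j)\<^sup>2 / (1 + v cmax j) / 4" if "j < n" for w j
    using v[OF that] by (simp add: t_def coords_def power_mult_distrib)
  have "emeasure (std_normal_n n) E = (\<integral>\<^sup>+w. indicator E w \<partial>std_normal_n n)" by simp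
  also have "\<dots> \<le> (\<integral>\<^sup>+w. ennreal (exp (- R / 4)) * ennreal (exp (\<Sum>j<n. t j * (w j)\<^sup>2)) \<partial>std_normal_n n)"
  proof (rule nn_integral_mono)
    fix w
    have "(\<Sum>j<n. t j * (w j)\<^sup>2) = (\<Sum>j<n. (coords c w j)\<^sup>2 / (1 + v cmax j)) / 4"
      unfolding sum_divide_distrib by (intro sum.cong) (auto simp: tw)
    then have "1 \<le> exp (- R / 4) * exp (\<Sum>j<n. t j * (w j)\<^sup>2)" if "w \<in> E"
      using that by (simp add: E_def flip: exp_add)
    then show "indicator E w \<le> ennreal (exp (- R / 4)) * ennreal (exp (\<Sum>j<n. t j * (w j)\<^sup>2))"
      by (auto simp: indicator_def simp flip: ennreal_mult)
  qed
  also have "\<dots> = ennreal (exp (- R / 4)) * (\<integral>\<^sup>+w. ennreal (exp (\<Sum>j<n. t j * (w j)\<^sup>2)) \<partial>std_normal_n n)"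
    by (rule nn_integral_cmult) measurable
  also have "\<dots> \<le> ennreal (exp (- R / 4)) * ennreal (exp (2 * (\<Sum>j<n. t j)))"
    by (intro mult_left_mono gaussian_exp_moment_le t) auto
  also have "\<dots> = ennreal (exp (2 * (\<Sum>j<n. t j) - R / 4))"
    by (simp add: mult_exp_exp flip: ennreal_mult)
  also have "\<dots> \<le> ennreal (exp (complexity cmax / 2 - R / 4))"
  proof -
    have "t j \<le> ln (1 + v cmax j) / 4" if j: "j < n" for j
    proof -
      have "v c j / (1 + v cmax j) \<le> v cmax j / (1 + v cmax j)"
        using v[OF j] by (intro divide_right_mono) auto
      also have "\<dots> \<le> ln (1 + v cmax j)"
      proof -
        have "ln (1 / (1 + v cmax j)) \<le> 1 / (1 + v cmax j) - 1"
          using v[OF j] by (intro ln_le_minus_one) auto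
        moreover have "1 / (1 + v cmax j) - 1 = - (v cmax j / (1 + v cmax j))"
          using v[OF j] by (simp add: field_simps)
        moreover have "ln (1 / (1 + v cmax j)) = - ln (1 + v cmax j)"
          using v[OF j] by (simp add: ln_div)
        ultimately show ?thesis by simp
      qed
      finally show ?thesis unfolding t_def by (rule divide_right_mono) simp
    qed
    then have "(\<Sum>j<n. t j) \<le> (\<Sum>j<n. ln (1 + v cmax j) / 4)" by (intro sum_mono) auto
    then show ?thesis by (intro ennreal_leI) (simp add: complexity_def sum_divide_distrib[symmetric])
  qed
  finally show ?thesis by (simp add: E_def)
qed

end

context gaussian_scale_mixture
begin

lemma rot_dist: "(\<Sum>i<n. (rot x i - rot y i)\<^sup>2) = (\<Sum>i<n. (x i - y i)\<^sup>2)"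
  using rot_norm[of "\<lambda>j. x j - y j"] by (simp add: rot_diff)

text \<open>Integrates the bound for fixed scales over \<open>{k..2 * k}\<close>. The two prices
  exp(-B)/2 and exp(-k)/2 multiply, and k <= B merges them.\<close>

lemma small_ball_mass:
  assumes k: "1 \<le> k" "k \<le> B" and cost: "\<And>c. k \<le> c \<Longrightarrow> c \<le> 2 * k \<Longrightarrow> approx_cost (inv_rot f) c \<le> B"
  defines "A \<equiv> {x \<in> space joint. (\<Sum>i<n. (case_prod draw x i - f i)\<^sup>2) \<le> 2 * B}"
  shows "A \<in> sets joint" "measure joint A \<ge> exp (- 2 * B) / 4"
proof -
  interpret Z: prob_space "std_normal_n n" by (rule prob_space_std_normal_n)
  interpret J: prob_space joint by (rule prob_space_joint)
  note draw_measurable[measurable]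
  have meas: "(\<lambda>x. case_prod draw x i) \<in> borel_measurable joint" if "i < n" for i
    by (rule measurable_compose[OF draw_measurable measurable_component_singleton]) (use that in simp)
  have "(\<lambda>x. \<Sum>i<n. (case_prod draw x i - f i)\<^sup>2) \<in> borel_measurable joint"
    by (intro borel_measurable_sum borel_measurable_power borel_measurable_diff meas) auto
  then show A: "A \<in> sets joint" unfolding A_def by measurable
  have fib: "emeasure (std_normal_n n) (Pair c -` A) \<ge> ennreal (exp (- B) / 2) * indicator {k..2 * k} c" for c
  proof (cases "c \<in> {k..2 * k}")
    case True
    have dist: "(\<Sum>i<n. (draw c w i - f i)\<^sup>2) = (\<Sum>j<n. (coords c w j - inv_rot f j)\<^sup>2)" for w
    proof -
      have "(\<Sum>i<n. (draw c w i - f i)\<^sup>2) = (\<Sum>i<n. (rot (coords c w) i - rot (inv_rot f) i)\<^sup>2)"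
        by (intro sum.cong) (auto simp: draw_def rot_inv_rot)
      then show ?thesis by (simp add: rot_dist)
    qed
    have "Pair c -` A = {w \<in> space (std_normal_n n). (\<Sum>j<n. (coords c w j - inv_rot f j)\<^sup>2) \<le> 2 * B}"
      unfolding A_def by (auto simp: space_pair_measure dist)
    then show ?thesis using True k cost[of c] small_ball_given_scale[of c B "inv_rot f"] by simp
  qed simp
  have "ennreal (exp (- 2 * B) / 4) \<le> ennreal (exp (- B) / 2 * (exp (- k) / 2))"
    using k by (intro ennreal_leI) (simp flip: exp_add)
  also have "\<dots> = ennreal (exp (- B) / 2) * ennreal (exp (- k) / 2)" by (subst ennreal_mult) auto
  also have "\<dots> \<le> ennreal (exp (- B) / 2) * emeasure exp1 {k..2 * k}"
    using emeasure_exp1_interval_ge[OF k(1)] by (intro mult_left_mono) auto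
  also have "\<dots> = (\<integral>\<^sup>+c. ennreal (exp (- B) / 2) * indicator {k..2 * k} c \<partial>exp1)"
    by (subst nn_integral_cmult_indicator) auto
  also have "\<dots> \<le> (\<integral>\<^sup>+c. emeasure (std_normal_n n) (Pair c -` A) \<partial>exp1)"
    by (intro nn_integral_mono fib)
  also have "\<dots> = emeasure joint A" by (rule Z.emeasure_pair_measure_alt[OF A, symmetric])
  finally show "measure joint A \<ge> exp (- 2 * B) / 4"
    by (simp add: J.emeasure_eq_measure)
qed

lemma sieve_mass:
  fixes cmax R :: real
  assumes cmax: "cmax > 0"
  defines "S \<equiv> {x \<in> space joint. 0 < fst x \<and> fst x \<le> cmax \<and>
    (\<Sum>j<n. (coords (fst x) (snd x) j)\<^sup>2 / (1 + v cmax j)) \<le> R}"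
  shows "S \<in> sets joint" "measure joint (space joint - S) \<le> exp (- cmax) + exp (complexity cmax / 2 - R / 4)"
proof -
  interpret E: prob_space exp1 by (rule prob_space_exp1)
  interpret Z: prob_space "std_normal_n n" by (rule prob_space_std_normal_n)
  interpret J: prob_space joint by (rule prob_space_joint)
  have [measurable]: "(\<lambda>x. v (fst x) j) \<in> borel_measurable joint" if "j < n" for j
  proof -
    have "(\<lambda>c. v c j) \<in> borel_measurable exp1"
      using v_measurable[OF that] by (subst measurable_cong_sets[OF sets_exp1 refl])
    from measurable_compose[OF measurable_fst this] show ?thesis .
  qed
  have [measurable]: "(\<lambda>x. \<Sum>j<n. (coords (fst x) (snd x) j)\<^sup>2 / (1 + v cmax j)) \<in> borel_measurable joint"
    unfolding coords_def
    by (intro borel_measurable_sum borel_measurable_divide borel_measurable_power borel_measurable_times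
        borel_measurable_sqrt) auto
  show S: "S \<in> sets joint" unfolding S_def by measurable
  define e where "e = exp (complexity cmax / 2 - R / 4)"
  have fib: "emeasure (std_normal_n n) (Pair c -` (space joint - S)) \<le>
      indicator {..0} c + indicator {cmax<..} c + ennreal e" for c
  proof (cases "0 < c \<and> c \<le> cmax")
    case True
    then have "Pair c -` (space joint - S) =
        {w \<in> space (std_normal_n n). (\<Sum>j<n. (coords c w j)\<^sup>2 / (1 + v cmax j)) > R}"
      unfolding S_def by (auto simp: space_pair_measure)
    then show ?thesis using True sieve_given_scale[of c cmax R] by (simp add: e_def)
  next
    case False
    have "emeasure (std_normal_n n) (Pair c -` (space joint - S)) \<le> 1" by (rule Z.emeasure_le_1)
    also have "\<dots> \<le> indicator {..0} c + indicator {cmax<..} c + ennreal e"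
      using False by (auto simp: indicator_def add_increasing2 add_increasing)
    finally show ?thesis .
  qed
  have "emeasure joint (space joint - S) = (\<integral>\<^sup>+c. emeasure (std_normal_n n) (Pair c -` (space joint - S)) \<partial>exp1)"
    by (rule Z.emeasure_pair_measure_alt) (rule sets.compl_sets[OF S])
  also have "\<dots> \<le> (\<integral>\<^sup>+c. indicator {..0} c + indicator {cmax<..} c + ennreal e \<partial>exp1)"
    by (intro nn_integral_mono fib)
  also have "\<dots> = emeasure exp1 {..0} + emeasure exp1 {cmax<..} + ennreal e"
    using E.emeasure_space_1 by (simp add: nn_integral_add)
  also have "\<dots> = ennreal (exp (- cmax) + e)"
    using exp1_tail[of cmax] cmax by (simp add: E.emeasure_eq_measure e_def)
  finally show "measure joint (space joint - S) \<le> exp (- cmax) + exp (complexity cmax / 2 - R / 4)"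
    unfolding J.emeasure_eq_measure by (subst (asm) ennreal_le_iff) (auto simp: e_def)
qed

end

section \<open>Link functions and the combined error bound\<close>

lemma norm_n_ge_iff:
  assumes "D \<ge> 0" "norm_n n f \<ge> D"
  shows "(\<Sum>i<n. (f i)\<^sup>2) \<ge> real n * D\<^sup>2"
proof (cases "n = 0")
  case False
  have "D\<^sup>2 \<le> (norm_n n f)\<^sup>2" using assms by (intro power_mono) auto
  also have "\<dots> = (\<Sum>i<n. (f i)\<^sup>2) / real n"
    by (simp add: norm_n_def inner_n_def power2_eq_square sum_nonneg)
  finally show ?thesis using False by (simp add: field_simps)
qed simp

text \<open>The bound on the logit turns closeness of f into closeness of likelihoods, and the bound
  on \<open>\<Psi>\<close> carries nets from f to p. A common constant \<open>K \<ge> 1\<close>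
  keeps the arithmetic of the exponents simple.\<close>

locale bernoulli_link =
  fixes \<Psi> :: "real \<Rightarrow> real" and K :: real
  assumes link_range: "\<Psi> x \<in> {0<..<1}"
    and link_measurable[measurable]: "\<Psi> \<in> borel_measurable borel"
    and link_lipschitz: "\<bar>\<Psi> x - \<Psi> y\<bar> \<le> K * \<bar>x - y\<bar>"
    and logit_link_lipschitz: "\<bar>logit (\<Psi> x) - logit (\<Psi> y)\<bar> \<le> K * \<bar>x - y\<bar>"
    and K: "K \<ge> 1"
begin

lemma sum_square_lipschitz:
  fixes h :: "real \<Rightarrow> real" and a b :: "nat \<Rightarrow> real"
  assumes "\<And>x y. \<bar>h x - h y\<bar> \<le> K * \<bar>x - y\<bar>"
  shows "(\<Sum>i<n. (h (a i) - h (b i))\<^sup>2) \<le> K\<^sup>2 * (\<Sum>i<n. (a i - b i)\<^sup>2)"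
  unfolding sum_distrib_left
proof (intro sum_mono)
  fix i
  have "\<bar>h (a i) - h (b i)\<bar>\<^sup>2 \<le> (K * \<bar>a i - b i\<bar>)\<^sup>2" using assms by (intro power_mono) auto
  then show "(h (a i) - h (b i))\<^sup>2 \<le> K\<^sup>2 * (a i - b i)\<^sup>2" by (simp add: power_mult_distrib)
qed

end

locale mixture_model = gaussian_scale_mixture n U v + bernoulli_link \<Psi> K
  for n U v \<Psi> K +
  fixes f0 p0 :: "nat \<Rightarrow> real" and \<mu> :: "(nat \<Rightarrow> real) measure"
  assumes p0_eq: "\<And>i. i < n \<Longrightarrow> p0 i = \<Psi> (f0 i)"
    and \<mu>_eq: "\<mu> = link_law n \<Psi> (distr joint (PiM {..<n} (\<lambda>_. borel)) (case_prod draw))"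
begin

text \<open>The constants are chosen such that all error terms of the posterior mass bound are of
  order \<open>exp (- B)\<close>.\<close>

theorem posterior_contraction_bound:
  defines "a \<equiv> 4 * K\<^sup>2 + 3"
  assumes k: "1 \<le> k" "k \<le> B"
    and cost: "\<And>c. k \<le> c \<Longrightarrow> c \<le> 2 * k \<Longrightarrow> approx_cost (inv_rot f0) c \<le> B"
    and H: "B \<le> H" "complexity (a * B) \<le> H"
    and D: "D \<ge> 0" "real n * D\<^sup>2 \<ge> 25 * K\<^sup>2 * (8 * a + 6) * H" and \<delta>: "\<delta> > 0"
  shows "measure_pmf.prob (data_law n p0)
      {Y. measure (posterior n \<mu> Y) {p \<in> space \<mu>. norm_n n (\<lambda>i. p i - p0 i) \<ge> D} > \<delta>}
    \<le> (3 + 24 / \<delta>) * exp (- B)"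
proof -
  define X where "X x = compose {..<n} \<Psi> (case_prod draw x)" for x
  interpret J: prob_space joint by (rule prob_space_joint)
  have comp: "compose {..<n} \<Psi> \<in> PiM {..<n} (\<lambda>_. borel) \<rightarrow>\<^sub>M PiM {..<n} (\<lambda>_. borel)"
    unfolding compose_def by measurable
  have X: "X \<in> joint \<rightarrow>\<^sub>M PiM {..<n} (\<lambda>_. borel)"
    unfolding X_def by (rule measurable_compose[OF draw_measurable comp])
  have X_i: "X x i = \<Psi> (case_prod draw x i)" if "i < n" for x i using that by (simp add: X_def compose_def)
  interpret M: bernoulli_model joint n X p0
    by unfold_locales (use X link_range p0_eq X_i in auto)
  have prior: "M.prior = \<mu>"
  proof -
    have "X = compose {..<n} \<Psi> \<circ> case_prod draw" by (simp add: fun_eq_iff X_def)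
    then show ?thesis
      unfolding M.prior_def \<mu>_eq link_law_def using comp draw_measurable by (simp add: distr_distr)
  qed
  define \<Phi> where "\<Phi> = complexity (a * B)"
  \<comment> \<open>Chosen so that \<open>\<Phi> / 2 - R / 4 = - (a * B)\<close>: leaving the
    ellipsoid is then as unlikely as exceeding the cutoff \<open>a * B\<close> of the scale.\<close>
  define R where "R = 4 * a * B + 2 * \<Phi>"
  define r where "r = real n * D\<^sup>2"
  have K2: "K\<^sup>2 \<ge> 1" using K by simp
  have a: "a \<ge> 7" using K2 by (simp add: a_def)
  have B: "B \<ge> 1" using k by simp
  have cmax: "a * B > 0" using a B by simp
  have \<Phi>: "0 \<le> \<Phi>" "\<Phi> \<le> H"
    using H(2) v_nonneg[OF cmax] by (auto simp: \<Phi>_def complexity_def intro!: sum_nonneg ln_ge_zero)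
  have aBH: "a * B \<le> a * H" using H(1) a by simp
  have R: "0 \<le> R" "R \<le> (4 * a + 2) * H"
    using \<Phi> cmax aBH by (auto simp: R_def algebra_simps)
  \<comment> \<open>The net has squared radius 2R + 2\<Phi> for f; the link multiplies it by at most
    \<open>K\<^sup>2\<close>, and the tests require 25 times the result to be at most
    \<open>r\<close>.\<close>
  have r_ge: "r \<ge> 25 * K\<^sup>2 * (2 * R + 2 * \<Phi>)"
  proof -
    have "2 * R + 2 * \<Phi> \<le> (8 * a + 6) * H" using R(2) \<Phi>(2) by (simp add: algebra_simps)
    then have "25 * K\<^sup>2 * (2 * R + 2 * \<Phi>) \<le> 25 * K\<^sup>2 * ((8 * a + 6) * H)"
      using K2 by (intro mult_left_mono) auto
    then show ?thesis using D(2) by (simp add: r_def mult.assoc)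
  qed
  have "25 * ((8 * a + 6) * H) \<le> 25 * K\<^sup>2 * ((8 * a + 6) * H)"
    using K2 a H(1) B by (intro mult_right_mono) auto
  then have r_big: "r \<ge> 200 * (a * H) + 150 * H" using D(2) by (simp add: r_def algebra_simps)
  have r16: "r / 16 \<ge> a * B" using r_big aBH H(1) B cmax by simp
  have r4: "r / 4 \<ge> R + 4 * \<Phi> + B" using r_big R(2) \<Phi>(2) H(1) B aBH cmax by (simp add: algebra_simps)
  have r_pos: "r > 0" using r16 cmax by linarith
  define A where "A = {x \<in> space joint. (\<Sum>i<n. (case_prod draw x i - f0 i)\<^sup>2) \<le> 2 * B}"
  have A: "A \<in> sets joint" "exp (- 2 * B) / 4 \<le> measure joint A"
    unfolding A_def using small_ball_mass[of k B f0] k cost by blast+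
  define S where "S = {x \<in> space joint. 0 < fst x \<and> fst x \<le> a * B \<and>
    (\<Sum>j<n. (coords (fst x) (snd x) j)\<^sup>2 / (1 + v (a * B) j)) \<le> R}"
  have S: "S \<in> sets joint" "measure joint (space joint - S) \<le> exp (- (a * B)) + exp (\<Phi> / 2 - R / 4)"
    unfolding S_def \<Phi>_def using sieve_mass[OF cmax, of R] by blast+
  obtain T where T: "finite T" "real (card T) \<le> exp (R + 4 * \<Phi>)"
    "\<And>g. (\<Sum>j<n. (g j)\<^sup>2 / (1 + v (a * B) j)) \<le> R \<Longrightarrow> \<exists>t\<in>T. (\<Sum>j<n. (g j - t j)\<^sup>2) \<le> 2 * R + 2 * \<Phi>"
    using ellipsoid_net[of n "v (a * B)" R \<Phi>] v_nonneg[OF cmax] R(1) by (auto simp: \<Phi>_def complexity_def)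
  define T' where "T' = (\<lambda>t i. \<Psi> (rot t i)) ` T"
  have near: "(\<Sum>i<n. (logit (X x i) - logit (p0 i))\<^sup>2) \<le> 2 * K\<^sup>2 * B" if "x \<in> A" for x
  proof -
    have "(\<Sum>i<n. (logit (X x i) - logit (p0 i))\<^sup>2) =
        (\<Sum>i<n. (logit (\<Psi> (case_prod draw x i)) - logit (\<Psi> (f0 i)))\<^sup>2)"
      by (intro sum.cong) (auto simp: X_i p0_eq)
    also have "\<dots> \<le> K\<^sup>2 * (\<Sum>i<n. (case_prod draw x i - f0 i)\<^sup>2)"
      by (rule sum_square_lipschitz[where h = "\<lambda>x. logit (\<Psi> x)"]) (rule logit_link_lipschitz)
    also have "\<dots> \<le> K\<^sup>2 * (2 * B)" using that by (intro mult_left_mono) (auto simp: A_def)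
    finally show ?thesis by simp
  qed
  have net: "\<exists>t\<in>T'. 25 * (\<Sum>i<n. (X x i - t i)\<^sup>2) \<le> r" if "x \<in> S" for x
  proof -
    have "(\<Sum>j<n. (coords (fst x) (snd x) j)\<^sup>2 / (1 + v (a * B) j)) \<le> R" using that by (simp add: S_def)
    from T(3)[OF this]
    obtain t where t: "t \<in> T" "(\<Sum>j<n. (coords (fst x) (snd x) j - t j)\<^sup>2) \<le> 2 * R + 2 * \<Phi>"
      by (rule bexE)
    have "(\<Sum>i<n. (X x i - \<Psi> (rot t i))\<^sup>2) = (\<Sum>i<n. (\<Psi> (case_prod draw x i) - \<Psi> (rot t i))\<^sup>2)"
      by (intro sum.cong) (auto simp: X_i)
    also have "\<dots> \<le> K\<^sup>2 * (\<Sum>i<n. (case_prod draw x i - rot t i)\<^sup>2)"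
      by (rule sum_square_lipschitz) (rule link_lipschitz)
    also have "(\<Sum>i<n. (case_prod draw x i - rot t i)\<^sup>2) = (\<Sum>j<n. (coords (fst x) (snd x) j - t j)\<^sup>2)"
      unfolding draw_def case_prod_unfold by (rule rot_dist)
    also have "K\<^sup>2 * \<dots> \<le> K\<^sup>2 * (2 * R + 2 * \<Phi>)" using t(2) by (intro mult_left_mono) auto
    finally have "25 * (\<Sum>i<n. (X x i - \<Psi> (rot t i))\<^sup>2) \<le> r" using r_ge by simp
    then show ?thesis using t(1) unfolding T'_def by (intro bexI[of _ "\<lambda>i. \<Psi> (rot t i)"]) auto
  qed
  define F where "F = {p \<in> space \<mu>. norm_n n (\<lambda>i. p i - p0 i) \<ge> D}"
  have sets_\<mu>: "sets \<mu> = sets (PiM {..<n} (\<lambda>_. borel))" by (simp add: \<mu>_eq link_law_def)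
  have "(\<lambda>p. norm_n n (\<lambda>i. p i - p0 i)) \<in> borel_measurable (PiM {..<n} (\<lambda>_. borel))"
    unfolding norm_n_def inner_n_def by measurable
  then have F: "F \<in> sets (PiM {..<n} (\<lambda>_. borel))"
    unfolding F_def sets_eq_imp_space_eq[OF sets_\<mu>] by measurable
  have far: "(\<Sum>i<n. (p i - p0 i)\<^sup>2) \<ge> r" if "p \<in> F" for p
    using that norm_n_ge_iff[OF D(1), of n "\<lambda>i. p i - p0 i"] by (simp add: F_def r_def)
  have "measure_pmf.prob (data_law n p0) {Y. measure (posterior n \<mu> Y) F > \<delta>} \<le>
      2 * exp (- 2 * (2 * K\<^sup>2 * B)) + real (card T') * exp (- r / 4) +
      2 * exp (2 * (2 * K\<^sup>2 * B)) / (exp (- 2 * B) / 4 * \<delta>) * (exp (- r / 16) + measure joint (space joint - S))"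
    unfolding prior[symmetric]
  proof (rule M.posterior_mass_bound[OF A(1) _ near _ A(2) S(1) _ net r_pos \<delta> F far])
    show "0 < 2 * K\<^sup>2 * B" using K2 B by (intro mult_pos_pos) linarith+
    show "finite T'" using T(1) by (simp add: T'_def)
  qed auto
  \<comment> \<open>In the last term \<open>exp (4 * K\<^sup>2 * B)\<close> comes from the
    likelihood ratio and \<open>exp (2 * B)\<close> from the prior mass, together
    \<open>exp ((a - 1) * B)\<close>. The factor 3 counts the test error, the tail of the scale and
    the ellipsoid.\<close>
  also have "\<dots> \<le> 2 * exp (- B) + exp (- B) + 8 * exp ((a - 1) * B) / \<delta> * (3 * exp (- (a * B)))"
  proof (intro add_mono)
    have "B * 1 \<le> B * (4 * K\<^sup>2)" using K2 B by (intro mult_left_mono) auto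
    then show "2 * exp (- 2 * (2 * K\<^sup>2 * B)) \<le> 2 * exp (- B)" by (simp add: mult.commute)
    have "real (card T') \<le> exp (R + 4 * \<Phi>)" using T(2) card_image_le[OF T(1)] unfolding T'_def by (meson of_nat_le_iff order_trans)
    then have "real (card T') * exp (- r / 4) \<le> exp (R + 4 * \<Phi>) * exp (- r / 4)" by (intro mult_right_mono) auto
    also have "\<dots> \<le> exp (- B)" using r4 by (simp flip: exp_add)
    finally show "real (card T') * exp (- r / 4) \<le> exp (- B)" .
    have "2 * exp (2 * (2 * K\<^sup>2 * B)) / (exp (- 2 * B) / 4 * \<delta>) = 8 * exp ((a - 1) * B) / \<delta>"
      by (simp add: a_def exp_minus field_simps flip: exp_add)
    moreover have "exp (- r / 16) + measure joint (space joint - S) \<le> 3 * exp (- (a * B))"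
    proof -
      have "exp (- r / 16) \<le> exp (- (a * B))" using r16 by simp
      moreover have "\<Phi> / 2 - R / 4 = - (a * B)" by (simp add: R_def add_divide_distrib)
      then have "measure joint (space joint - S) \<le> exp (- (a * B)) + exp (- (a * B))" using S(2) by simp
      ultimately show ?thesis by linarith
    qed
    ultimately show "2 * exp (2 * (2 * K\<^sup>2 * B)) / (exp (- 2 * B) / 4 * \<delta>) * (exp (- r / 16) + measure joint (space joint - S)) \<le>
        8 * exp ((a - 1) * B) / \<delta> * (3 * exp (- (a * B)))"
      using \<delta> by (simp only:) (intro mult_left_mono, auto)
  qed
  also have "\<dots> = (3 + 24 / \<delta>) * exp (- B)"
  proof -
    have "exp ((a - 1) * B) * exp (- (a * B)) = exp (- B)" by (simp add: algebra_simps flip: exp_add)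
    then show ?thesis by (simp add: algebra_simps)
  qed
  finally show ?thesis unfolding F_def .
qed

end

section \<open>Sums and limits\<close>

lemma eventually_at_top_in:
  "eventually P (at_top_in N) \<longleftrightarrow> (\<exists>n0. \<forall>n\<in>N. n0 \<le> n \<longrightarrow> P n)"
  unfolding at_top_in_def eventually_inf_principal eventually_sequentially by blast

lemma at_top_in_le: "at_top_in N \<le> sequentially"
  unfolding at_top_in_def by (rule inf_le1)

lemma eventually_at_top_in_mem: "eventually (\<lambda>n. n \<in> N) (at_top_in N)"
  unfolding eventually_at_top_in by blast

lemma sum_inverse_sqrt_le: "(\<Sum>j\<in>{1..m}. 1 / sqrt (real j)) \<le> 2 * sqrt (real m)"
proof (induction m)
  case (Suc m)
  define a b where "a = sqrt (real m)" and "b = sqrt (real (Suc m))"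
  have ab: "a \<ge> 0" "b > 0" "a \<le> b" by (auto simp: a_def b_def)
  have sq: "b * b = a * a + 1" by (simp add: a_def b_def)
  have "0 \<le> (b - a)\<^sup>2" by simp
  also have "(b - a)\<^sup>2 = b * b + a * a - 2 * a * b" by (simp add: power2_eq_square algebra_simps)
  finally have "2 * a * b + 1 \<le> 2 * (b * b)" using sq by linarith
  then have "2 * a + 1 / b \<le> 2 * b" using ab by (simp add: field_simps)
  then show ?case using Suc by (simp add: a_def b_def)
qed simp

text \<open>A discrete integral comparison: ln (1 - 1/y) <= -1/y at y = j + 1, followed by 1 + x <=
  exp x.\<close>

lemma powr_minus_le_telescope:
  fixes s :: real and j :: nat
  assumes s: "s > 1" and j: "j \<ge> 1"
  shows "real (Suc j) powr (- s) \<le> (real j powr (1 - s) - real (Suc j) powr (1 - s)) / (s - 1)"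
proof -
  define y where "y = real (Suc j)"
  have y: "y > 1" using j by (simp add: y_def)
  have "ln (1 - 1 / y) \<le> - (1 / y)" using ln_le_minus_one[of "1 - 1 / y"] y by simp
  moreover have "1 - 1 / y = real j / y" using y by (simp add: y_def field_simps)
  ultimately have ln: "ln (real j) - ln y \<le> - (1 / y)" using y j by (simp add: ln_div)
  have "1 + (s - 1) * (1 / y) \<le> exp ((s - 1) * (1 / y))" by (rule exp_ge_add_one_self)
  also have "\<dots> \<le> exp ((1 - s) * (ln (real j) - ln y))"
  proof -
    have "(s - 1) * (ln (real j) - ln y) \<le> (s - 1) * - (1 / y)" using ln s by (intro mult_left_mono) auto
    then show ?thesis by (simp add: algebra_simps)
  qed
  also have "\<dots> = real j powr (1 - s) / y powr (1 - s)"
    using j y by (simp add: powr_def right_diff_distrib exp_diff)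
  finally have "(1 + (s - 1) * (1 / y)) * y powr (1 - s) \<le> real j powr (1 - s)"
    using y by (simp add: field_simps)
  moreover have "y powr (1 - s) / y = y powr (- s)"
    using y powr_diff[of y "1 - s" 1] by simp
  moreover have "(1 + (s - 1) * (1 / y)) * y powr (1 - s) = y powr (1 - s) + (s - 1) * (y powr (1 - s) / y)"
    by (simp add: distrib_right)
  ultimately have "(s - 1) * y powr (- s) \<le> real j powr (1 - s) - y powr (1 - s)"
    by simp
  then show ?thesis using s by (simp add: y_def field_simps)
qed

lemma sum_powr_tail_le:
  fixes s :: real
  assumes s: "s > 1" and p: "p \<ge> 1"
  shows "(\<Sum>j\<in>{Suc p..m}. real j powr (- s)) \<le> real p powr (1 - s) / (s - 1)"
proof (cases "p \<le> m")
  case True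
  then have "(\<Sum>j\<in>{Suc p..m}. real j powr (- s)) \<le> (real p powr (1 - s) - real m powr (1 - s)) / (s - 1)"
  proof (induction m rule: dec_induct)
    case (step m)
    have "(\<Sum>j\<in>{Suc p..Suc m}. real j powr (- s)) = (\<Sum>j\<in>{Suc p..m}. real j powr (- s)) + real (Suc m) powr (- s)"
      using step.hyps by (simp add: sum.nat_ivl_Suc')
    also have "\<dots> \<le> (real p powr (1 - s) - real m powr (1 - s)) / (s - 1) +
        (real m powr (1 - s) - real (Suc m) powr (1 - s)) / (s - 1)"
      using step.IH powr_minus_le_telescope[OF s, of m] p step.hyps by (intro add_mono) auto
    also have "\<dots> = (real p powr (1 - s) - real (Suc m) powr (1 - s)) / (s - 1)"
      by (simp add: diff_divide_distrib)
    finally show ?case .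
  qed simp
  also have "\<dots> \<le> real p powr (1 - s) / (s - 1)"
    using s by (intro divide_right_mono) auto
  finally show ?thesis .
qed (use s in auto)

text \<open>The bound is linear in \<open>c\<close> without a logarithm, because the summand depends
  on j / c only and is summable on that scale: logarithmic growth for j up to c, a power tail with
  exponent s > 1 beyond. The rate of the power prior owes its lack of a logarithm to this.\<close>

lemma sum_ln_power_le:
  fixes a s :: real
  assumes a: "a > 0" and s: "s > 1"
  obtains C where "C > 0"
    "\<And>c m. c \<ge> 1 \<Longrightarrow> (\<Sum>j\<in>{1..m}. ln (1 + a * (c / real j) powr s)) \<le> C * c"
proof
  let ?C = "ln (1 + a) + 4 * s + a * 2 powr (s - 1) / (s - 1)"
  show "?C > 0" using a s by (intro add_pos_pos divide_pos_pos mult_pos_pos) auto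
  fix c :: real and m :: nat
  assume c: "c \<ge> 1"
  define p where "p = nat \<lfloor>c\<rfloor>"
  have "real p = of_int \<lfloor>c\<rfloor>" "\<lfloor>c\<rfloor> \<ge> 1" using c by (auto simp: p_def le_floor_iff)
  then have p: "p \<ge> 1" "real p \<le> c" "c / 2 \<le> real p" by linarith+
  define h where "h j = ln (1 + a * (c / real j) powr s)" for j :: nat
  have h0: "h j \<ge> 0" for j unfolding h_def using a by (intro ln_ge_zero) simp
  have "(\<Sum>j\<in>{1..m}. h j) \<le> (\<Sum>j\<in>{1..p} \<union> {Suc p..m}. h j)"
    by (intro sum_mono2) (use h0 in auto)
  also have "\<dots> = (\<Sum>j\<in>{1..p}. h j) + (\<Sum>j\<in>{Suc p..m}. h j)"
    by (intro sum.union_disjoint) auto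
  \<comment> \<open>The crude estimate ln x <= 2 sqrt x suffices, since the sum of sqrt(c / j) over
    j <= c is still of order \<open>c\<close>.\<close>
  also have "(\<Sum>j\<in>{1..p}. h j) \<le> (\<Sum>j\<in>{1..p}. ln (1 + a) + 2 * s * sqrt c * (1 / sqrt (real j)))"
  proof (intro sum_mono)
    fix j assume j: "j \<in> {1..p}"
    define x where "x = c / real j"
    have "real j \<le> c" using j p(2) by (simp add: order_trans[OF _ p(2)])
    then have x: "x \<ge> 1" using j by (simp add: x_def)
    have "1 + a * x powr s \<le> (1 + a) * x powr s"
      using ge_one_powr_ge_zero[of x s] x s by (simp add: algebra_simps)
    then have "h j \<le> ln ((1 + a) * x powr s)"
      unfolding h_def x_def[symmetric] using a x by (subst ln_le_cancel_iff) (auto simp: add_pos_pos)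
    also have "\<dots> = ln (1 + a) + s * ln x" using a x by (simp add: ln_mult ln_powr)
    also have "ln x \<le> 2 * sqrt x"
      using ln_le_minus_one[of "sqrt x"] x by (simp add: ln_sqrt)
    also have "sqrt x = sqrt c * (1 / sqrt (real j))" by (simp add: x_def real_sqrt_divide)
    finally show "h j \<le> ln (1 + a) + 2 * s * sqrt c * (1 / sqrt (real j))"
      using s by (simp add: mult_left_mono mult_ac)
  qed
  also have "\<dots> = real p * ln (1 + a) + 2 * s * sqrt c * (\<Sum>j\<in>{1..p}. 1 / sqrt (real j))"
    by (simp add: sum.distrib sum_distrib_left)
  also have "\<dots> \<le> c * ln (1 + a) + 2 * s * sqrt c * (2 * sqrt c)"
  proof (intro add_mono mult_left_mono mult_right_mono)
    have "sqrt (real p) \<le> sqrt c" using p(2) by simp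
    then show "(\<Sum>j\<in>{1..p}. 1 / sqrt (real j)) \<le> 2 * sqrt c" using sum_inverse_sqrt_le[of p] by linarith
  qed (use a s p c in auto)
  also have "2 * s * sqrt c * (2 * sqrt c) = 4 * s * c" using c by simp
  also have "(\<Sum>j\<in>{Suc p..m}. h j) \<le> (\<Sum>j\<in>{Suc p..m}. a * c powr s * real j powr (- s))"
  proof (intro sum_mono)
    fix j assume j: "j \<in> {Suc p..m}"
    have "h j \<le> a * (c / real j) powr s" unfolding h_def using a by (intro ln_add_one_self_le_self) simp
    also have "\<dots> = a * c powr s * real j powr (- s)"
      using c by (simp add: powr_divide powr_minus field_simps)
    finally show "h j \<le> a * c powr s * real j powr (- s)" .
  qed
  also have "\<dots> = a * c powr s * (\<Sum>j\<in>{Suc p..m}. real j powr (- s))" by (simp add: sum_distrib_left)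
  also have "\<dots> \<le> a * c powr s * (real p powr (1 - s) / (s - 1))"
    using a sum_powr_tail_le[OF s p(1), of m] by (intro mult_left_mono) auto
  also have "\<dots> \<le> a * c powr s * ((c / 2) powr (1 - s) / (s - 1))"
    using a s c p by (intro mult_left_mono divide_right_mono powr_mono2') auto
  also have "\<dots> = a * 2 powr (s - 1) / (s - 1) * c"
  proof -
    have "c powr s * c powr (1 - s) = c" using c by (simp flip: powr_add)
    moreover have "(c / 2) powr (1 - s) = c powr (1 - s) * 2 powr (s - 1)"
    proof -
      have e: "2 powr (s - 1) = inverse (2 powr (1 - s))"
        using powr_minus[of "2 :: real" "1 - s"] by (simp only: minus_diff_eq)
      have "(c / 2) powr (1 - s) = c powr (1 - s) / 2 powr (1 - s)" using c by (simp add: powr_divide)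
      then show ?thesis unfolding e divide_inverse .
    qed
    ultimately have "c powr s * (c / 2) powr (1 - s) = c * 2 powr (s - 1)"
      by (simp only: mult.assoc[symmetric])
    then show ?thesis by (simp add: mult.assoc)
  qed
  finally show "(\<Sum>j\<in>{1..m}. ln (1 + a * (c / real j) powr s)) \<le> ?C * c"
    by (simp add: h_def algebra_simps)
qed

lemma ln_le_powr:
  fixes x \<rho> :: real
  assumes "x \<ge> 1" "\<rho> > 0"
  shows "ln x \<le> x powr \<rho> / \<rho>"
proof -
  have "\<rho> * ln x = ln (x powr \<rho>)" using assms by (simp add: ln_powr)
  also have "\<dots> \<le> x powr \<rho> - 1" using assms by (intro ln_le_minus_one) auto
  finally show ?thesis using assms by (simp add: field_simps)
qed

section \<open>Contraction from bounds on cost and complexity\<close>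

text \<open>The hypothesis bounds exactly the derivative of the logit of the link. As
  \<open>\<Psi> x * (1 - \<Psi> x) \<le> 1\<close>, it bounds the derivative of
  \<open>\<Psi>\<close> as well.\<close>

lemma bernoulli_link_of_deriv:
  assumes onto: "range \<Psi> = {0<..<1}" and diff: "\<And>x. \<Psi> differentiable (at x)"
    and bdd: "\<And>x. \<bar>deriv \<Psi> x / (\<Psi> x * (1 - \<Psi> x))\<bar> \<le> K0"
  shows "bernoulli_link \<Psi> (max K0 1)"
proof
  let ?K = "max K0 1"
  have rng: "\<Psi> x \<in> {0<..<1}" for x using onto by blast
  then show "\<Psi> x \<in> {0<..<1}" for x .
  have pos: "\<Psi> x * (1 - \<Psi> x) > 0" "\<Psi> x * (1 - \<Psi> x) \<le> 1" for x
    using rng[of x] by (auto intro: mult_le_one)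
  have der: "(\<Psi> has_real_derivative deriv \<Psi> x) (at x)" for x
    using diff[of x] by (metis DERIV_imp_deriv real_differentiable_def)
  have lip: "\<bar>h x - h y\<bar> \<le> ?K * \<bar>x - y\<bar>"
    if "\<And>x. (h has_real_derivative h' x) (at x)" "\<And>x. \<bar>h' x\<bar> \<le> ?K" for h h' :: "real \<Rightarrow> real" and x y
    using field_differentiable_bound[of UNIV h h' ?K x y] that by simp
  show "\<Psi> \<in> borel_measurable borel"
    using der by (intro borel_measurable_continuous_onI continuous_at_imp_continuous_on) (auto intro: DERIV_isCont)
  show "\<bar>\<Psi> x - \<Psi> y\<bar> \<le> ?K * \<bar>x - y\<bar>" for x y
  proof (rule lip[OF der])
    fix x
    define q where "q = \<Psi> x * (1 - \<Psi> x)"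
    have "\<bar>deriv \<Psi> x\<bar> = \<bar>deriv \<Psi> x / q\<bar> * q"
      using pos(1)[of x] by (simp add: q_def[symmetric] abs_divide)
    also have "\<dots> \<le> ?K * 1"
      using bdd[of x] pos[of x] unfolding q_def by (intro mult_mono) auto
    finally show "\<bar>deriv \<Psi> x\<bar> \<le> ?K" by simp
  qed
  show "\<bar>logit (\<Psi> x) - logit (\<Psi> y)\<bar> \<le> ?K * \<bar>x - y\<bar>" for x y
  proof (rule lip[where h = "\<lambda>x. logit (\<Psi> x)"])
    fix x
    have r: "0 < \<Psi> x" "\<Psi> x < 1" using rng[of x] by auto
    have "((\<lambda>x. ln (\<Psi> x) - ln (1 - \<Psi> x)) has_real_derivative
        deriv \<Psi> x / \<Psi> x - (0 - deriv \<Psi> x) / (1 - \<Psi> x)) (at x)"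
      using r by (auto intro!: derivative_eq_intros der)
    moreover have "(\<lambda>x. ln (\<Psi> x) - ln (1 - \<Psi> x)) = (\<lambda>x. logit (\<Psi> x))"
    proof
      show "ln (\<Psi> x) - ln (1 - \<Psi> x) = logit (\<Psi> x)" for x
        using rng[of x] by (simp add: logit_def ln_div)
    qed
    moreover have "deriv \<Psi> x / \<Psi> x - (0 - deriv \<Psi> x) / (1 - \<Psi> x) = deriv \<Psi> x / (\<Psi> x * (1 - \<Psi> x))"
      using r by (simp add: field_simps)
    ultimately show "((\<lambda>x. logit (\<Psi> x)) has_real_derivative deriv \<Psi> x / (\<Psi> x * (1 - \<Psi> x))) (at x)" by simp
  qed (use bdd le_max_iff_disj in blast)
qed simp

text \<open>The geometry condition speaks of indices up to \<open>\<kappa>0 * n\<close>. Beyond them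
  the eigenvalues are at least the one at the floor of \<open>\<kappa>0 * n\<close>, and as j/n < 1
  a smaller constant covers all remaining indices.\<close>

lemma geometry_eigenvalue_lower_bound:
  assumes r: "r \<ge> 1" and graphs: "\<And>n. n \<in> N \<Longrightarrow> conn_graph n (G n)"
    and geometry: "geometry_condition r N G"
  obtains i0 a where "i0 \<ge> 1" "a > 0"
    "\<forall>\<^sub>F n in at_top_in N. \<forall>j. i0 \<le> j \<and> j < n \<longrightarrow>
      a * (real j / real n) powr (2 / r) \<le> laplacian_eigenvalue n (G n) j"
proof -
  obtain i0 \<kappa>0 C1 C2 where g: "0 < \<kappa>0" "\<kappa>0 \<le> 1" "0 < C1"
    "\<forall>\<^sub>F n in at_top_in N. \<forall>i. i0 \<le> i \<and> real i \<le> \<kappa>0 * real n \<and> i \<le> n - 1 \<longrightarrow>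
        C1 * (real i / real n) powr (2 / r) \<le> laplacian_eigenvalue n (G n) i \<and>
        laplacian_eigenvalue n (G n) i \<le> C2 * (real i / real n) powr (2 / r)"
    using geometry unfolding geometry_condition_def by blast
  define a where "a = C1 * (\<kappa>0 / 2) powr (2 / r)"
  have p: "2 / r > 0" using r by simp
  have aC1: "a \<le> C1"
    unfolding a_def using g r powr_le1[of "2 / r" "\<kappa>0 / 2"] by simp
  \<comment> \<open>Ensures \<open>\<kappa>0 * n \<ge> 2\<close>, so that the floor \<open>m\<close>
    is at least half of \<open>\<kappa>0 * n\<close>, and \<open>\<kappa>0 * n \<ge> i0 + 1\<close>,
    so that \<open>m \<ge> i0\<close>.\<close>
  define n1 where "n1 = nat \<lceil>max (2 / \<kappa>0) ((real i0 + 1) / \<kappa>0)\<rceil>"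
  have n1: "real n \<ge> 2 / \<kappa>0" "real n \<ge> (real i0 + 1) / \<kappa>0" if "n \<ge> n1" for n
    using that unfolding n1_def by linarith+
  have "\<forall>\<^sub>F n in at_top_in N. n \<ge> n1" unfolding eventually_at_top_in by blast
  then have "\<forall>\<^sub>F n in at_top_in N. \<forall>j. max i0 1 \<le> j \<and> j < n \<longrightarrow>
      a * (real j / real n) powr (2 / r) \<le> laplacian_eigenvalue n (G n) j"
    using g(4) eventually_at_top_in_mem
  proof eventually_elim
    case (elim n)
    have large: "\<kappa>0 * real n \<ge> 2" "\<kappa>0 * real n \<ge> real i0 + 1"
      using n1[OF elim(1)] g(1) by (simp_all add: field_simps)
    obtain U where mono: "\<And>i j. i \<le> j \<Longrightarrow> j < n \<Longrightarrow> laplacian_eigenvalue n (G n) i \<le> laplacian_eigenvalue n (G n) j"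
      using laplacian_spectral[OF graphs[OF elim(3)]] by metis
    show ?case
    proof (intro allI impI)
      fix j assume j: "max i0 1 \<le> j \<and> j < n"
      show "a * (real j / real n) powr (2 / r) \<le> laplacian_eigenvalue n (G n) j"
      proof (cases "real j \<le> \<kappa>0 * real n")
        case True
        have "a * (real j / real n) powr (2 / r) \<le> C1 * (real j / real n) powr (2 / r)"
          using aC1 by (intro mult_right_mono) auto
        also have "\<dots> \<le> laplacian_eigenvalue n (G n) j" using elim(2) True j by auto
        finally show ?thesis .
      next
        case False
        define m where "m = nat \<lfloor>\<kappa>0 * real n\<rfloor>"
        have m_eq: "real m = of_int \<lfloor>\<kappa>0 * real n\<rfloor>" using large(1) by (simp add: m_def)
        have m: "real m \<le> \<kappa>0 * real n" "real m \<ge> \<kappa>0 * real n - 1" unfolding m_eq by linarith+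
        have mj: "m \<le> j" "i0 \<le> m" using m False large by linarith+
        have n: "real n > 0" using j by simp
        have "\<kappa>0 / 2 \<le> real m / real n" using m large n by (simp add: field_simps)
        have "a * (real j / real n) powr (2 / r) \<le> a * 1"
          using j p g(3) by (intro mult_left_mono powr_le1) (auto simp: a_def)
        also have "a \<le> C1 * (real m / real n) powr (2 / r)"
          unfolding a_def using g \<open>\<kappa>0 / 2 \<le> real m / real n\<close> p
          by (intro mult_left_mono powr_mono2) auto
        also have "\<dots> \<le> laplacian_eigenvalue n (G n) m" using elim(2) m mj j by auto
        also have "\<dots> \<le> laplacian_eigenvalue n (G n) j" using mono mj j by auto
        finally show ?thesis by simp
      qed
    qed
  qed
  moreover have "a > 0" using g by (simp add: a_def)
  ultimately show thesis using that[of "max i0 1" a] by simp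
qed

lemma sobolev_ball_spectral:
  assumes U: "U \<in> carrier_mat n n" "transpose_mat U * U = 1\<^sub>m n"
    and L: "laplacian n G = U * mat_diag n d * transpose_mat U" and n: "n > 0"
    and f: "f \<in> sobolev_ball r n G \<beta> C"
  shows "(\<Sum>j<n. (1 + (real n powr (2 / r) * d j) powr \<beta>) * (\<Sum>i<n. U $$ (i, j) * f i)\<^sup>2) \<le> real n * C\<^sup>2"
proof -
  let ?x = "real n powr (2 / r)"
  let ?e = "\<lambda>j. (?x * d j) powr \<beta> + 1"
  have c: "U * mat_diag n (\<lambda>j. (?x * d j) powr \<beta>) * transpose_mat U \<in> carrier_mat n n"
    using U by (intro mult_carrier_mat mat_diag_dim) auto
  have "mat_powr (?x \<cdot>\<^sub>m laplacian n G) \<beta> = U * mat_diag n (\<lambda>j. (?x * d j) powr \<beta>) * transpose_mat U"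
    unfolding L spectral_smult[OF U(1)] by (rule spectral_fun_eq[OF U])
  have "1\<^sub>m n + mat_powr (?x \<cdot>\<^sub>m laplacian n G) \<beta> =
      U * mat_diag n (\<lambda>j. (?x * d j) powr \<beta>) * transpose_mat U + 1 \<cdot>\<^sub>m 1\<^sub>m n"
  proof -
    have "(1::real) \<cdot>\<^sub>m 1\<^sub>m n = 1\<^sub>m n" by (rule eq_matI) auto
    then show ?thesis using comm_add_mat[OF one_carrier_mat c] \<open>mat_powr _ \<beta> = _\<close> by simp
  qed
  also have "\<dots> = U * mat_diag n ?e * transpose_mat U" by (rule spectral_add_smult_one[OF U])
  finally have "inner_n n f (mat_app n (U * mat_diag n ?e * transpose_mat U) f) \<le> C\<^sup>2"
    using f unfolding sobolev_ball_def by simp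
  moreover have "(\<Sum>i<n. f i * mat_app n (U * mat_diag n ?e * transpose_mat U) f i) =
      (\<Sum>j<n. ?e j * (\<Sum>i<n. U $$ (i, j) * f i)\<^sup>2)"
  proof -
    have "(\<Sum>i<n. f i * mat_app n (U * mat_diag n ?e * transpose_mat U) f i) =
        (\<Sum>i<n. \<Sum>j<n. f i * (U $$ (i, j) * ?e j * (\<Sum>k<n. U $$ (k, j) * f k)))"
      by (intro sum.cong refl) (simp add: mat_app_spectral[OF U(1)] sum_distrib_left)
    also have "\<dots> = (\<Sum>j<n. \<Sum>i<n. f i * (U $$ (i, j) * ?e j * (\<Sum>k<n. U $$ (k, j) * f k)))"
      by (rule sum.swap)
    also have "\<dots> = (\<Sum>j<n. ?e j * (\<Sum>i<n. U $$ (i, j) * f i)\<^sup>2)"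
      by (intro sum.cong refl)
        (simp add: power2_eq_square sum_distrib_left sum_distrib_right algebra_simps)
    finally show ?thesis .
  qed
  ultimately show ?thesis using n by (simp add: inner_n_def field_simps)
qed

text \<open>\<open>B\<close> bounds the cost and has to diverge, as the error is of order exp(-B).
  \<open>H\<close> bounds the complexity at the enlarged cutoff and alone has to match the squared
  rate. Taking M at least \<open>sqrt (l * C)\<close> turns the last bound into the separation
  required of the tests.\<close>

theorem contracts_of_bounds:
  fixes \<epsilon> B :: "nat \<Rightarrow> real" and f0 :: "nat \<Rightarrow> nat \<Rightarrow> real"
  assumes K: "K \<ge> 1"
    and bounds: "\<forall>\<^sub>F n in at_top_in N. \<exists>U v k. mixture_model n U v \<Psi> K (f0 n) (p0 n) (\<mu> n) \<and>
      1 \<le> k \<and> k \<le> B n \<and>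
      (\<forall>c. k \<le> c \<and> c \<le> 2 * k \<longrightarrow>
        gaussian_scale_mixture.approx_cost n v (orthogonal_map.inv_rot n U (f0 n)) c \<le> B n) \<and>
      B n \<le> H n \<and> gaussian_scale_mixture.complexity n v ((4 * K\<^sup>2 + 3) * B n) \<le> H n \<and>
      H n \<le> C * (real n * (\<epsilon> n)\<^sup>2)"
    and B: "filterlim B at_top (at_top_in N)" and \<epsilon>: "\<And>n. \<epsilon> n \<ge> 0" and C: "C > 0"
  shows "contracts N \<mu> p0 \<epsilon>"
  unfolding contracts_def
proof (intro eventually_at_top_linorderI allI impI)
  define l where "l = 25 * K\<^sup>2 * (8 * (4 * K\<^sup>2 + 3) + 6)"
  have l: "l \<ge> 0" unfolding l_def by simp
  fix M \<delta> :: real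
  assume M: "M \<ge> sqrt (l * C)" and \<delta>: "\<delta> > 0"
  have M0: "M \<ge> 0" using M l C by (meson mult_nonneg_nonneg less_imp_le order_trans real_sqrt_ge_zero)
  have M2: "l * C \<le> M\<^sup>2" using M0 M l C by (metis real_sqrt_le_iff real_sqrt_abs abs_of_nonneg)
  let ?p = "\<lambda>n. measure_pmf.prob (data_law n (p0 n))
    {Y. measure (posterior n (\<mu> n) Y) {p \<in> space (\<mu> n). norm_n n (\<lambda>i. p i - p0 n i) \<ge> M * \<epsilon> n} > \<delta>}"
  have upper: "\<forall>\<^sub>F n in at_top_in N. ?p n \<le> (3 + 24 / \<delta>) * exp (- B n)"
    using bounds
  proof eventually_elim
    case (elim n)
    then obtain U v k where "mixture_model n U v \<Psi> K (f0 n) (p0 n) (\<mu> n)"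
      and k: "1 \<le> k" "k \<le> B n"
      and cost: "\<And>c. k \<le> c \<Longrightarrow> c \<le> 2 * k \<Longrightarrow>
        gaussian_scale_mixture.approx_cost n v (orthogonal_map.inv_rot n U (f0 n)) c \<le> B n"
      and H: "B n \<le> H n" "gaussian_scale_mixture.complexity n v ((4 * K\<^sup>2 + 3) * B n) \<le> H n"
      and HC: "H n \<le> C * (real n * (\<epsilon> n)\<^sup>2)"
      by blast
    interpret mixture_model n U v \<Psi> K "f0 n" "p0 n" "\<mu> n" by fact
    have D: "l * H n \<le> real n * (M * \<epsilon> n)\<^sup>2"
    proof -
      have "l * H n \<le> l * (C * (real n * (\<epsilon> n)\<^sup>2))" using HC l by (intro mult_left_mono) auto
      also have "\<dots> \<le> M\<^sup>2 * (real n * (\<epsilon> n)\<^sup>2)" using M2 by (simp add: mult.assoc[symmetric] mult_right_mono)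
      finally show ?thesis by (simp add: power_mult_distrib mult_ac)
    qed
    show ?case
      by (rule posterior_contraction_bound[OF k cost H _ _ \<delta>]) (use D M0 \<epsilon>[of n] in \<open>auto simp: l_def\<close>)
  qed
  have "((\<lambda>n. (3 + 24 / \<delta>) * exp (- B n)) \<longlongrightarrow> (3 + 24 / \<delta>) * 0) (at_top_in N)"
    by (intro tendsto_mult tendsto_const filterlim_compose[OF exp_at_bot]
        filterlim_compose[OF filterlim_uminus_at_bot_at_top] B)
  then have lim: "((\<lambda>n. (3 + 24 / \<delta>) * exp (- B n)) \<longlongrightarrow> 0) (at_top_in N)" by simp
  show "(?p \<longlongrightarrow> 0) (at_top_in N)"
    by (rule tendsto_sandwich[OF _ upper tendsto_const lim]) (simp add: always_eventually)
qed

section \<open>Complexity of the two priors\<close>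

definition power_var :: "real \<Rightarrow> real \<Rightarrow> nat \<Rightarrow> (nat \<Rightarrow> real) \<Rightarrow> real \<Rightarrow> nat \<Rightarrow> real" where
  "power_var r \<alpha> n d c j =
    inverse (((real n / c) powr (2 / r) * (d j + 1 / (real n)\<^sup>2)) powr (\<alpha> + r / 2))"

definition exp_var :: "real \<Rightarrow> nat \<Rightarrow> (nat \<Rightarrow> real) \<Rightarrow> real \<Rightarrow> nat \<Rightarrow> real" where
  "exp_var r n d c j = real n * exp (- ((real n / c) powr (2 / r)) * d j)"

lemma power_cov_spectral:
  assumes U: "U \<in> carrier_mat n n" "transpose_mat U * U = 1\<^sub>m n"
    and L: "laplacian n G = U * mat_diag n d * transpose_mat U"
  shows "spectral_fun sqrt (power_cov r \<alpha> n G c) =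
    U * mat_diag n (\<lambda>j. sqrt (power_var r \<alpha> n d c j)) * transpose_mat U"
  unfolding power_cov_def L spectral_add_smult_one[OF U] spectral_smult[OF U(1)] spectral_fun_eq[OF U]
    power_var_def ..

lemma exp_cov_spectral:
  assumes U: "U \<in> carrier_mat n n" "transpose_mat U * U = 1\<^sub>m n"
    and L: "laplacian n G = U * mat_diag n d * transpose_mat U"
  shows "spectral_fun sqrt (exp_cov r n G c) =
    U * mat_diag n (\<lambda>j. sqrt (exp_var r n d c j)) * transpose_mat U"
  unfolding exp_cov_def L spectral_smult[OF U(1)] spectral_fun_eq[OF U] exp_var_def ..

lemma power_var_mixture:
  assumes U: "U \<in> carrier_mat n n" "transpose_mat U * U = 1\<^sub>m n"
    and r: "r \<ge> 1" and \<alpha>: "\<alpha> > 0" and d: "\<And>j. j < n \<Longrightarrow> d j \<ge> 0"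
  shows "gaussian_scale_mixture n (\<lambda>i j. U $$ (i, j)) (power_var r \<alpha> n d)"
proof -
  interpret orthogonal_map n "\<lambda>i j. U $$ (i, j)" by (rule orthogonal_map_mat[OF U])
  show ?thesis
  proof
    show "(\<lambda>c. power_var r \<alpha> n d c j) \<in> borel_measurable borel" for j
      unfolding power_var_def by measurable
    show "power_var r \<alpha> n d c j \<ge> 0" for c j unfolding power_var_def by simp
    fix c c' :: real and j assume c: "0 < c" "c \<le> c'" and j: "j < n"
    have n: "real n > 0" using j by simp
    have y: "d j + 1 / (real n)\<^sup>2 > 0" using d[OF j] n by (intro add_nonneg_pos) auto
    have "(real n / c') powr (2 / r) \<le> (real n / c) powr (2 / r)"
      using c n r by (intro powr_mono2 divide_left_mono) auto
    then have "(real n / c') powr (2 / r) * (d j + 1 / (real n)\<^sup>2) \<le>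
        (real n / c) powr (2 / r) * (d j + 1 / (real n)\<^sup>2)"
      using y by (intro mult_right_mono) auto
    then have "((real n / c') powr (2 / r) * (d j + 1 / (real n)\<^sup>2)) powr (\<alpha> + r / 2) \<le>
        ((real n / c) powr (2 / r) * (d j + 1 / (real n)\<^sup>2)) powr (\<alpha> + r / 2)"
      using y \<alpha> r by (auto intro: powr_mono2)
    moreover have "((real n / c') powr (2 / r) * (d j + 1 / (real n)\<^sup>2)) powr (\<alpha> + r / 2) > 0"
      using y c n by simp
    ultimately show "power_var r \<alpha> n d c j \<le> power_var r \<alpha> n d c' j"
      unfolding power_var_def by (rule le_imp_inverse_le)
  qed
qed

lemma exp_var_mixture:
  assumes U: "U \<in> carrier_mat n n" "transpose_mat U * U = 1\<^sub>m n"
    and r: "r \<ge> 1" and d: "\<And>j. j < n \<Longrightarrow> d j \<ge> 0"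
  shows "gaussian_scale_mixture n (\<lambda>i j. U $$ (i, j)) (exp_var r n d)"
proof -
  interpret orthogonal_map n "\<lambda>i j. U $$ (i, j)" by (rule orthogonal_map_mat[OF U])
  show ?thesis
  proof
    show "(\<lambda>c. exp_var r n d c j) \<in> borel_measurable borel" for j
      unfolding exp_var_def by measurable
    show "exp_var r n d c j \<ge> 0" for c j unfolding exp_var_def by simp
    fix c c' :: real and j assume c: "0 < c" "c \<le> c'" and j: "j < n"
    have "(real n / c') powr (2 / r) \<le> (real n / c) powr (2 / r)"
      using c j r by (intro powr_mono2 divide_left_mono) auto
    then have "(real n / c') powr (2 / r) * d j \<le> (real n / c) powr (2 / r) * d j"
      using d[OF j] by (rule mult_right_mono)
    then show "exp_var r n d c j \<le> exp_var r n d c' j"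
      unfolding exp_var_def by (intro mult_left_mono) auto
  qed
qed

lemma (in gaussian_scale_mixture) approx_cost_le:
  assumes c: "c > 0"
  shows "approx_cost g c \<le> complexity c + (\<Sum>j<n. (g j)\<^sup>2 / (1 + 2 * v c j))"
  unfolding approx_cost_def complexity_def sum.distrib[symmetric]
proof (intro sum_mono)
  fix j assume "j \<in> {..<n}"
  then have v: "v c j \<ge> 0" using v_nonneg c by simp
  have "ln (1 + 2 * v c j) \<le> ln ((1 + v c j)\<^sup>2)"
    using v by (subst ln_le_cancel_iff) (auto simp: power2_eq_square algebra_simps add_pos_nonneg)
  also have "\<dots> = 2 * ln (1 + v c j)" using v by (simp add: ln_realpow)
  finally show "ln (1 + 2 * v c j) / 2 + (g j)\<^sup>2 / (1 + 2 * v c j) \<le> ln (1 + v c j) + (g j)\<^sup>2 / (1 + 2 * v c j)"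
    by simp
qed

lemma sum_if_less_le:
  fixes T :: real
  assumes "T \<ge> 0"
  shows "(\<Sum>j<n. if j < m then T else 0) \<le> real m * T"
proof -
  have "(\<Sum>j<n. if j < m then T else 0) = real (card ({..<n} \<inter> {j. j < m})) * T"
    by (simp add: sum.If_cases)
  also have "\<dots> \<le> real m * T"
    using card_mono[of "{..<m}" "{..<n} \<inter> {j. j < m}"] assms by (intro mult_right_mono) auto
  finally show ?thesis .
qed

text \<open>The first bound uses only the shift by n^(-2) and tames the finitely many lowest
  eigenvalues, of which the geometry condition says nothing. The second uses the eigenvalue bound
  and has the form c / j required by \<open>sum_ln_power_le\<close>.\<close>

lemma power_var_le:
  fixes c :: real and n j :: nat
  assumes r: "r \<ge> 1" and \<alpha>: "\<alpha> > 0" and c: "c \<ge> 1" and n: "n \<ge> 1" and d: "d j \<ge> 0"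
  defines "\<gamma> \<equiv> \<alpha> + r / 2"
  defines "s \<equiv> 2 / r * \<gamma>"
  shows "power_var r \<alpha> n d c j \<le> c powr s * real n powr (2 * \<gamma>)"
    "a > 0 \<Longrightarrow> j \<ge> 1 \<Longrightarrow> a * (real j / real n) powr (2 / r) \<le> d j \<Longrightarrow>
      power_var r \<alpha> n d c j \<le> a powr (- \<gamma>) * (c / real j) powr s"
proof -
  define p where "p = 2 / r"
  define x where "x = (real n / c) powr p"
  have p: "p > 0" using r by (simp add: p_def)
  have \<gamma>: "\<gamma> > 0" using r \<alpha> by (simp add: \<gamma>_def)
  have s: "s = p * \<gamma>" by (simp add: s_def p_def)
  have x: "x > 0" using n c by (simp add: x_def)
  have mono: "power_var r \<alpha> n d c j \<le> inverse (z powr \<gamma>)" if "0 < z" "z \<le> x * (d j + 1 / (real n)\<^sup>2)" for z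
    unfolding power_var_def \<gamma>_def[symmetric] p_def[symmetric] x_def[symmetric]
    using that \<gamma> by (intro le_imp_inverse_le powr_mono2) auto
  have "power_var r \<alpha> n d c j \<le> inverse ((x * (1 / (real n)\<^sup>2)) powr \<gamma>)"
    using x n d by (intro mono mult_left_mono) auto
  also have "\<dots> = (c / real n) powr s * real n powr (2 * \<gamma>)"
  proof -
    have "inverse (x powr \<gamma>) = (c / real n) powr s"
      using n c by (simp add: x_def s powr_powr powr_divide)
    moreover have "inverse ((1 / (real n)\<^sup>2) powr \<gamma>) = real n powr (2 * \<gamma>)"
    proof -
      have "(real n)\<^sup>2 = real n powr 2" using n by simp
      then show ?thesis using n by (simp add: powr_divide powr_powr del: powr_numeral)
    qed
    moreover have "(x * (1 / (real n)\<^sup>2)) powr \<gamma> = x powr \<gamma> * (1 / (real n)\<^sup>2) powr \<gamma>"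
      by (rule powr_mult)
    ultimately show ?thesis by (simp only: inverse_mult_distrib)
  qed
  also have "\<dots> \<le> c powr s * real n powr (2 * \<gamma>)"
    using n c p \<gamma> by (intro mult_right_mono powr_mono2) (auto simp: s divide_le_eq)
  finally show "power_var r \<alpha> n d c j \<le> c powr s * real n powr (2 * \<gamma>)" .
  assume a: "a > 0" and j: "j \<ge> 1" and le: "a * (real j / real n) powr (2 / r) \<le> d j"
  have xa: "x * (a * (real j / real n) powr p) = a * (real j / c) powr p"
    using n c j by (simp add: x_def powr_divide)
  have "power_var r \<alpha> n d c j \<le> inverse ((x * (a * (real j / real n) powr p)) powr \<gamma>)"
    using x a j n le by (intro mono mult_left_mono) (auto simp: p_def intro: add_increasing2)
  also have "\<dots> = a powr (- \<gamma>) * (c / real j) powr s"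
    unfolding xa using a c j by (simp add: powr_mult powr_powr s powr_minus powr_divide, simp add: field_simps)
  finally show "power_var r \<alpha> n d c j \<le> a powr (- \<gamma>) * (c / real j) powr s" .
qed

lemma power_complexity_bound:
  fixes r \<alpha> a :: real and i0 :: nat
  assumes r: "r \<ge> 1" and \<alpha>: "\<alpha> > 0" and i0: "i0 \<ge> 1" and a: "a > 0"
  obtains C where "C > 0"
    "\<And>n d c. n \<ge> 1 \<Longrightarrow> (\<And>j. j < n \<Longrightarrow> d j \<ge> 0) \<Longrightarrow>
      (\<And>j. i0 \<le> j \<Longrightarrow> j < n \<Longrightarrow> a * (real j / real n) powr (2 / r) \<le> d j) \<Longrightarrow> c \<ge> 1 \<Longrightarrow>
      (\<Sum>j<n. ln (1 + power_var r \<alpha> n d c j)) \<le> C * (c + ln (real n))"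
proof -
  define \<gamma> where "\<gamma> = \<alpha> + r / 2"
  define s where "s = 2 / r * \<gamma>"
  have \<gamma>: "\<gamma> > 0" using r \<alpha> by (simp add: \<gamma>_def)
  \<comment> \<open>Indeed s = 1 + 2 \<alpha> / r; positivity of \<alpha> is what makes the tail of
    the variances summable.\<close>
  have s: "s > 1" using r \<alpha> by (simp add: s_def \<gamma>_def field_simps)
  define a' where "a' = a powr (- \<gamma>)"
  have a': "a' > 0" using a by (simp add: a'_def)
  obtain C0 where C0: "C0 > 0"
    "\<And>c m. c \<ge> 1 \<Longrightarrow> (\<Sum>j\<in>{1..m}. ln (1 + a' * (c / real j) powr s)) \<le> C0 * c"
    using sum_ln_power_le[OF a' s] by blast
  define C where "C = real i0 * (1 + s + 2 * \<gamma>) + C0"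
  show thesis
  proof
    show "C > 0" using C0 s \<gamma> by (auto simp: C_def intro!: add_nonneg_pos)
    fix n :: nat and d :: "nat \<Rightarrow> real" and c :: real
    assume n: "n \<ge> 1" and d: "\<And>j. j < n \<Longrightarrow> d j \<ge> 0"
      and low: "\<And>j. i0 \<le> j \<Longrightarrow> j < n \<Longrightarrow> a * (real j / real n) powr (2 / r) \<le> d j" and c: "c \<ge> 1"
    have lnn: "ln (real n) \<ge> 0" using n by simp
    define T where "T = 1 + s * c + 2 * \<gamma> * ln (real n)"
    have T: "T \<ge> 0" using s c \<gamma> lnn by (simp add: T_def)
    define h where "h j = ln (1 + a' * (c / real j) powr s)" for j :: nat
    have h0: "h j \<ge> 0" for j unfolding h_def using a' by (intro ln_ge_zero) simp
    have v0: "power_var r \<alpha> n d c j \<ge> 0" for j unfolding power_var_def by simp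
    have bound: "ln (1 + power_var r \<alpha> n d c j) \<le> (if j < i0 then T else 0) + (if j \<ge> 1 then h j else 0)"
      if j: "j < n" for j
    proof (cases "j < i0")
      case True
      define w where "w = c powr s * real n powr (2 * \<gamma>)"
      have w: "w \<ge> 1"
        using mult_mono[of 1 "c powr s" 1 "real n powr (2 * \<gamma>)"] c n s \<gamma>
        by (simp add: w_def ge_one_powr_ge_zero)
      have "power_var r \<alpha> n d c j \<le> w"
        unfolding w_def s_def \<gamma>_def by (rule power_var_le(1)[where d = d and j = j, OF r \<alpha> c n d[OF j]])
      then have "1 + power_var r \<alpha> n d c j \<le> 2 * w" using w by simp
      then have "ln (1 + power_var r \<alpha> n d c j) \<le> ln (2 * w)"
        using v0[of j] w by (subst ln_le_cancel_iff) auto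
      also have "\<dots> = ln 2 + s * ln c + 2 * \<gamma> * ln (real n)"
        using w c n by (simp add: w_def ln_mult ln_powr)
      also have "\<dots> \<le> T"
      proof -
        have "ln c \<le> c" using ln_le_minus_one[of c] c by simp
        then have "s * ln c \<le> s * c" using s by simp
        then show ?thesis using ln2_le_25_over_36 by (simp add: T_def)
      qed
      finally show ?thesis using True h0[of j] by simp
    next
      case False
      then have j1: "j \<ge> 1" using i0 by simp
      have "power_var r \<alpha> n d c j \<le> a' * (c / real j) powr s"
        unfolding a'_def s_def \<gamma>_def using False j
        by (intro power_var_le(2)[where d = d and j = j, OF r \<alpha> c n d[OF j] a j1] low) auto
      then have "ln (1 + power_var r \<alpha> n d c j) \<le> h j"
        unfolding h_def using v0[of j] by (subst ln_le_cancel_iff) auto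
      then show ?thesis using False j1 by simp
    qed
    have "(\<Sum>j<n. ln (1 + power_var r \<alpha> n d c j)) \<le>
        (\<Sum>j<n. (if j < i0 then T else 0) + (if j \<ge> 1 then h j else 0))"
      by (intro sum_mono bound) auto
    also have "\<dots> = (\<Sum>j<n. if j < i0 then T else 0) + (\<Sum>j<n. if j \<ge> 1 then h j else 0)"
      by (rule sum.distrib)
    also have "(\<Sum>j<n. if j \<ge> 1 then h j else 0) \<le> (\<Sum>j\<in>{1..n}. h j)"
    proof -
      have "(\<Sum>j<n. if j \<ge> 1 then h j else 0) = (\<Sum>j\<in>{..<n} \<inter> {j. j \<ge> 1}. h j)"
        by (simp add: sum.If_cases)
      also have "\<dots> \<le> (\<Sum>j\<in>{1..n}. h j)" by (intro sum_mono2) (use h0 in auto)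
      finally show ?thesis .
    qed
    also have "\<dots> \<le> C0 * c" unfolding h_def by (rule C0(2)[OF c])
    also have "(\<Sum>j<n. if j < i0 then T else 0) \<le> real i0 * T" by (rule sum_if_less_le[OF T])
    also have "real i0 * T + C0 * c \<le> C * (c + ln (real n))"
    proof -
      have "T \<le> (1 + s + 2 * \<gamma>) * (c + ln (real n))"
      proof -
        have "0 \<le> (1 + s) * ln (real n)" "0 \<le> 2 * \<gamma> * c" using s \<gamma> lnn c by simp_all
        then show ?thesis using c by (simp add: T_def algebra_simps)
      qed
      then have "real i0 * T \<le> real i0 * ((1 + s + 2 * \<gamma>) * (c + ln (real n)))"
        by (rule mult_left_mono) simp
      moreover have "C0 * c \<le> C0 * (c + ln (real n))" using C0 lnn by simp
      ultimately show ?thesis by (simp add: C_def algebra_simps)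
    qed
    finally show "(\<Sum>j<n. ln (1 + power_var r \<alpha> n d c j)) \<le> C * (c + ln (real n))" by simp
  qed
qed

text \<open>The variances are at most n, and below 1/n once j exceeds a multiple of c (ln n)^(r/2).
  The former indices cost at most 2 ln n each, the latter 1 in total. Assuming n >= 3 makes ln n >=
  1.\<close>

lemma exp_complexity_bound:
  fixes r a :: real and i0 :: nat
  assumes r: "r \<ge> 1" and i0: "i0 \<ge> 1" and a: "a > 0"
  obtains C where "C > 0"
    "\<And>n d c. n \<ge> 3 \<Longrightarrow> (\<And>j. j < n \<Longrightarrow> d j \<ge> 0) \<Longrightarrow>
      (\<And>j. i0 \<le> j \<Longrightarrow> j < n \<Longrightarrow> a * (real j / real n) powr (2 / r) \<le> d j) \<Longrightarrow> c \<ge> 1 \<Longrightarrow>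
      (\<Sum>j<n. ln (1 + exp_var r n d c j)) \<le> C * (c * ln (real n) powr (1 + r / 2))"
proof -
  \<comment> \<open>With this \<open>b\<close> the exponent \<open>a * (j / c) powr (2 / r)\<close>
    equals 2 ln n at the cutoff index \<open>D\<close>.\<close>
  define b where "b = (2 / a) powr (r / 2)"
  have b: "b > 0" using a by (simp add: b_def)
  define C where "C = 2 * (real i0 + b + 1) + 1"
  show thesis
  proof
    show "C > 0" using b by (simp add: C_def)
    fix n :: nat and d :: "nat \<Rightarrow> real" and c :: real
    assume n: "n \<ge> 3" and d: "\<And>j. j < n \<Longrightarrow> d j \<ge> 0"
      and low: "\<And>j. i0 \<le> j \<Longrightarrow> j < n \<Longrightarrow> a * (real j / real n) powr (2 / r) \<le> d j" and c: "c \<ge> 1"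
    define l where "l = ln (real n)"
    have l: "l \<ge> 1"
      unfolding l_def using n exp_le by (subst ln_ge_iff) auto
    define D where "D = b * c * l powr (r / 2)"
    define m where "m = nat \<lceil>D\<rceil>"
    have D: "D \<ge> 0" using b c by (simp add: D_def)
    have m: "real m \<le> D + 1" "D \<le> real m" unfolding m_def using D by linarith+
    have v0: "exp_var r n d c j \<ge> 0" for j unfolding exp_var_def by simp
    have bound: "ln (1 + exp_var r n d c j) \<le> (if j < max i0 m then 2 * l else 0) + 1 / real n"
      if j: "j < n" for j
    proof (cases "j < max i0 m")
      case True
      have "exp_var r n d c j \<le> real n * 1"
        unfolding exp_var_def using d[OF j] by (intro mult_left_mono) auto
      moreover have "1 + real n \<le> (real n)\<^sup>2" 
      proof -
        have "2 * real n \<le> real n * real n" using n by (intro mult_right_mono) auto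
        then show ?thesis unfolding power2_eq_square using n by linarith
      qed
      ultimately have "1 + exp_var r n d c j \<le> (real n)\<^sup>2" by linarith
      then have "ln (1 + exp_var r n d c j) \<le> ln ((real n)\<^sup>2)"
        using v0[of j] n by (subst ln_le_cancel_iff) auto
      also have "\<dots> = 2 * l" using n by (simp add: l_def ln_realpow)
      finally show ?thesis using True by (simp add: add_increasing2)
    next
      case False
      have n0: "real n > 0" using n by simp
      have jD: "D \<le> real j" "j \<ge> 1" "i0 \<le> j" using False m i0 by (auto intro: order_trans)
      have "2 * l \<le> a * (real j / c) powr (2 / r)"
      proof -
        have "b * l powr (r / 2) \<le> real j / c" using jD(1) c by (simp add: D_def field_simps)
        then have "(b * l powr (r / 2)) powr (2 / r) \<le> (real j / c) powr (2 / r)"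
          using b r by (intro powr_mono2) auto
        moreover have "(b * l powr (r / 2)) powr (2 / r) = 2 / a * l"
          using a r l by (simp add: b_def powr_mult powr_powr)
        ultimately show ?thesis using a by (simp add: field_simps)
      qed
      also have "\<dots> = (real n / c) powr (2 / r) * (a * (real j / real n) powr (2 / r))"
        using n c jD by (simp add: powr_divide)
      also have "\<dots> \<le> (real n / c) powr (2 / r) * d j"
        using low[OF jD(3) j] by (intro mult_left_mono) auto
      finally have "exp_var r n d c j \<le> real n * exp (- (2 * l))"
        unfolding exp_var_def by (intro mult_left_mono) auto
      also have "exp (- (2 * l)) = 1 / (real n * real n)"
      proof -
        have "exp (2 * l) = exp l * exp l" by (simp flip: exp_add)
        then show ?thesis using n0 by (simp add: l_def exp_minus inverse_eq_divide)
      qed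
      also have "real n * \<dots> = 1 / real n" using n0 by simp
      finally have "exp_var r n d c j \<le> 1 / real n" .
      moreover have "ln (1 + exp_var r n d c j) \<le> exp_var r n d c j"
        by (rule ln_add_one_self_le_self) (rule v0)
      ultimately show ?thesis using False by simp
    qed
    have "(\<Sum>j<n. ln (1 + exp_var r n d c j)) \<le> (\<Sum>j<n. (if j < max i0 m then 2 * l else 0) + 1 / real n)"
      by (intro sum_mono bound) auto
    also have "\<dots> = (\<Sum>j<n. if j < max i0 m then 2 * l else 0) + 1"
      using n by (simp add: sum.distrib)
    also have "(\<Sum>j<n. if j < max i0 m then 2 * l else 0) \<le> real (max i0 m) * (2 * l)"
      using l by (intro sum_if_less_le) auto
    also have "real (max i0 m) * (2 * l) \<le> (real i0 + D + 1) * (2 * l)"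
      using m D l by (intro mult_right_mono) (auto simp: max_def)
    also have "(real i0 + D + 1) * (2 * l) + 1 \<le> C * (c * l powr (1 + r / 2))"
    proof -
      define q where "q = l powr (r / 2)"
      have q: "q \<ge> 1" using l r by (simp add: q_def ge_one_powr_ge_zero)
      have lq: "l powr (1 + r / 2) = l * q" using l by (simp add: q_def powr_add)
      have cq: "c * q \<ge> 1" using mult_mono[of 1 c 1 q] c q by simp
      have "real i0 + D + 1 \<le> (real i0 + b + 1) * (c * q)"
      proof -
        have "(real i0 + 1) * 1 \<le> (real i0 + 1) * (c * q)" using cq by (intro mult_left_mono) auto
        then show ?thesis by (simp add: D_def q_def[symmetric] algebra_simps)
      qed
      then have "(real i0 + D + 1) * (2 * l) \<le> (real i0 + b + 1) * (c * q) * (2 * l)"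
        using l by (intro mult_right_mono) auto
      moreover have "1 \<le> c * q * l" using mult_mono[of 1 "c * q" 1 l] cq l by simp
      ultimately show ?thesis unfolding lq by (simp add: C_def algebra_simps)
    qed
    finally show "(\<Sum>j<n. ln (1 + exp_var r n d c j)) \<le> C * (c * ln (real n) powr (1 + r / 2))"
      by (simp add: l_def)
  qed
qed

section \<open>Smooth functions on graphs\<close>

text \<open>With variance x^(-\<gamma>) and \<gamma> = \<alpha> + r/2, the weight 1 / (1 + 2v) is at
  most min(1, x^\<gamma>), and this is at most x^\<beta> because \<beta> does not exceed \<gamma>.
  The weight is thus dominated by the Sobolev weight times a power of c.\<close>

lemma power_smooth_cost:
  fixes d g :: "nat \<Rightarrow> real"
  assumes r: "r \<ge> 1" and \<alpha>: "\<alpha> > 0" and \<beta>: "\<beta> > 0" "\<beta> \<le> \<alpha> + r / 2" and n: "n \<ge> 1" and c: "c > 0"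
    and d: "\<And>j. j < n \<Longrightarrow> d j \<ge> 0"
    and g: "(\<Sum>j<n. (1 + (real n powr (2 / r) * d j) powr \<beta>) * (g j)\<^sup>2) \<le> S"
  shows "(\<Sum>j<n. (g j)\<^sup>2 / (1 + 2 * power_var r \<alpha> n d c j)) \<le> 2 powr \<beta> * c powr (- (2 * \<beta> / r)) * S"
proof -
  let ?b = "2 powr \<beta> * c powr (- (2 * \<beta> / r))"
  have "(\<Sum>j<n. (g j)\<^sup>2 / (1 + 2 * power_var r \<alpha> n d c j)) \<le>
      (\<Sum>j<n. ?b * ((1 + (real n powr (2 / r) * d j) powr \<beta>) * (g j)\<^sup>2))"
  proof (intro sum_mono)
    fix j assume "j \<in> {..<n}"
    then have dj: "d j \<ge> 0" using d by simp
    define \<gamma> where "\<gamma> = \<alpha> + r / 2"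
    define y where "y = d j + 1 / (real n)\<^sup>2"
    have y: "y > 0" using dj n by (auto simp: y_def intro!: add_nonneg_pos)
    define x where "x = (real n / c) powr (2 / r) * y"
    have x: "x > 0" using y n c by (simp add: x_def)
    define z where "z = real n powr (2 / r) * d j"
    have z: "z \<ge> 0" using dj by (simp add: z_def)
    have v: "power_var r \<alpha> n d c j = inverse (x powr \<gamma>)"
      by (simp add: power_var_def x_def y_def \<gamma>_def)
    have "1 / (1 + 2 * inverse (x powr \<gamma>)) \<le> x powr \<beta>"
    proof (cases "x \<le> 1")
      case True
      have "x powr \<gamma> > 0" using x by simp
      then have "1 / (1 + 2 * inverse (x powr \<gamma>)) \<le> x powr \<gamma>"
        by (simp add: field_simps add_pos_pos)
      also have "\<dots> \<le> x powr \<beta>" using True x \<beta> by (intro powr_mono') (auto simp: \<gamma>_def)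
      finally show ?thesis .
    next
      case False
      have "1 / (1 + 2 * inverse (x powr \<gamma>)) \<le> 1"
        by (subst divide_le_eq_1_pos) (simp_all add: add_pos_nonneg)
      also have "\<dots> \<le> x powr \<beta>" using False \<beta> by (intro ge_one_powr_ge_zero) auto
      finally show ?thesis .
    qed
    also have "x powr \<beta> = c powr (- (2 * \<beta> / r)) * (real n powr (2 / r) * y) powr \<beta>"
      using n c y by (simp add: x_def powr_divide powr_mult powr_powr powr_minus field_simps)
    also have "\<dots> \<le> c powr (- (2 * \<beta> / r)) * (2 powr \<beta> * (1 + z powr \<beta>))"
    proof (intro mult_left_mono)
      \<comment> \<open>As r >= 1, the shift by n^(-2) contributes at most 1 to n^(2/r) y; the
        constant part of the Sobolev norm absorbs it.\<close>
      have "real n powr (2 / r) \<le> real n powr 2"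
        using n r by (intro powr_mono) (auto simp: field_simps)
      then have "real n powr (2 / r) * (1 / (real n)\<^sup>2) \<le> 1" using n by (simp add: field_simps)
      then have le: "real n powr (2 / r) * y \<le> z + 1" by (simp add: y_def z_def distrib_left)
      have "(real n powr (2 / r) * y) powr \<beta> \<le> (2 * max z 1) powr \<beta>"
        using le y n \<beta> by (intro powr_mono2) (auto simp: max_def)
      also have "\<dots> = 2 powr \<beta> * max z 1 powr \<beta>" using z by (simp add: powr_mult)
      also have "\<dots> \<le> 2 powr \<beta> * (1 + z powr \<beta>)"
        by (intro mult_left_mono) (auto simp: max_def)
      finally show "(real n powr (2 / r) * y) powr \<beta> \<le> 2 powr \<beta> * (1 + z powr \<beta>)" .
    qed simp
    finally have "(g j)\<^sup>2 * (1 / (1 + 2 * inverse (x powr \<gamma>))) \<le>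
        (g j)\<^sup>2 * (c powr (- (2 * \<beta> / r)) * (2 powr \<beta> * (1 + z powr \<beta>)))"
      by (rule mult_left_mono) simp
    then show "(g j)\<^sup>2 / (1 + 2 * power_var r \<alpha> n d c j) \<le>
        ?b * ((1 + (real n powr (2 / r) * d j) powr \<beta>) * (g j)\<^sup>2)"
      by (simp add: v z_def mult_ac)
  qed
  also have "\<dots> = ?b * (\<Sum>j<n. (1 + (real n powr (2 / r) * d j) powr \<beta>) * (g j)\<^sup>2)"
    by (rule sum_distrib_left[symmetric])
  also have "\<dots> \<le> ?b * S" using g by (intro mult_left_mono) auto
  finally show ?thesis .
qed

text \<open>Where the exponent x is at most 1, the variance is at least n / e and the weight at most
  3/n. Where x > 1, the trivial weight 1 is at most x^\<beta>. No relation between \<beta> and the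
  prior arises.\<close>

lemma exp_smooth_cost:
  fixes d g :: "nat \<Rightarrow> real"
  assumes r: "r \<ge> 1" and \<beta>: "\<beta> > 0" and n: "n \<ge> 1" and c: "c > 0"
    and d: "\<And>j. j < n \<Longrightarrow> d j \<ge> 0"
    and g: "(\<Sum>j<n. (1 + (real n powr (2 / r) * d j) powr \<beta>) * (g j)\<^sup>2) \<le> S"
  shows "(\<Sum>j<n. (g j)\<^sup>2 / (1 + 2 * exp_var r n d c j)) \<le> (3 / real n + c powr (- (2 * \<beta> / r))) * S"
proof -
  let ?b = "3 / real n + c powr (- (2 * \<beta> / r))"
  have "(\<Sum>j<n. (g j)\<^sup>2 / (1 + 2 * exp_var r n d c j)) \<le>
      (\<Sum>j<n. ?b * ((1 + (real n powr (2 / r) * d j) powr \<beta>) * (g j)\<^sup>2))"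
  proof (intro sum_mono)
    fix j assume "j \<in> {..<n}"
    then have dj: "d j \<ge> 0" using d by simp
    define x where "x = (real n / c) powr (2 / r) * d j"
    define z where "z = (real n powr (2 / r) * d j) powr \<beta>"
    have x: "x \<ge> 0" using dj by (simp add: x_def)
    have xz: "x powr \<beta> = c powr (- (2 * \<beta> / r)) * z"
      using n c dj by (simp add: x_def z_def powr_divide powr_mult powr_powr powr_minus field_simps)
    have "1 / (1 + 2 * exp_var r n d c j) \<le> 3 / real n + x powr \<beta>"
    proof (cases "x \<le> 1")
      case True
      have "exp x \<le> 3" using True exp_le order_trans[of "exp x" "exp 1" 3] by simp
      have "1 / (1 + 2 * exp_var r n d c j) \<le> 1 / (real n * exp (- x))"
        using n by (intro divide_left_mono) (auto simp: exp_var_def x_def add_pos_nonneg)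
      also have "\<dots> = exp x / real n" by (simp add: exp_minus field_simps)
      also have "\<dots> \<le> 3 / real n" using \<open>exp x \<le> 3\<close> by (intro divide_right_mono) auto
      finally show ?thesis by (simp add: add_increasing2)
    next
      case False
      have "1 / (1 + 2 * exp_var r n d c j) \<le> 1"
        by (subst divide_le_eq_1_pos) (simp_all add: exp_var_def add_pos_nonneg)
      also have "\<dots> \<le> x powr \<beta>" using False \<beta> by (intro ge_one_powr_ge_zero) auto
      finally show ?thesis by (simp add: add_increasing)
    qed
    also have "\<dots> \<le> ?b * (1 + z)"
    proof -
      have "z \<ge> 0" by (simp add: z_def)
      then have "0 \<le> 3 / real n * z + c powr (- (2 * \<beta> / r))" by simp
      moreover have "?b * (1 + z) = (3 / real n + x powr \<beta>) + (3 / real n * z + c powr (- (2 * \<beta> / r)))"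
        unfolding xz by (simp add: distrib_left distrib_right)
      ultimately show ?thesis by linarith
    qed
    finally have "(g j)\<^sup>2 * (1 / (1 + 2 * exp_var r n d c j)) \<le> (g j)\<^sup>2 * (?b * (1 + z))"
      by (rule mult_left_mono) simp
    then show "(g j)\<^sup>2 / (1 + 2 * exp_var r n d c j) \<le>
        ?b * ((1 + (real n powr (2 / r) * d j) powr \<beta>) * (g j)\<^sup>2)"
      unfolding z_def[symmetric] by (simp add: mult_ac)
  qed
  also have "\<dots> = ?b * (\<Sum>j<n. (1 + (real n powr (2 / r) * d j) powr \<beta>) * (g j)\<^sup>2)"
    by (rule sum_distrib_left[symmetric])
  also have "\<dots> \<le> ?b * S" using g by (intro mult_left_mono) auto
  finally show ?thesis .
qed

section \<open>Balancing bias and complexity for Sobolev truths\<close>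

locale smooth_truth_on_graphs =
  fixes r \<beta> C K :: real and N :: "nat set" and G :: "nat \<Rightarrow> nat pair_pre_digraph"
    and \<Psi> :: "real \<Rightarrow> real" and p0 f0 :: "nat \<Rightarrow> nat \<Rightarrow> real"
  assumes r: "r \<ge> 1" and \<beta>: "\<beta> > 0" and C: "C > 0"
    and graphs: "\<And>n. n \<in> N \<Longrightarrow> conn_graph n (G n)"
    and geometry: "geometry_condition r N G"
    and link: "bernoulli_link \<Psi> K"
    and p0: "\<And>n i. n \<in> N \<Longrightarrow> i < n \<Longrightarrow> p0 n i = \<Psi> (f0 n i)"
    and smooth: "\<And>n. n \<in> N \<Longrightarrow> f0 n \<in> sobolev_ball r n (G n) \<beta> C"
begin

definition rate :: "nat \<Rightarrow> real" where
  "rate n = real n powr (- (\<beta> / (r + 2 * \<beta>)))"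

text \<open>The prior mass near the truth is bounded below by restricting \<open>c\<close> to this order of magnitude,
  for which bias and complexity balance.\<close>

definition scale :: "nat \<Rightarrow> real" where
  "scale n = real n powr (r / (r + 2 * \<beta>))"

lemma scale_exponent: "0 < r / (r + 2 * \<beta>)" "1 + 2 * (- (\<beta> / (r + 2 * \<beta>))) = r / (r + 2 * \<beta>)"
  using r \<beta> by (auto simp: field_simps)

lemma scale_ge_1: "n \<ge> 1 \<Longrightarrow> scale n \<ge> 1"
  using scale_exponent by (simp add: scale_def ge_one_powr_ge_zero)

lemma rate_square: "n \<ge> 1 \<Longrightarrow> real n * (rate n)\<^sup>2 = scale n"
proof -
  assume n: "n \<ge> 1"
  have "(rate n)\<^sup>2 = real n powr (2 * (- (\<beta> / (r + 2 * \<beta>))))"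
    unfolding rate_def power2_eq_square powr_add[symmetric] by simp
  then have "real n * (rate n)\<^sup>2 = real n powr (1 + 2 * (- (\<beta> / (r + 2 * \<beta>))))"
    by (simp only: powr_mult_base of_nat_0_le_iff)
  then show ?thesis unfolding scale_exponent scale_def .
qed

text \<open>The exponent of \<open>scale\<close> solves n c^(-2 \<beta> / r) = c, the equality of
  squared bias and complexity; a larger \<open>c\<close> only lowers the bias.\<close>

lemma scale_bias:
  assumes n: "n \<ge> 1" and c: "scale n \<le> c"
  shows "c powr (- (2 * \<beta> / r)) * real n \<le> scale n"
proof -
  have "c powr (- (2 * \<beta> / r)) \<le> scale n powr (- (2 * \<beta> / r))"
    using c scale_ge_1[OF n] r \<beta> by (intro powr_mono2') auto
  also have "\<dots> = real n powr (2 * (- (\<beta> / (r + 2 * \<beta>))))"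
    using r \<beta> by (simp add: scale_def powr_powr field_simps)
  finally have "c powr (- (2 * \<beta> / r)) * real n \<le> real n powr (2 * (- (\<beta> / (r + 2 * \<beta>)))) * real n"
    by (rule mult_right_mono) simp
  also have "\<dots> = real n powr (1 + 2 * (- (\<beta> / (r + 2 * \<beta>))))"
    by (subst mult.commute) (simp only: powr_mult_base of_nat_0_le_iff)
  finally show ?thesis unfolding scale_exponent scale_def .
qed

lemma scale_at_top: "filterlim scale at_top sequentially"
proof -
  have "filterlim (\<lambda>n. exp (r / (r + 2 * \<beta>) * ln (real n))) at_top sequentially"
    by (intro filterlim_compose[OF exp_at_top] filterlim_tendsto_pos_mult_at_top[OF tendsto_const]
        filterlim_compose[OF ln_at_top] filterlim_real_sequentially scale_exponent(1))
  moreover have "\<forall>\<^sub>F n in sequentially. exp (r / (r + 2 * \<beta>) * ln (real n)) = scale n"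
    by (intro eventually_sequentiallyI[of 1]) (simp add: scale_def powr_def)
  ultimately show ?thesis by (simp cong: filterlim_cong)
qed

lemma ln_le_scale: "n \<ge> 1 \<Longrightarrow> ln (real n) \<le> (r + 2 * \<beta>) / r * scale n"
  using ln_le_powr[of "real n" "r / (r + 2 * \<beta>)"] scale_exponent(1) by (simp add: scale_def mult.commute)

lemma K: "K \<ge> 1"
  using link by (rule bernoulli_link.K)

lemma mixture_model_link_law:
  assumes n: "n \<in> N" and U: "U \<in> carrier_mat n n" "transpose_mat U * U = 1\<^sub>m n"
    and v: "gaussian_scale_mixture n (\<lambda>i j. U $$ (i, j)) v"
    and S: "\<And>c. spectral_fun sqrt (S c) = U * mat_diag n (\<lambda>j. sqrt (v c j)) * transpose_mat U"
  shows "mixture_model n (\<lambda>i j. U $$ (i, j)) v \<Psi> K (f0 n) (p0 n) (link_law n \<Psi> (gaussian_mixture n S))"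
proof -
  interpret V: gaussian_scale_mixture n "\<lambda>i j. U $$ (i, j)" v by (rule v)
  interpret L: bernoulli_link \<Psi> K by (rule link)
  show ?thesis
    by unfold_locales (use p0[OF n] V.gaussian_mixture_eq[OF U(1) _ S] in auto)
qed

lemma truth_coordinates:
  assumes n: "n \<in> N" "n \<ge> 1" and U: "U \<in> carrier_mat n n" "transpose_mat U * U = 1\<^sub>m n"
    and L: "laplacian n (G n) = U * mat_diag n d * transpose_mat U"
  shows "(\<Sum>j<n. (1 + (real n powr (2 / r) * d j) powr \<beta>) *
    (orthogonal_map.inv_rot n (\<lambda>i j. U $$ (i, j)) (f0 n) j)\<^sup>2) \<le> real n * C\<^sup>2"
proof -
  interpret orthogonal_map n "\<lambda>i j. U $$ (i, j)" by (rule orthogonal_map_mat[OF U])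
  show ?thesis
    using sobolev_ball_spectral[OF U L _ smooth[OF n(1)]] n(2) by (simp add: inv_rot_def)
qed

theorem power_prior_contracts:
  assumes \<alpha>: "\<alpha> > 0" "\<beta> \<le> \<alpha> + r / 2"
  shows "contracts N (\<lambda>n. power_prior \<Psi> r \<alpha> n (G n)) p0 rate"
proof -
  obtain i0 a where i0: "i0 \<ge> 1" and a: "a > 0"
    and low: "\<forall>\<^sub>F n in at_top_in N. \<forall>j. i0 \<le> j \<and> j < n \<longrightarrow>
      a * (real j / real n) powr (2 / r) \<le> laplacian_eigenvalue n (G n) j"
    using geometry_eigenvalue_lower_bound[OF r graphs geometry] by blast
  obtain C1 where C1: "C1 > 0"
    "\<And>n d c. n \<ge> 1 \<Longrightarrow> (\<And>j. j < n \<Longrightarrow> d j \<ge> 0) \<Longrightarrow>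
      (\<And>j. i0 \<le> j \<Longrightarrow> j < n \<Longrightarrow> a * (real j / real n) powr (2 / r) \<le> d j) \<Longrightarrow> c \<ge> 1 \<Longrightarrow>
      (\<Sum>j<n. ln (1 + power_var r \<alpha> n d c j)) \<le> C1 * (c + ln (real n))"
    using power_complexity_bound[OF r \<alpha>(1) i0 a] by blast
  define q where "q = (r + 2 * \<beta>) / r"
  have q: "q > 0" using r \<beta> by (simp add: q_def)
  \<comment> \<open>The complexity at c <= 2 \<open>scale\<close> costs C1 (2 + q) times
    \<open>scale\<close>, where q pays for ln n, and the bias costs
    \<open>2 powr \<beta> * C\<^sup>2\<close> times \<open>scale\<close>. The summand 1 ensures b >=
    1.\<close>
  define b where "b = C1 * (2 + q) + 2 powr \<beta> * C\<^sup>2 + 1"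
  have b: "b \<ge> 1" using C1(1) q by (simp add: b_def)
  define A where "A = 4 * K\<^sup>2 + 3"
  have A: "A \<ge> 3" by (simp add: A_def)
  define h where "h = b + C1 * (A * b + q)"
  have h: "h > 0" using b C1(1) A q by (auto simp: h_def intro!: add_pos_pos mult_pos_pos)
  show ?thesis
  proof (rule contracts_of_bounds[OF K, where \<Psi> = \<Psi> and B = "\<lambda>n. b * scale n" and H = "\<lambda>n. h * scale n" and C = h])
    have "\<forall>\<^sub>F n in at_top_in N. n \<ge> 1" unfolding eventually_at_top_in by blast
    then show "\<forall>\<^sub>F n in at_top_in N. \<exists>U v k.
        mixture_model n U v \<Psi> K (f0 n) (p0 n) (power_prior \<Psi> r \<alpha> n (G n)) \<and>
        1 \<le> k \<and> k \<le> b * scale n \<and>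
        (\<forall>c. k \<le> c \<and> c \<le> 2 * k \<longrightarrow>
          gaussian_scale_mixture.approx_cost n v (orthogonal_map.inv_rot n U (f0 n)) c \<le> b * scale n) \<and>
        b * scale n \<le> h * scale n \<and>
        gaussian_scale_mixture.complexity n v ((4 * K\<^sup>2 + 3) * (b * scale n)) \<le> h * scale n \<and>
        h * scale n \<le> h * (real n * (rate n)\<^sup>2)"
      using low eventually_at_top_in_mem
    proof eventually_elim
      case (elim n)
      define d where "d = laplacian_eigenvalue n (G n)"
      obtain U where U: "U \<in> carrier_mat n n" "transpose_mat U * U = 1\<^sub>m n"
        and L: "laplacian n (G n) = U * mat_diag n d * transpose_mat U" and d: "\<And>j. j < n \<Longrightarrow> d j \<ge> 0"
        using laplacian_spectral[OF graphs[OF elim(3)]] unfolding d_def by metis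
      let ?U = "\<lambda>i j. U $$ (i, j)" and ?v = "power_var r \<alpha> n d"
      interpret V: gaussian_scale_mixture n ?U ?v by (rule power_var_mixture[OF U r \<alpha>(1) d])
      have k: "scale n \<ge> 1" by (rule scale_ge_1[OF elim(1)])
      have lnk: "ln (real n) \<le> q * scale n" unfolding q_def by (rule ln_le_scale[OF elim(1)])
      have cplx: "V.complexity c \<le> C1 * (c + q * scale n)" if "c \<ge> 1" for c
      proof -
        have "V.complexity c \<le> C1 * (c + ln (real n))"
          unfolding V.complexity_def using elim(1,2) d that by (intro C1(2)) (auto simp: d_def)
        also have "\<dots> \<le> C1 * (c + q * scale n)" using lnk C1(1) by simp
        finally show ?thesis .
      qed
      have "mixture_model n ?U ?v \<Psi> K (f0 n) (p0 n) (power_prior \<Psi> r \<alpha> n (G n))"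
        unfolding power_prior_def
        by (rule mixture_model_link_law[OF elim(3) U V.gaussian_scale_mixture_axioms power_cov_spectral[OF U L]])
      moreover have "V.approx_cost (V.inv_rot (f0 n)) c \<le> b * scale n"
        if c: "scale n \<le> c" "c \<le> 2 * scale n" for c
      proof -
        have c1: "c \<ge> 1" using c k by simp
        have "V.approx_cost (V.inv_rot (f0 n)) c \<le>
            V.complexity c + (\<Sum>j<n. (V.inv_rot (f0 n) j)\<^sup>2 / (1 + 2 * ?v c j))"
          using c1 by (intro V.approx_cost_le) simp
        also have "\<dots> \<le> C1 * (2 * scale n + q * scale n) + 2 powr \<beta> * C\<^sup>2 * scale n"
        proof (intro add_mono)
          show "V.complexity c \<le> C1 * (2 * scale n + q * scale n)"
            using c C1(1) by (intro order_trans[OF cplx[OF c1]] mult_left_mono) auto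
          have "(\<Sum>j<n. (V.inv_rot (f0 n) j)\<^sup>2 / (1 + 2 * ?v c j)) \<le>
              2 powr \<beta> * c powr (- (2 * \<beta> / r)) * (real n * C\<^sup>2)"
            using c1 by (intro power_smooth_cost[OF r \<alpha>(1) \<beta> \<alpha>(2) elim(1) _ d]
                truth_coordinates[OF elim(3,1) U L]) auto
          also have "\<dots> = 2 powr \<beta> * C\<^sup>2 * (c powr (- (2 * \<beta> / r)) * real n)" by simp
          also have "\<dots> \<le> 2 powr \<beta> * C\<^sup>2 * scale n"
            by (intro mult_left_mono scale_bias[OF elim(1) c(1)]) auto
          finally show "(\<Sum>j<n. (V.inv_rot (f0 n) j)\<^sup>2 / (1 + 2 * ?v c j)) \<le> 2 powr \<beta> * C\<^sup>2 * scale n" .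
        qed
        also have "\<dots> \<le> b * scale n" using k by (simp add: b_def algebra_simps)
        finally show ?thesis .
      qed
      moreover have "V.complexity (A * (b * scale n)) \<le> h * scale n"
      proof -
        have "1 \<le> A * (b * scale n)"
          using mult_mono[of 1 A 1 "b * scale n"] mult_mono[of 1 b 1 "scale n"] A b k by simp
        from cplx[OF this] have "V.complexity (A * (b * scale n)) \<le> C1 * (A * b + q) * scale n"
          by (simp add: algebra_simps)
        also have "\<dots> \<le> h * scale n" using b k by (simp add: h_def mult_right_mono)
        finally show ?thesis .
      qed
      moreover have "scale n \<le> b * scale n" using b k by simp
      moreover have "b * scale n \<le> h * scale n"
        using k C1(1) A b q by (intro mult_right_mono) (auto simp: h_def)
      ultimately show ?case
        using k rate_square[OF elim(1)] unfolding A_def by (intro exI[of _ ?U] exI[of _ ?v] exI[of _ "scale n"]) auto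
    qed
    show "filterlim (\<lambda>n. b * scale n) at_top (at_top_in N)"
      using b by (intro filterlim_tendsto_pos_mult_at_top[OF tendsto_const]
          filterlim_mono[OF scale_at_top order_refl at_top_in_le]) auto
  qed (use h in \<open>auto simp: rate_def\<close>)
qed

text \<open>The window for the scale has the order \<open>scale n\<close>, but the prior mass
  exponent there is larger by the factor \<open>l n\<close>. The cutoff is proportional to this
  exponent and its complexity brings in \<open>l n\<close> again. Hence the square in
  \<open>H\<close>, which matches the square of the claimed rate.\<close>

theorem exp_prior_contracts:
  "contracts N (\<lambda>n. exp_prior \<Psi> r n (G n)) p0 (\<lambda>n. rate n * ln (real n) powr (1 + r / 2))"
proof -
  obtain i0 a where i0: "i0 \<ge> 1" and a: "a > 0"
    and low: "\<forall>\<^sub>F n in at_top_in N. \<forall>j. i0 \<le> j \<and> j < n \<longrightarrow>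
      a * (real j / real n) powr (2 / r) \<le> laplacian_eigenvalue n (G n) j"
    using geometry_eigenvalue_lower_bound[OF r graphs geometry] by blast
  define l where "l n = ln (real n) powr (1 + r / 2)" for n :: nat
  obtain C1 where C1: "C1 > 0"
    "\<And>n d c. n \<ge> 3 \<Longrightarrow> (\<And>j. j < n \<Longrightarrow> d j \<ge> 0) \<Longrightarrow>
      (\<And>j. i0 \<le> j \<Longrightarrow> j < n \<Longrightarrow> a * (real j / real n) powr (2 / r) \<le> d j) \<Longrightarrow> c \<ge> 1 \<Longrightarrow>
      (\<Sum>j<n. ln (1 + exp_var r n d c j)) \<le> C1 * (c * l n)"
    using exp_complexity_bound[OF r i0 a] unfolding l_def by blast
  \<comment> \<open>Twice \<open>C1\<close> for c <= 2 \<open>scale\<close>; the bias gives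
    \<open>3 * C\<^sup>2\<close> from the coordinates of large variance and \<open>C\<^sup>2\<close>
    from the others.\<close>
  define b where "b = 2 * C1 + 4 * C\<^sup>2 + 1"
  have b: "b \<ge> 1" using C1(1) by (simp add: b_def)
  define A where "A = 4 * K\<^sup>2 + 3"
  have A: "A \<ge> 3" by (simp add: A_def)
  define h where "h = b + C1 * A * b"
  have h: "h > 0" using b C1(1) A by (auto simp: h_def intro!: add_pos_pos mult_pos_pos)
  have l1: "l n \<ge> 1" if "n \<ge> 3" for n
  proof -
    have "ln (real n) \<ge> 1" using that exp_le by (subst ln_ge_iff) auto
    then show ?thesis unfolding l_def using r by (intro ge_one_powr_ge_zero) auto
  qed
  have large: "\<forall>\<^sub>F n in at_top_in N. n \<ge> 3" unfolding eventually_at_top_in by blast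
  show ?thesis
  proof (rule contracts_of_bounds[OF K, where \<Psi> = \<Psi> and B = "\<lambda>n. b * (scale n * l n)"
        and H = "\<lambda>n. h * (scale n * (l n)\<^sup>2)" and C = h])
    show "\<forall>\<^sub>F n in at_top_in N. \<exists>U v k.
        mixture_model n U v \<Psi> K (f0 n) (p0 n) (exp_prior \<Psi> r n (G n)) \<and>
        1 \<le> k \<and> k \<le> b * (scale n * l n) \<and>
        (\<forall>c. k \<le> c \<and> c \<le> 2 * k \<longrightarrow>
          gaussian_scale_mixture.approx_cost n v (orthogonal_map.inv_rot n U (f0 n)) c \<le> b * (scale n * l n)) \<and>
        b * (scale n * l n) \<le> h * (scale n * (l n)\<^sup>2) \<and>
        gaussian_scale_mixture.complexity n v ((4 * K\<^sup>2 + 3) * (b * (scale n * l n))) \<le> h * (scale n * (l n)\<^sup>2) \<and>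
        h * (scale n * (l n)\<^sup>2) \<le> h * (real n * (rate n * ln (real n) powr (1 + r / 2))\<^sup>2)"
      using large low eventually_at_top_in_mem
    proof eventually_elim
      case (elim n)
      define d where "d = laplacian_eigenvalue n (G n)"
      have n1: "n \<ge> 1" using elim(1) by simp
      obtain U where U: "U \<in> carrier_mat n n" "transpose_mat U * U = 1\<^sub>m n"
        and L: "laplacian n (G n) = U * mat_diag n d * transpose_mat U" and d: "\<And>j. j < n \<Longrightarrow> d j \<ge> 0"
        using laplacian_spectral[OF graphs[OF elim(3)]] unfolding d_def by metis
      let ?U = "\<lambda>i j. U $$ (i, j)" and ?v = "exp_var r n d"
      interpret V: gaussian_scale_mixture n ?U ?v by (rule exp_var_mixture[OF U r d])
      define k where "k = scale n"
      define w where "w = l n"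
      have k: "k \<ge> 1" unfolding k_def by (rule scale_ge_1[OF n1])
      have w: "w \<ge> 1" unfolding w_def by (rule l1[OF elim(1)])
      have kw: "k \<le> k * w" using k w by simp
      have cplx: "V.complexity c \<le> C1 * (c * w)" if "c \<ge> 1" for c
        unfolding V.complexity_def w_def using elim(1,2) d that by (intro C1(2)) (auto simp: d_def)
      have model: "mixture_model n ?U ?v \<Psi> K (f0 n) (p0 n) (exp_prior \<Psi> r n (G n))"
        unfolding exp_prior_def
        by (rule mixture_model_link_law[OF elim(3) U V.gaussian_scale_mixture_axioms exp_cov_spectral[OF U L]])
      have cost: "V.approx_cost (V.inv_rot (f0 n)) c \<le> b * (k * w)" if c: "k \<le> c" "c \<le> 2 * k" for c
      proof -
        have c1: "c \<ge> 1" using c k by simp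
        have "V.approx_cost (V.inv_rot (f0 n)) c \<le>
            V.complexity c + (\<Sum>j<n. (V.inv_rot (f0 n) j)\<^sup>2 / (1 + 2 * ?v c j))"
          using c1 by (intro V.approx_cost_le) simp
        also have "\<dots> \<le> C1 * (2 * k * w) + 4 * C\<^sup>2 * k"
        proof (intro add_mono)
          show "V.complexity c \<le> C1 * (2 * k * w)"
            using c C1(1) w by (intro order_trans[OF cplx[OF c1]] mult_left_mono mult_right_mono) auto
          have "(\<Sum>j<n. (V.inv_rot (f0 n) j)\<^sup>2 / (1 + 2 * ?v c j)) \<le>
              (3 / real n + c powr (- (2 * \<beta> / r))) * (real n * C\<^sup>2)"
            using c1 by (intro exp_smooth_cost[OF r \<beta> n1 _ d] truth_coordinates[OF elim(3) n1 U L]) auto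
          also have "\<dots> = C\<^sup>2 * (3 + c powr (- (2 * \<beta> / r)) * real n)"
            using n1 by (simp add: field_simps)
          also have "\<dots> \<le> C\<^sup>2 * (3 * k + k)"
            using scale_bias[OF n1, of c] c k by (intro mult_left_mono add_mono) (auto simp: k_def)
          finally show "(\<Sum>j<n. (V.inv_rot (f0 n) j)\<^sup>2 / (1 + 2 * ?v c j)) \<le> 4 * C\<^sup>2 * k" by simp
        qed
        also have "\<dots> \<le> b * (k * w)"
        proof -
          have "4 * C\<^sup>2 * k \<le> 4 * C\<^sup>2 * (k * w)" using kw by (intro mult_left_mono) auto
          moreover have "0 \<le> k * w" using k w by simp
          ultimately show ?thesis by (simp add: b_def algebra_simps)
        qed
        finally show ?thesis .
      qed
      have cplxA: "V.complexity (A * (b * (k * w))) \<le> h * (k * w\<^sup>2)"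
      proof -
        have "1 \<le> b * (k * w)" using mult_mono[of 1 b 1 "k * w"] b k kw by simp
        then have "1 \<le> A * (b * (k * w))" using mult_mono[of 1 A 1 "b * (k * w)"] A by simp
        from cplx[OF this] have "V.complexity (A * (b * (k * w))) \<le> C1 * A * b * (k * w\<^sup>2)"
          by (simp add: algebra_simps power2_eq_square)
        also have "\<dots> \<le> h * (k * w\<^sup>2)" using b k by (intro mult_right_mono) (auto simp: h_def)
        finally show ?thesis .
      qed
      have kb: "k \<le> b * (k * w)"
        using mult_mono[of 1 b k "k * w"] b k kw by simp
      have bh: "b * (k * w) \<le> h * (k * w\<^sup>2)"
      proof (intro mult_mono)
        show "b \<le> h" using C1(1) A b by (simp add: h_def)
        show "w \<le> w\<^sup>2" using w by (simp add: power2_eq_square)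
      qed (use b h k w in auto)
      have rate: "h * (k * w\<^sup>2) \<le> h * (real n * (rate n * ln (real n) powr (1 + r / 2))\<^sup>2)"
        using rate_square[OF n1] by (simp add: k_def w_def l_def power_mult_distrib mult.assoc[symmetric])
      show ?case
        unfolding k_def[symmetric] w_def[symmetric] A_def[symmetric]
        using model k kb cost bh cplxA rate
        by (intro exI[of _ ?U] exI[of _ ?v] exI[of _ k]) auto
    qed
    show "filterlim (\<lambda>n. b * (scale n * l n)) at_top (at_top_in N)"
    proof (rule filterlim_at_top_mono)
      show "filterlim scale at_top (at_top_in N)" by (rule filterlim_mono[OF scale_at_top order_refl at_top_in_le])
      show "\<forall>\<^sub>F n in at_top_in N. scale n \<le> b * (scale n * l n)"
        using large
      proof eventually_elim
        case (elim n)
        have k: "scale n \<ge> 1" using elim by (intro scale_ge_1) simp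
        have "scale n \<le> scale n * l n" using k l1[OF elim] by simp
        then show ?case using mult_mono[of 1 b "scale n" "scale n * l n"] b k by simp
      qed
    qed
  qed (use h in \<open>auto simp: rate_def\<close>)
qed

end

theorem theorem5p2:
  fixes r \<beta> C :: real
    and N :: "nat set"
    and G :: "nat \<Rightarrow> nat pair_pre_digraph"
    and \<Psi> :: "real \<Rightarrow> real"
    and p0 :: "nat \<Rightarrow> nat \<Rightarrow> real"
  assumes r: "r \<ge> 1"
    and N: "infinite N" "\<And>n. n \<in> N \<Longrightarrow> n > 0"
    and graphs: "\<And>n. n \<in> N \<Longrightarrow> conn_graph n (G n)"
    and geometry: "geometry_condition r N G"
    and onto: "range \<Psi> = {0<..<1}"
    and mono: "strict_mono \<Psi>"
    and diff: "\<And>x. \<Psi> differentiable (at x)"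
    and bdd: "\<exists>K. \<forall>x. \<bar>deriv \<Psi> x / (\<Psi> x * (1 - \<Psi> x))\<bar> \<le> K"
    and p0: "\<And>n i. n \<in> N \<Longrightarrow> i < n \<Longrightarrow> p0 n i \<in> {0<..<1}"
    and pos: "\<beta> > 0" "C > 0"
    and smooth: "\<And>n. n \<in> N \<Longrightarrow> (\<lambda>i. inv_into UNIV \<Psi> (p0 n i)) \<in> sobolev_ball r n (G n) \<beta> C"
  shows
    "(\<forall>\<alpha>>0. \<beta> \<le> \<alpha> + r / 2 \<longrightarrow>
        contracts N (\<lambda>n. power_prior \<Psi> r \<alpha> n (G n)) p0
          (\<lambda>n. real n powr (- (\<beta> / (r + 2 * \<beta>))))) \<and>
     (\<exists>\<kappa>>0. contracts N (\<lambda>n. exp_prior \<Psi> r n (G n)) p0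
          (\<lambda>n. real n powr (- (\<beta> / (r + 2 * \<beta>))) * (ln (real n)) powr \<kappa>))"
proof -
  obtain K0 where "\<And>x. \<bar>deriv \<Psi> x / (\<Psi> x * (1 - \<Psi> x))\<bar> \<le> K0" using bdd by blast
  then have link: "bernoulli_link \<Psi> (max K0 1)"
    by (rule bernoulli_link_of_deriv[OF onto diff])
  have p0_eq: "p0 n i = \<Psi> (inv_into UNIV \<Psi> (p0 n i))" if "n \<in> N" "i < n" for n i
    using p0[OF that] onto by (simp add: f_inv_into_f)
  interpret smooth_truth_on_graphs r \<beta> C "max K0 1" N G \<Psi> p0 "\<lambda>n i. inv_into UNIV \<Psi> (p0 n i)"
    by (rule smooth_truth_on_graphs.intro[OF r pos graphs geometry link p0_eq smooth])
  have rate: "rate = (\<lambda>n. real n powr (- (\<beta> / (r + 2 * \<beta>))))" by (simp add: fun_eq_iff rate_def)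
  show ?thesis
  proof (intro conjI allI impI exI[of _ "1 + r / 2"])
    show "contracts N (\<lambda>n. power_prior \<Psi> r \<alpha> n (G n)) p0 (\<lambda>n. real n powr (- (\<beta> / (r + 2 * \<beta>))))"
      if "\<alpha> > 0" "\<beta> \<le> \<alpha> + r / 2" for \<alpha>
      using power_prior_contracts[OF that] unfolding rate .
    show "contracts N (\<lambda>n. exp_prior \<Psi> r n (G n)) p0
        (\<lambda>n. real n powr (- (\<beta> / (r + 2 * \<beta>))) * ln (real n) powr (1 + r / 2))"
      using exp_prior_contracts unfolding rate .
  qed (use r in simp)
qed

end
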